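(* For any large prime $p\geq 2$, the finite field $\mathbb{F}_p$ contains $3$ consecutive squarefree primitive roots $n$, $n+1$, $n+2$. Furthermore, the number $N_2(3,p)$ of such triples satisfies $$N_2(3,p)=\prod_{q\geq 2}\left(1-\frac{3}{q^2}\right)\left(\frac{\varphi(p-1)}{p-1}\right)^3p+O\left(p^{1-\varepsilon}\right),$$ where the product is over all primes $q$ and $\varepsilon>0$ is an arbitrarily small number.
   Context: An element $\alpha\in\mathbb{F}_p$ is a primitive root if its multiplicative order $\mathrm{ord}_p(\alpha)$ equals $p-1$. Elements $n\in\mathbb{F}_p$ are identified with their integer representatives $0\leq n\leq p-1$, and $n+i$ is regarded as an integer when squarefreeness is considered. With $\mu$ the Möbius function ($\mu^2$ is the characteristic function of squarefree integers), $$N_2(3,p)=\#\{n\in\mathbb{F}_p:\ \mathrm{ord}_p(n+i)=p-1 \text{ and } \mu^2(n+i)=1 \text{ for } i=0,1,2\}.$$ $\varphi$ is Euler's totient function. "Large prime" means $p$ sufficiently large, and asymptotics are for $p\to\infty$. *)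

theory Defs
  imports "HOL-Number_Theory.Number_Theory" "HOL-Analysis.Analysis"
    "HOL-Computational_Algebra.Squarefree" "HOL-Library.Landau_Symbols"
begin

text \<open>
  Elements of the prime field are represented by the naturals \<open>n < p\<close>. The order \<open>ord p m\<close>
  depends only on \<open>m\<close> modulo \<open>p\<close> (and is \<open>0\<close> if \<open>p dvd m\<close>), whereas squarefreeness refers to
  the integer \<open>m\<close> itself.
\<close>

definition sqfree_primroot :: "nat \<Rightarrow> nat \<Rightarrow> bool" where
  "sqfree_primroot p m \<longleftrightarrow> ord p m = p - 1 \<and> squarefree m"

definition N2 :: "nat \<Rightarrow> nat \<Rightarrow> nat" where
  "N2 k p = card {n. n < p \<and> (\<forall>i<k. sqfree_primroot p (n + i))}"

definition sqfree_triple_const :: real where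
  "sqfree_triple_const = prodinf (\<lambda>q. if prime q then 1 - 3 / (real q)\<^sup>2 else 1)"

text \<open>\<^const>\<open>prodinf\<close> is unspecified for divergent products; here it is a genuine value.\<close>

lemma convergent_sqfree_triple_const:
  "abs_convergent_prod (\<lambda>q. if prime q then 1 - 3 / (real q)\<^sup>2 else 1)"
proof (rule summable_imp_abs_convergent_prod)
  have s: "summable (\<lambda>q. 3 * inverse ((real q)\<^sup>2))"
    by (intro summable_mult inverse_power_summable) simp
  show "summable (\<lambda>q. norm ((if prime q then 1 - 3 / (real q)\<^sup>2 else 1) - 1))"
    by (rule summable_comparison_test[OF _ s]) (auto simp: field_simps)
qed

definition primes_at_top :: "nat filter" where
  "primes_at_top = inf at_top (principal {p. prime p})"

end

theory Submission
  imports Defs "HOL-Algebra.Algebraic_Closure_Type" "Berlekamp_Zassenhaus.Finite_Field"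
begin

text \<open>
  Both conditions are expanded by Moebius inversion: \<open>n + i\<close> being a primitive root into power residue
  conditions \<open>(n + i) ^ ((p - 1) div d) = 1\<close> with \<open>d dvd p - 1\<close>, squarefreeness into divisibility by
  squares. Large \<open>d\<close> and large squares contribute little for trivial reasons. For small ones, a shift
  along the arithmetic progression and Cauchy--Schwarz reduce the count to complete sums over the prime
  field that involve six translates of \<open>n\<close>. So it suffices that for distinct \<open>c i\<close> and small \<open>d i\<close> the
  elements \<open>x + c i\<close> are simultaneously \<open>d i\<close>-th power residues for \<open>p / (\<Prod>i. d i) + O(p ^ (1 - \<delta>))\<close>
  values of \<open>x\<close>.

  This replaces Weil's bound and follows from Stepanov's method: an auxiliary polynomial of small degree
  vanishes to high order at all \<open>x\<close> with prescribed values of \<open>(x + c i) ^ ((p - 1) div d i)\<close>. It does not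
  vanish identically because the roots \<open>(x + c i) powr (1 / d i)\<close> generate an extension of degree
  \<open>\<Prod>i. d i\<close> of the rational function field, in a quantitative form.
\<close>

text \<open>Divisibility by squares has moduli unrelated to \<open>p\<close>. Cauchy--Schwarz
  removes these weights: what remains are products over two windows \<open>n + s + i\<close> and
  \<open>n + t + i\<close> with \<open>i < 3\<close>, hence six translates. This costs a square
  root, but any power saving in the complete sums is enough, so a weak form of Stepanov's method
  suffices: an error of order \<open>p / J\<close> as long as \<open>J^2 * N^2\<close> stays below a
  constant multiple of \<open>p\<close>, with \<open>N\<close> the product of the
  \<open>d i\<close>. The delicate point is the nonvanishing. If \<open>t * d = p - 1\<close>, the
  inverse of \<open>(X + c) ^ t\<close> is a \<open>d\<close>-th root of
  \<open>(X + c) / (X + c) ^ p\<close>, whose denominator is constant modulo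
  \<open>(X - z) ^ p\<close>. Polynomials of huge degree thus behave like roots of linear ones, but
  only up to order \<open>p\<close>; independence of the exact roots has to be transferred by a norm
  of degree below \<open>p\<close>. The Moebius weights of the divisors of \<open>p - 1\<close> cost
  a factor that grows slower than every power of \<open>p\<close>, so any fixed saving survives.
  With \<open>p = u ^ 100\<close>, all errors are brought down to a multiple of
  \<open>u ^ 98\<close>.\<close>

hide_const (open) up_ring.monom up_ring.coeff Polynomials.degree Polynomials.lead_coeff
  Coset.order Divisibility.prime

section \<open>Linear systems and exponent boxes\<close>

text \<open>Gaussian elimination, by induction on the equations. Arbitrary index sets allow unknowns
  and equations to be labelled by tuples; this yields both the cofactor \<open>g\<close> in
  \<open>box_mult_norm\<close> and the auxiliary polynomial in
  \<open>stepanov_bound\<close>.\<close>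

lemma homogeneous_system_nontrivial:
  fixes \<alpha> :: "'e \<Rightarrow> 'i \<Rightarrow> 'a::field"
  assumes "finite E" "finite I" "card E < card I"
  shows "\<exists>v. (\<exists>i\<in>I. v i \<noteq> 0) \<and> (\<forall>e\<in>E. (\<Sum>i\<in>I. \<alpha> e i * v i) = 0)"
  using assms
proof (induction E arbitrary: I \<alpha> rule: finite_induct)
  case empty
  then have "I \<noteq> {}" by auto
  then show ?case by (intro exI[of _ "\<lambda>_. 1"]) auto
next
  case (insert e E)
  show ?case
  proof (cases "\<forall>i\<in>I. \<alpha> e i = 0")
    case True
    from insert have "card E < card I" by simp
    from insert.IH[OF insert.prems(1) this, of \<alpha>] True show ?thesis by auto
  next
    case False
    then obtain j where j: "j \<in> I" "\<alpha> e j \<noteq> 0" by auto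
    \<comment> \<open>Equation \<open>e\<close> is solved for the unknown \<open>j\<close>;
      \<open>\<beta>\<close> is the system that remains for the other unknowns.\<close>
    define \<beta> where "\<beta> = (\<lambda>f i. \<alpha> f i - \<alpha> f j * \<alpha> e i / \<alpha> e j)"
    have "card E < card (I - {j})" using insert j by simp
    from insert.IH[OF _ this, of \<beta>] insert.prems obtain v where
      v: "\<exists>i\<in>I-{j}. v i \<noteq> 0" "\<forall>f\<in>E. (\<Sum>i\<in>I-{j}. \<beta> f i * v i) = 0" by auto
    define x where "x = - (\<Sum>i\<in>I-{j}. \<alpha> e i * v i) / \<alpha> e j"
    have split: "(\<Sum>i\<in>I. \<alpha> f i * (v(j := x)) i) = \<alpha> f j * x + (\<Sum>i\<in>I-{j}. \<alpha> f i * v i)" for f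
      by (subst sum.remove[OF insert.prems(1) j(1)]) (auto intro!: arg_cong2[where f="(+)"] sum.cong)
    have "(\<Sum>i\<in>I. \<alpha> f i * (v(j := x)) i) = 0" if "f \<in> insert e E" for f
    proof (cases "f = e")
      case True
      then show ?thesis using split[of e] j by (simp add: x_def)
    next
      case False
      have "(\<Sum>i\<in>I-{j}. \<beta> f i * v i)
          = (\<Sum>i\<in>I-{j}. \<alpha> f i * v i) - (\<Sum>i\<in>I-{j}. \<alpha> f j / \<alpha> e j * (\<alpha> e i * v i))"
        unfolding \<beta>_def sum_subtractf[symmetric] by (intro sum.cong) (auto simp: algebra_simps)
      also have "\<dots> = (\<Sum>i\<in>I-{j}. \<alpha> f i * v i) + \<alpha> f j * x"
        unfolding x_def sum_distrib_left[symmetric] by simp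
      finally show ?thesis unfolding split using v(2) that False by (simp add: add.commute)
    qed
    moreover have "\<exists>i\<in>I. (v(j := x)) i \<noteq> 0" using v(1) by auto
    ultimately show ?thesis by blast
  qed
qed

lemma sum_rotate:
  "(\<Sum>x\<in>A. \<Sum>y\<in>B. \<Sum>z\<in>C. f x y z) = (\<Sum>y\<in>B. \<Sum>z\<in>C. \<Sum>x\<in>A. f x y z)"
  by (subst sum.swap, rule sum.cong[OF refl], rule sum.swap)

lemma smult_sum_right: "smult c (sum f A) = (\<Sum>x\<in>A. smult c (f x))"
  by (induction A rule: infinite_finite_induct) (simp_all add: smult_add_right)

text \<open>A family \<open>r\<close> indexed by \<open>exp_box I d\<close> stands for the element \<open>\<Sum>b. r b * (\<Prod>i\<in>I. Y i ^ b i)\<close> of the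
  ring obtained by adjoining generators with \<open>Y i ^ d i = l i\<close>; \<open>box_mult\<close> is multiplication in this ring.\<close>

definition exp_box :: "'i set \<Rightarrow> ('i \<Rightarrow> nat) \<Rightarrow> ('i \<Rightarrow> nat) set" where
  "exp_box I d = PiE I (\<lambda>i. {..<d i})"

definition exp_red :: "'i set \<Rightarrow> ('i \<Rightarrow> nat) \<Rightarrow> ('i \<Rightarrow> nat) \<Rightarrow> 'i \<Rightarrow> nat" where
  "exp_red I d b = (\<lambda>i\<in>I. b i mod d i)"

definition exp_carry :: "'i set \<Rightarrow> ('i \<Rightarrow> nat) \<Rightarrow> ('i \<Rightarrow> 'a::comm_ring_1) \<Rightarrow> ('i \<Rightarrow> nat) \<Rightarrow> 'a" where
  "exp_carry I d l b = (\<Prod>i\<in>I. l i ^ (b i div d i))"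

definition box_mult :: "'i set \<Rightarrow> ('i \<Rightarrow> nat) \<Rightarrow> ('i \<Rightarrow> 'a::comm_ring_1) \<Rightarrow>
    (('i \<Rightarrow> nat) \<Rightarrow> 'a) \<Rightarrow> (('i \<Rightarrow> nat) \<Rightarrow> 'a) \<Rightarrow> ('i \<Rightarrow> nat) \<Rightarrow> 'a" where
  "box_mult I d l r s b = (\<Sum>b1\<in>exp_box I d. \<Sum>b2\<in>exp_box I d.
     if exp_red I d (\<lambda>i. b1 i + b2 i) = b then r b1 * s b2 * exp_carry I d l (\<lambda>i. b1 i + b2 i) else 0)"

definition box_eval :: "'i set \<Rightarrow> ('i \<Rightarrow> nat) \<Rightarrow> ('a \<Rightarrow> 'b::comm_ring_1) \<Rightarrow> ('i \<Rightarrow> 'b) \<Rightarrow>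
    (('i \<Rightarrow> nat) \<Rightarrow> 'a) \<Rightarrow> 'b" where
  "box_eval I d \<phi> Y r = (\<Sum>b\<in>exp_box I d. \<phi> (r b) * (\<Prod>i\<in>I. Y i ^ b i))"

lemma finite_exp_box [simp]: "finite I \<Longrightarrow> finite (exp_box I d)"
  by (auto simp: exp_box_def intro: finite_PiE)

lemma card_exp_box: "finite I \<Longrightarrow> card (exp_box I d) = (\<Prod>i\<in>I. d i)"
  by (simp add: exp_box_def card_PiE)

lemma exp_red_in_exp_box: "(\<And>i. i \<in> I \<Longrightarrow> d i > 0) \<Longrightarrow> exp_red I d b \<in> exp_box I d"
  by (auto simp: exp_red_def exp_box_def)

lemma exp_box_zero: "(\<And>i. i \<in> I \<Longrightarrow> d i > 0) \<Longrightarrow> (\<lambda>i\<in>I. 0) \<in> exp_box I d"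
  by (auto simp: exp_box_def)

lemma sum_exp_box_insert:
  assumes "finite I" "j \<notin> I"
  shows "(\<Sum>b\<in>exp_box (insert j I) d. f b) = (\<Sum>\<beta><d j. \<Sum>b\<in>exp_box I d. f (b(j := \<beta>)))"
proof -
  have "(\<Sum>b\<in>exp_box (insert j I) d. f b) = (\<Sum>(\<beta>, b)\<in>{..<d j} \<times> exp_box I d. f (b(j := \<beta>)))"
    unfolding exp_box_def PiE_insert_eq
    by (subst sum.reindex[OF inj_combinator[OF assms(2)]]) (auto intro!: sum.cong simp: exp_box_def)
  then show ?thesis by (simp add: sum.cartesian_product)
qed

text \<open>Two embeddings of polynomials into power series share these facts: the expansion
  \<open>fps_at z\<close> at a point, and the same followed by the substitution of
  \<open>X ^ d\<close> for \<open>X\<close>, which makes room for a ramified root.\<close>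

locale ring_morphism =
  fixes \<phi> :: "'a::comm_ring_1 \<Rightarrow> 'b::comm_ring_1"
  assumes map_one: "\<phi> 1 = 1" and map_add: "\<phi> (x + y) = \<phi> x + \<phi> y" and map_mult: "\<phi> (x * y) = \<phi> x * \<phi> y"
begin

lemma map_zero: "\<phi> 0 = 0"
  using map_add[of 0 0] by simp

lemma map_power: "\<phi> (x ^ n) = \<phi> x ^ n"
  by (induction n) (simp_all add: map_one map_mult)

lemma map_sum: "\<phi> (sum f A) = (\<Sum>x\<in>A. \<phi> (f x))"
  by (induction A rule: infinite_finite_induct) (simp_all add: map_zero map_add)

lemma map_prod: "\<phi> (prod f A) = (\<Prod>x\<in>A. \<phi> (f x))"
  by (induction A rule: infinite_finite_induct) (simp_all add: map_one map_mult)

end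

lemma dvd_diff_mult:
  fixes q :: "'a::comm_ring_1"
  assumes "q dvd a - b" "q dvd c - d"
  shows "q dvd a * c - b * d"
proof -
  have "a * c - b * d = (a - b) * c + b * (c - d)" by (simp add: algebra_simps)
  then show ?thesis using assms by (simp add: dvd_add)
qed

lemma dvd_diff_power:
  fixes q :: "'a::comm_ring_1"
  assumes "q dvd a - b"
  shows "q dvd a ^ n - b ^ n"
  by (induction n) (use assms in \<open>auto intro: dvd_diff_mult\<close>)

lemma dvd_diff_prod:
  fixes q :: "'a::comm_ring_1"
  assumes "\<And>i. i \<in> I \<Longrightarrow> q dvd f i - g i"
  shows "q dvd prod f I - prod g I"
  using assms by (induction I rule: infinite_finite_induct) (auto intro: dvd_diff_mult)

text \<open>The relations \<open>Y i ^ d i = l i\<close> are demanded only modulo \<open>q\<close>.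
  Taking \<open>q = 0\<close> treats genuine roots; \<open>q = X ^ p\<close> treats series that are
  roots only up to order \<open>p\<close>.\<close>

lemma (in ring_morphism) box_eval_mult:
  assumes "finite I" "\<And>i. i \<in> I \<Longrightarrow> d i > 0"
    and Y: "\<And>i. i \<in> I \<Longrightarrow> q dvd Y i ^ d i - \<phi> (l i)"
  shows "q dvd box_eval I d \<phi> Y r * box_eval I d \<phi> Y s - box_eval I d \<phi> Y (box_mult I d l r s)"
proof -
  let ?B = "exp_box I d"
  let ?y = "\<lambda>b. \<Prod>i\<in>I. Y i ^ b i"
  let ?c = "\<lambda>b1 b2. exp_carry I d l (\<lambda>i. b1 i + b2 i)" and ?m = "\<lambda>b1 b2. exp_red I d (\<lambda>i. b1 i + b2 i)"
  have "box_eval I d \<phi> Y (box_mult I d l r s)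
      = (\<Sum>b\<in>?B. \<Sum>b1\<in>?B. \<Sum>b2\<in>?B. if ?m b1 b2 = b then \<phi> (r b1 * s b2 * ?c b1 b2) * ?y b else 0)"
    unfolding box_eval_def box_mult_def map_sum sum_distrib_right
    by (intro sum.cong refl) (simp add: map_zero)
  also have "\<dots> = (\<Sum>b1\<in>?B. \<Sum>b2\<in>?B. \<Sum>b\<in>?B. if ?m b1 b2 = b then \<phi> (r b1 * s b2 * ?c b1 b2) * ?y b else 0)"
    by (rule sum_rotate)
  also have "\<dots> = (\<Sum>b1\<in>?B. \<Sum>b2\<in>?B. \<phi> (r b1 * s b2 * ?c b1 b2) * ?y (?m b1 b2))"
    by (intro sum.cong refl, subst sum.delta') (simp_all add: assms(1) exp_red_in_exp_box[OF assms(2)])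
  finally have e: "box_eval I d \<phi> Y r * box_eval I d \<phi> Y s - box_eval I d \<phi> Y (box_mult I d l r s)
     = (\<Sum>b1\<in>?B. \<Sum>b2\<in>?B. \<phi> (r b1) * \<phi> (s b2) * (?y b1 * ?y b2 - \<phi> (?c b1 b2) * ?y (?m b1 b2)))"
    by (simp add: box_eval_def sum_product sum_subtractf[symmetric] map_mult algebra_simps)
  have "q dvd ?y b1 * ?y b2 - \<phi> (?c b1 b2) * ?y (?m b1 b2)" for b1 b2
  proof -
    have "?y b1 * ?y b2 = (\<Prod>i\<in>I. (Y i ^ d i) ^ ((b1 i + b2 i) div d i) * Y i ^ ((b1 i + b2 i) mod d i))"
      by (simp add: prod.distrib[symmetric] power_add[symmetric] power_mult[symmetric])
    moreover have "\<phi> (?c b1 b2) * ?y (?m b1 b2)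
        = (\<Prod>i\<in>I. \<phi> (l i) ^ ((b1 i + b2 i) div d i) * Y i ^ ((b1 i + b2 i) mod d i))"
      by (simp add: exp_carry_def exp_red_def map_prod map_power prod.distrib[symmetric])
    ultimately show ?thesis
      by (auto intro!: dvd_diff_prod dvd_diff_mult dvd_diff_power Y)
  qed
  then show ?thesis unfolding e by (intro dvd_sum) auto
qed

lemma box_eval_scalar:
  fixes \<phi> :: "'a::comm_ring_1 \<Rightarrow> 'b::comm_ring_1"
  assumes "ring_morphism \<phi>" "finite I" "\<And>i. i \<in> I \<Longrightarrow> d i > 0"
    and "\<And>b. b \<in> exp_box I d \<Longrightarrow> r b = (if b = (\<lambda>i\<in>I. 0) then \<Delta> else 0)"
  shows "box_eval I d \<phi> Z r = \<phi> \<Delta>"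
proof -
  interpret ring_morphism \<phi> by fact
  have "box_eval I d \<phi> Z r = (\<Sum>b\<in>exp_box I d. if b = (\<lambda>i\<in>I. 0) then \<phi> \<Delta> else 0)"
    unfolding box_eval_def by (intro sum.cong) (auto simp: assms(4) map_zero)
  then show ?thesis using exp_box_zero[of I d] assms(2,3) by simp
qed

text \<open>A substitute for the norm of \<open>r\<close>: a multiple of \<open>r\<close> that involves no \<open>Y i\<close> is found by counting
  coefficients. That \<open>\<Delta> \<noteq> 0\<close> is not clear at this point.\<close>

lemma box_mult_norm:
  fixes r :: "('i \<Rightarrow> nat) \<Rightarrow> 'a::field poly"
  assumes I: "finite I" "\<And>i. i \<in> I \<Longrightarrow> d i > 0"
    and l: "\<And>i. i \<in> I \<Longrightarrow> degree (l i) \<le> 1"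
    and r: "\<And>b. b \<in> exp_box I d \<Longrightarrow> degree (r b) < A"
  shows "\<exists>g \<Delta>. (\<exists>b\<in>exp_box I d. g b \<noteq> 0) \<and> degree \<Delta> < card (exp_box I d) * (A + card I) \<and>
           (\<forall>b\<in>exp_box I d. box_mult I d l r g b = (if b = (\<lambda>i\<in>I. 0) then \<Delta> else 0))"
proof -
  let ?B = "exp_box I d" and ?z = "(\<lambda>i\<in>I. 0) :: 'i \<Rightarrow> nat"
  let ?c = "\<lambda>b1 b2. exp_carry I d l (\<lambda>i. b1 i + b2 i)" and ?m = "\<lambda>b1 b2. exp_red I d (\<lambda>i. b1 i + b2 i)"
  define N k where "N = card ?B" and "k = card I"
  have z: "?z \<in> ?B" by (rule exp_box_zero[OF I(2)])
  then have N: "N \<ge> 1" unfolding N_def using I(1) by (simp add: Suc_le_eq card_gt_0_iff, auto)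
  have "A \<ge> 1" using r[OF z] by simp
  \<comment> \<open>The unknowns are the \<open>N * G\<close> coefficients of the
    \<open>g b\<close>. The \<open>N - 1\<close> components to be killed have degree below
    \<open>A + G + k\<close>. So there are more unknowns than equations as soon as
    \<open>G > (N - 1) * (A + k)\<close>, and this is the least such \<open>G\<close>.\<close>
  define G where "G = (N - 1) * (A + k) + 1"
  define U where "U = ?B \<times> {..<G}"
  define E where "E = (?B - {?z}) \<times> {..<A + G + k}"
  define h where "h = (\<lambda>b (b2, a). \<Sum>b1\<in>?B. if ?m b1 b2 = b then r b1 * monom 1 a * ?c b1 b2 else 0)"
  have "card E = (N - 1) * (A + G + k)" using z I(1) by (simp add: E_def N_def card_cartesian_product)
  also have "\<dots> = (N - 1) * (A + k) + (N - 1) * G" by (simp only: distrib_left add.assoc add.left_commute add.commute)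
  also have "\<dots> < G + (N - 1) * G" by (simp add: G_def)
  also have "\<dots> = card U" using N by (simp add: U_def N_def card_cartesian_product algebra_simps)
  finally have "card E < card U" .
  then obtain v where v: "\<exists>i\<in>U. v i \<noteq> 0" "\<forall>e\<in>E. (\<Sum>i\<in>U. coeff (h (fst e) i) (snd e) * v i) = 0"
    using homogeneous_system_nontrivial[of E U "\<lambda>e i. coeff (h (fst e) i) (snd e)"] I(1)
    by (auto simp: E_def U_def)
  define g where "g = (\<lambda>b. \<Sum>a<G. monom (v (b, a)) a)"
  have cg: "coeff (g b) n = (if n < G then v (b, n) else 0)" for b n
    by (simp add: g_def coeff_sum)
  have dg: "degree (g b) \<le> G - 1" for b
    by (rule degree_le) (auto simp: cg)
  \<comment> \<open>Two exponents below \<open>d i\<close> add up to less than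
    \<open>2 * d i\<close>, so each index carries at most once and contributes at most one linear
    factor.\<close>
  have dc: "degree (?c b1 b2) \<le> k" if "b1 \<in> ?B" "b2 \<in> ?B" for b1 b2
  proof -
    have "degree (?c b1 b2) \<le> (\<Sum>i\<in>I. degree (l i ^ ((b1 i + b2 i) div d i)))"
      unfolding exp_carry_def using degree_prod_sum_le[OF I(1)] by (simp add: comp_def)
    also have "\<dots> \<le> (\<Sum>i\<in>I. 1)"
    proof (rule sum_mono)
      fix i assume i: "i \<in> I"
      have "b1 i < d i" "b2 i < d i" using that i by (auto simp: exp_box_def)
      then have "(b1 i + b2 i) div d i < 2" by (intro less_mult_imp_div_less) simp
      then have "degree (l i) * ((b1 i + b2 i) div d i) \<le> 1 * 1" using l[OF i] by (intro mult_le_mono) auto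
      then show "degree (l i ^ ((b1 i + b2 i) div d i)) \<le> 1"
        using degree_power_le[of "l i" "(b1 i + b2 i) div d i"] by linarith
    qed
    finally show ?thesis by (simp add: k_def)
  qed
  have dm: "degree (box_mult I d l r g b) \<le> A + G + k - 2" for b
    unfolding box_mult_def
  proof (intro degree_sum_le finite_exp_box I(1))
    fix b1 b2 assume b: "b1 \<in> ?B" "b2 \<in> ?B"
    have "degree (r b1 * g b2 * ?c b1 b2) \<le> (degree (r b1) + degree (g b2)) + degree (?c b1 b2)"
      using degree_mult_le[of "r b1 * g b2" "?c b1 b2"] degree_mult_le[of "r b1" "g b2"] by linarith
    also have "\<dots> \<le> A + G + k - 2" using dg[of b2] dc[OF b] r[OF b(1)] G_def by linarith
    finally show "degree (if ?m b1 b2 = b then r b1 * g b2 * ?c b1 b2 else 0) \<le> A + G + k - 2" by simp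
  qed
  have mh: "box_mult I d l r g b = (\<Sum>i\<in>U. smult (v i) (h b i))" for b
  proof -
    have "box_mult I d l r g b
       = (\<Sum>b1\<in>?B. \<Sum>b2\<in>?B. \<Sum>a<G. smult (v (b2, a)) (if ?m b1 b2 = b then r b1 * monom 1 a * ?c b1 b2 else 0))"
      unfolding box_mult_def
    proof (intro sum.cong refl)
      fix b1 b2 assume "b1 \<in> ?B" "b2 \<in> ?B"
      have "g b2 = (\<Sum>a<G. smult (v (b2, a)) (monom 1 a))" by (simp add: g_def smult_monom)
      then show "(if ?m b1 b2 = b then r b1 * g b2 * ?c b1 b2 else 0)
          = (\<Sum>a<G. smult (v (b2, a)) (if ?m b1 b2 = b then r b1 * monom 1 a * ?c b1 b2 else 0))"
        by (simp add: sum_distrib_left sum_distrib_right)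
    qed
    also have "\<dots> = (\<Sum>b2\<in>?B. \<Sum>a<G. \<Sum>b1\<in>?B. smult (v (b2, a)) (if ?m b1 b2 = b then r b1 * monom 1 a * ?c b1 b2 else 0))"
      by (rule sum_rotate)
    also have "\<dots> = (\<Sum>i\<in>U. smult (v i) (h b i))"
      unfolding U_def h_def by (simp add: sum.cartesian_product' smult_sum_right)
    finally show ?thesis .
  qed
  have zero: "box_mult I d l r g b = 0" if "b \<in> ?B" "b \<noteq> ?z" for b
  proof (rule poly_eqI)
    fix n
    show "coeff (box_mult I d l r g b) n = coeff 0 n"
    proof (cases "n < A + G + k")
      case True
      then have "(b, n) \<in> E" using that by (auto simp: E_def)
      then show ?thesis using v(2) by (auto simp: mh coeff_sum mult.commute dest!: bspec)
    next
      case False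
      then show ?thesis using dm[of b] \<open>A \<ge> 1\<close> by (simp add: coeff_eq_0 G_def)
    qed
  qed
  obtain b a where "b \<in> ?B" "a < G" "v (b, a) \<noteq> 0" using v(1) by (auto simp: U_def)
  then have "g b \<noteq> 0" using cg[of b a] by auto
  moreover have "A + G + k \<le> N * (A + k) + 1" using N unfolding G_def
    by (cases N) (auto simp: algebra_simps)
  then have "degree (box_mult I d l r g ?z) < N * (A + k)"
    using dm[of ?z] \<open>A \<ge> 1\<close> G_def by linarith
  ultimately show ?thesis
    using \<open>b \<in> ?B\<close> zero
    by (intro exI[of _ g] exI[of _ "box_mult I d l r g ?z"]) (auto simp: N_def k_def)
qed

section \<open>Linear independence of roots of linear polynomials\<close>

text \<open>The series \<open>(1 + X) ^ d - 1\<close> has linear coefficient \<open>d\<close>, which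
  is nonzero in the field, so it has a compositional inverse. This inverse gives a
  \<open>d\<close>-th root of \<open>1 + X\<close>, into which \<open>f / f(0) - 1\<close> is
  substituted; the constant term is handled by a root in the field.\<close>

lemma fps_root_exists:
  fixes f :: "'a::alg_closed_field fps"
  assumes "f $ 0 \<noteq> 0" "of_nat d \<noteq> (0 :: 'a)"
  shows "\<exists>y. y ^ d = f"
proof -
  have d: "d > 0" using assms(2) by (cases d) auto
  obtain \<rho> where \<rho>: "\<rho> ^ d = f $ 0" using nth_root_exists[OF d] by blast
  define h where "h = fps_const (inverse (f $ 0)) * f - 1"
  have h0: "h $ 0 = 0" using assms(1) by (simp add: h_def)
  define W where "W = (1 + fps_X :: 'a fps) ^ d - 1"
  have W0: "W $ 0 = 0" by (simp add: W_def fps_power_zeroth)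
  have W1: "W $ 1 = of_nat d"
  proof -
    have "((1 + fps_X :: 'a fps) ^ n) $ 1 = of_nat n" for n
      by (induction n) (simp_all add: fps_mult_nth_1 fps_power_zeroth)
    then show ?thesis by (simp add: W_def)
  qed
  have j: "W oo fps_inv W = fps_X"
    by (rule fps_inv_right) (use W0 W1 assms(2) in auto)
  have i0: "fps_inv W $ 0 = 0" by (simp add: fps_inv_def)
  have "(1 + fps_inv W) ^ d - 1 = fps_X"
    using j i0 unfolding W_def
    by (simp add: fps_compose_sub_distrib fps_compose_add_distrib fps_compose_power[symmetric])
  then have "((1 + fps_inv W) ^ d) oo h = (1 + fps_X) oo h"
    by (simp add: algebra_simps)
  then have "((1 + fps_inv W) oo h) ^ d = 1 + h"
    using h0 by (simp only: fps_compose_power[OF h0]) (simp add: fps_compose_add_distrib)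
  then have "(fps_const \<rho> * ((1 + fps_inv W) oo h)) ^ d = fps_const (f $ 0) * (1 + h)"
    by (simp add: power_mult_distrib \<rho>)
  also have "\<dots> = f" using assms(1) by (simp add: h_def mult.assoc[symmetric])
  finally show ?thesis by blast
qed

text \<open>The Taylor expansion of \<open>r\<close> at \<open>z\<close>, in the local parameter
  \<open>X - z\<close>.\<close>

definition fps_at :: "'a::comm_ring_1 \<Rightarrow> 'a poly \<Rightarrow> 'a fps" where
  "fps_at z r = fps_of_poly (r \<circ>\<^sub>p [:z, 1:])"

interpretation fps_at: ring_morphism "fps_at z"
  by unfold_locales (simp_all add: fps_at_def pcompose_1 pcompose_add pcompose_mult fps_of_poly_add fps_of_poly_mult)

lemma fps_at_eq_0_iff [simp]: "fps_at z r = 0 \<longleftrightarrow> r = (0 :: 'a::idom poly)"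
  using fps_of_poly_eq_iff[of "r \<circ>\<^sub>p [:z, 1:]" 0] by (simp add: fps_at_def pcompose_eq_0_iff)

lemma fps_at_nth_0: "fps_at z r $ 0 = poly r z"
  by (simp add: fps_at_def poly_pcompose flip: poly_0_coeff_0)

lemma fps_at_dvd_imp_eq_0:
  fixes r :: "'a::field poly"
  assumes "fps_X ^ p dvd fps_at z r" "degree r < p"
  shows "r = 0"
proof -
  have "coeff (r \<circ>\<^sub>p [:z, 1:]) n = 0" for n
  proof (cases "n < p")
    case True
    obtain h where "fps_at z r = fps_X ^ p * h" using assms(1) by blast
    then have "fps_at z r $ n = 0" using True by (simp add: fps_X_power_mult_nth)
    then show ?thesis by (simp add: fps_at_def)
  next
    case False
    then show ?thesis using assms(2) by (intro coeff_eq_0) (simp add: degree_pcompose)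
  qed
  then have "r \<circ>\<^sub>p [:z, 1:] = 0" by (intro poly_eqI) simp
  then show ?thesis by (simp add: pcompose_eq_0_iff)
qed

lemma ring_morphism_compose_X_power:
  assumes "ring_morphism (\<phi> :: _ \<Rightarrow> 'a::idom fps)" "d > 0"
  shows "ring_morphism (\<lambda>r. \<phi> r oo fps_X ^ d)"
proof -
  interpret ring_morphism \<phi> by fact
  show ?thesis using assms(2)
    by unfold_locales (simp_all add: map_one map_add map_mult fps_compose_add_distrib fps_compose_mult_distrib)
qed

text \<open>At the zero of \<open>l j\<close> the root \<open>Y j\<close> is a uniformiser of a totally ramified extension while the
  other roots are unramified, so the powers of \<open>Y j\<close> have valuations that are distinct modulo \<open>d j\<close>.
  The norm \<open>\<Delta>\<close> carries the independence from that point to any other one.\<close>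

lemma box_eval_independent:
  fixes r :: "('i \<Rightarrow> nat) \<Rightarrow> 'a::alg_closed_field poly"
  assumes "finite I" "\<And>i. i \<in> I \<Longrightarrow> of_nat (d i) \<noteq> (0 :: 'a)"
    and "\<And>i. i \<in> I \<Longrightarrow> \<kappa> i \<noteq> 0" "inj_on c I"
    and "\<And>i. i \<in> I \<Longrightarrow> Y i ^ d i = fps_at z [:\<kappa> i * c i, \<kappa> i:]"
    and "\<exists>b\<in>exp_box I d. r b \<noteq> 0"
  shows "box_eval I d (fps_at z) Y r \<noteq> 0"
  using assms
proof (induction I arbitrary: z Y r rule: finite_induct)
  case empty
  then show ?case by (simp add: exp_box_def box_eval_def)
next
  case (insert j I)
  let ?J = "insert j I"
  define l where "l = (\<lambda>i. [:\<kappa> i * c i, \<kappa> i:])"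
  define z' where "z' = - c j"
  have d: "d i > 0" if "i \<in> ?J" for i using insert.prems(1)[OF that] by (cases "d i") auto
  have "\<exists>y. y ^ d i = fps_at z' (l i)" if "i \<in> I" for i
  proof (rule fps_root_exists)
    have "c i \<noteq> c j" using insert.prems(3) insert.hyps that by (metis inj_onD insertCI)
    then show "fps_at z' (l i) $ 0 \<noteq> 0"
      using insert.prems(2)[of i] that by (simp add: fps_at_nth_0 l_def z'_def algebra_simps)
  qed (use insert.prems(1) that in auto)
  then obtain \<eta> where \<eta>: "\<And>i. i \<in> I \<Longrightarrow> \<eta> i ^ d i = fps_at z' (l i)" by metis
  obtain \<nu> where \<nu>: "\<nu> ^ d j = \<kappa> j" using nth_root_exists[OF d] by blast
  have \<nu>0: "\<nu> \<noteq> 0" using \<nu> insert.prems(2)[of j] d[of j] by (auto simp: power_0_left)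
  define \<psi> where "\<psi> = (\<lambda>r. fps_at z' r oo fps_X ^ d j :: 'a fps)"
  \<comment> \<open>In the ramified variable the local parameter at \<open>z'\<close> is
    \<open>X ^ d j\<close>, and \<open>l j\<close> becomes \<open>\<kappa> j * X ^ d j\<close>,
    whose root is \<open>\<nu> * X\<close>. The other roots are series in
    \<open>X ^ d j\<close>.\<close>
  define Y' where "Y' = (\<lambda>i. if i = j then fps_const \<nu> * fps_X else \<eta> i oo fps_X ^ d j)"
  have X0: "(fps_X ^ d j :: 'a fps) $ 0 = 0" using d[of j] by simp
  interpret \<psi>: ring_morphism \<psi>
    unfolding \<psi>_def by (rule ring_morphism_compose_X_power) (use d in \<open>auto intro: fps_at.ring_morphism_axioms\<close>)
  have Y': "Y' i ^ d i = \<psi> (l i)" if "i \<in> ?J" for i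
  proof (cases "i = j")
    case True
    have "l j \<circ>\<^sub>p [:z', 1:] = [:0, \<kappa> j:]" by (simp add: l_def z'_def pcompose_pCons algebra_simps)
    then show ?thesis using True \<nu> X0
      by (simp add: Y'_def \<psi>_def fps_at_def power_mult_distrib fps_of_poly_pCons fps_compose_mult_distrib)
  next
    case False
    then show ?thesis using that \<eta>[of i] by (simp add: Y'_def \<psi>_def fps_compose_power[OF X0])
  qed
  have ram: "box_eval ?J d \<psi> Y' s \<noteq> 0" if s: "\<exists>b\<in>exp_box ?J d. s b \<noteq> 0" for s
  proof -
    obtain b where b: "b \<in> exp_box ?J d" "s b \<noteq> 0" using s by blast
    define F where "F = (\<lambda>\<beta>. box_eval I d (fps_at z') \<eta> (\<lambda>b. s (b(j := \<beta>))))"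
    have bj: "b j < d j" using b(1) by (auto simp: exp_box_def)
    define b' where "b' = b(j := undefined)"
    have "b' \<in> exp_box I d" using b(1) insert.hyps by (auto simp: exp_box_def b'_def PiE_def extensional_def)
    moreover have "b'(j := b j) = b" by (simp add: b'_def)
    ultimately have e0: "\<exists>b0\<in>exp_box I d. s (b0(j := b j)) \<noteq> 0"
      using b(2) by metis
    then have "F (b j) \<noteq> 0" unfolding F_def
      using insert.prems(1-3) \<eta> by (intro insert.IH e0) (auto simp: l_def)
    then obtain m where m: "F (b j) $ m \<noteq> 0" by (auto simp: fps_eq_iff)
    have "box_eval ?J d \<psi> Y' s = (\<Sum>\<beta><d j. (F \<beta> oo fps_X ^ d j) * (fps_const \<nu> * fps_X) ^ \<beta>)"
      unfolding box_eval_def sum_exp_box_insert[OF insert.hyps]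
    proof (intro sum.cong refl)
      fix \<beta> assume "\<beta> \<in> {..<d j}"
      have "(\<Prod>i\<in>?J. Y' i ^ (a(j := \<beta>)) i) = (fps_const \<nu> * fps_X) ^ \<beta> * ((\<Prod>i\<in>I. \<eta> i ^ a i) oo fps_X ^ d j)" for a
      proof -
        have "(\<Prod>i\<in>I. Y' i ^ (a(j := \<beta>)) i) = (\<Prod>i\<in>I. (\<eta> i ^ a i) oo fps_X ^ d j)"
          using insert.hyps X0 by (intro prod.cong) (auto simp: Y'_def fps_compose_power)
        then show ?thesis using insert.hyps X0 by (simp add: Y'_def fps_compose_prod_distrib)
      qed
      then show "(\<Sum>a\<in>exp_box I d. \<psi> (s (a(j := \<beta>))) * (\<Prod>i\<in>?J. Y' i ^ (a(j := \<beta>)) i))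
          = (F \<beta> oo fps_X ^ d j) * (fps_const \<nu> * fps_X) ^ \<beta>"
        using X0 by (simp add: F_def box_eval_def \<psi>_def fps_compose_sum_distrib sum_distrib_left
            fps_compose_mult_distrib mult_ac)
    qed
    \<comment> \<open>In the summand for \<open>\<beta>\<close> only exponents congruent to
      \<open>\<beta>\<close> modulo \<open>d j\<close> occur. Position \<open>d j * m + b j\<close>
      therefore sees \<open>\<beta> = b j\<close> alone, where the induction hypothesis provides a
      nonzero coefficient.\<close>
    then have "box_eval ?J d \<psi> Y' s $ (d j * m + b j)
        = (\<Sum>\<beta><d j. ((F \<beta> oo fps_X ^ d j) * (fps_const \<nu> * fps_X) ^ \<beta>) $ (d j * m + b j))"
      by (simp add: fps_sum_nth)
    also have "\<dots> = (\<Sum>\<beta><d j. if \<beta> = b j then F (b j) $ m * \<nu> ^ b j else 0)"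
    proof (intro sum.cong refl)
      fix \<beta> assume \<beta>: "\<beta> \<in> {..<d j}"
      have "(F \<beta> oo fps_X ^ d j) * (fps_const \<nu> * fps_X) ^ \<beta>
          = fps_const (\<nu> ^ \<beta>) * (fps_X ^ \<beta> * (F \<beta> oo fps_X ^ d j))"
        by (simp add: power_mult_distrib fps_const_power mult_ac)
      then have "((F \<beta> oo fps_X ^ d j) * (fps_const \<nu> * fps_X) ^ \<beta>) $ (d j * m + b j)
          = \<nu> ^ \<beta> * (fps_X ^ \<beta> * (F \<beta> oo fps_X ^ d j)) $ (d j * m + b j)"
        by (simp only: fps_mult_left_const_nth)
      also have "\<dots> = \<nu> ^ \<beta> * (if d j * m + b j < \<beta> \<or> \<not> d j dvd d j * m + b j - \<beta> then 0
          else F \<beta> $ ((d j * m + b j - \<beta>) div d j))"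
        by (simp add: fps_X_power_mult_nth fps_nth_compose_X_power)
      also have "\<dots> = (if \<beta> = b j then F (b j) $ m * \<nu> ^ b j else 0)"
      proof (cases "\<beta> = b j")
        case True
        then show ?thesis using d[of j] by simp
      next
        case False
        have "\<not> d j dvd d j * m + b j - \<beta>" if "\<beta> \<le> d j * m + b j"
        proof
          assume "d j dvd d j * m + b j - \<beta>"
          then have "(d j * m + b j) mod d j = \<beta> mod d j" using mod_eq_dvd_iff_nat[OF that] by blast
          then show False using False bj \<beta> by simp
        qed
        then show ?thesis using False by auto
      qed
      finally show "((F \<beta> oo fps_X ^ d j) * (fps_const \<nu> * fps_X) ^ \<beta>) $ (d j * m + b j)
        = (if \<beta> = b j then F (b j) $ m * \<nu> ^ b j else 0)" .
    qed
    also have "\<dots> \<noteq> 0" using bj m \<nu>0 by simp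
    finally show ?thesis by auto
  qed
  have fin: "finite ?J" using insert.hyps by simp
  obtain A where A: "\<And>b. b \<in> exp_box ?J d \<Longrightarrow> degree (r b) < A"
  proof
    fix b assume "b \<in> exp_box ?J d"
    then show "degree (r b) < Suc (\<Sum>b\<in>exp_box ?J d. degree (r b))"
      using member_le_sum[of b "exp_box ?J d" "\<lambda>b. degree (r b)"] finite_exp_box[OF fin] by simp
  qed
  have l1: "degree (l i) \<le> 1" for i by (simp add: l_def)
  obtain g \<Delta> where g: "\<exists>b\<in>exp_box ?J d. g b \<noteq> 0"
    "\<And>b. b \<in> exp_box ?J d \<Longrightarrow> box_mult ?J d l r g b = (if b = (\<lambda>i\<in>?J. 0) then \<Delta> else 0)"
    using box_mult_norm[of ?J d l r A, OF fin d l1 A] by blast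
  have ev: "ring_morphism \<phi> \<Longrightarrow> box_eval ?J d \<phi> Z (box_mult ?J d l r g) = \<phi> \<Delta>" for \<phi> :: "'a poly \<Rightarrow> 'a fps" and Z
    by (rule box_eval_scalar[OF _ fin d g(2)])
  \<comment> \<open>The cofactor \<open>g\<close> is a nonzero family too, so \<open>ram\<close>
    applies to both factors and \<open>\<Delta>\<close> is nonzero. The same \<open>\<Delta>\<close>
    is the product of the two values at \<open>z\<close>.\<close>
  have "box_eval ?J d \<psi> Y' r * box_eval ?J d \<psi> Y' g = \<psi> \<Delta>"
    using \<psi>.box_eval_mult[OF fin, where d = d, OF d, where q = 0 and Y = Y' and l = l and r = r and s = g] Y' ev[OF \<psi>.ring_morphism_axioms] by simp
  with ram[OF insert.prems(5)] ram[OF g(1)] have "\<psi> \<Delta> \<noteq> 0" by (metis mult_eq_0_iff)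
  then have "\<Delta> \<noteq> 0" using \<psi>.map_zero by auto
  moreover have "box_eval ?J d (fps_at z) Y r * box_eval ?J d (fps_at z) Y g = fps_at z \<Delta>"
    using fps_at.box_eval_mult[OF fin, where d = d, OF d, where q = 0 and Y = Y and z = z and l = l and r = r and s = g] insert.prems(4) ev[OF fps_at.ring_morphism_axioms]
    by (simp add: l_def)
  ultimately show ?case by auto
qed

text \<open>\<open>\<Delta>\<close> does not depend on the roots chosen. Evaluation at exact roots,
  which exist at \<open>z\<close> because \<open>z + c i\<close> is nonzero, shows that it is
  nonzero. Evaluation at the approximate roots \<open>Y\<close> would make it divisible by
  \<open>X ^ p\<close> if \<open>r\<close> were, against its degree being below
  \<open>p\<close>.\<close>

lemma box_eval_nonvanishing:
  fixes r :: "('i \<Rightarrow> nat) \<Rightarrow> 'a::alg_closed_field poly"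
  assumes I: "finite I" "\<And>i. i \<in> I \<Longrightarrow> of_nat (d i) \<noteq> (0 :: 'a)"
    and \<kappa>: "\<And>i. i \<in> I \<Longrightarrow> \<kappa> i \<noteq> 0" and c: "inj_on c I" "\<And>i. i \<in> I \<Longrightarrow> z + c i \<noteq> 0"
    and Y: "\<And>i. i \<in> I \<Longrightarrow> fps_X ^ p dvd Y i ^ d i - fps_at z [:\<kappa> i * c i, \<kappa> i:]"
    and r: "\<exists>b\<in>exp_box I d. r b \<noteq> 0" "\<And>b. b \<in> exp_box I d \<Longrightarrow> degree (r b) < A"
    and p: "card (exp_box I d) * (A + card I) \<le> p"
  shows "\<not> fps_X ^ p dvd box_eval I d (fps_at z) Y r"
proof
  assume dvd: "fps_X ^ p dvd box_eval I d (fps_at z) Y r"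
  define l where "l = (\<lambda>i. [:\<kappa> i * c i, \<kappa> i:])"
  have d: "d i > 0" if "i \<in> I" for i using I(2)[OF that] by (cases "d i") auto
  have l1: "degree (l i) \<le> 1" for i by (simp add: l_def)
  obtain g \<Delta> where g: "\<exists>b\<in>exp_box I d. g b \<noteq> 0" "degree \<Delta> < p"
    "\<And>b. b \<in> exp_box I d \<Longrightarrow> box_mult I d l r g b = (if b = (\<lambda>i\<in>I. 0) then \<Delta> else 0)"
    using box_mult_norm[of I d l r A, OF I(1) d l1 r(2)] order_less_le_trans[OF _ p] by blast
  have ev: "box_eval I d (fps_at z) Z (box_mult I d l r g) = fps_at z \<Delta>" for Z
    by (rule box_eval_scalar[OF fps_at.ring_morphism_axioms I(1) d g(3)])
  have "\<exists>y. y ^ d i = fps_at z (l i)" if "i \<in> I" for i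
  proof (rule fps_root_exists)
    show "fps_at z (l i) $ 0 \<noteq> 0"
      using \<kappa>[OF that] c(2)[OF that] by (simp add: fps_at_nth_0 l_def) (metis add.commute distrib_left mult.commute mult_eq_0_iff)
  qed (rule I(2)[OF that])
  then obtain \<eta> where \<eta>: "\<And>i. i \<in> I \<Longrightarrow> \<eta> i ^ d i = fps_at z (l i)" by metis
  have "box_eval I d (fps_at z) \<eta> r * box_eval I d (fps_at z) \<eta> g = fps_at z \<Delta>"
    using fps_at.box_eval_mult[OF I(1), where d = d, OF d, where q = 0 and Y = \<eta> and z = z and l = l and r = r and s = g] \<eta> ev by simp
  moreover have "box_eval I d (fps_at z) \<eta> s \<noteq> 0" if "\<exists>b\<in>exp_box I d. s b \<noteq> 0" for s
    using box_eval_independent[OF I \<kappa> c(1) _ that, where Y = \<eta> and z = z] \<eta> by (simp add: l_def)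
  ultimately have "\<Delta> \<noteq> 0" using r(1) g(1) by (metis fps_at_eq_0_iff mult_eq_0_iff)
  have "fps_X ^ p dvd box_eval I d (fps_at z) Y r * box_eval I d (fps_at z) Y g - fps_at z \<Delta>"
    using fps_at.box_eval_mult[OF I(1), where d = d, OF d, where q = "fps_X ^ p" and Y = Y and z = z and l = l and r = r and s = g] Y ev by (simp add: l_def)
  then have "fps_X ^ p dvd fps_at z \<Delta>"
    using dvd by (metis dvd_diff_commute dvd_diffD dvd_mult2 dvd_diff_right_iff)
  then show False using fps_at_dvd_imp_eq_0 g(2) \<open>\<Delta> \<noteq> 0\<close> by blast
qed

section \<open>Stepanov's method\<close>

text \<open>With \<open>P\<close> the product of all \<open>X + c i\<close>, this derivation sends a
  multiple of a product of powers of the \<open>X + c i\<close> to a multiple of the same product,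
  so that the known values of these powers remain usable.\<close>

definition poly_deriv_by :: "'a::idom poly \<Rightarrow> 'a poly \<Rightarrow> 'a poly" where
  "poly_deriv_by P f = P * pderiv f"

lemma of_nat_neq_0_of_less_CHAR:
  assumes "0 < j" "j < CHAR('a)"
  shows "of_nat j \<noteq> (0 :: 'a::ring_1)"
  using assms by (simp add: of_nat_eq_0_iff_char_dvd nat_dvd_not_less)

text \<open>If \<open>x\<close> were a zero of order \<open>j < M\<close>, each derivation would
  lower the order by exactly one, because the factors \<open>j, ..., 1\<close> are nonzero in a
  field whose characteristic is at least \<open>M\<close>. After \<open>j\<close> derivations the
  value at \<open>x\<close> would be nonzero.\<close>

lemma linear_power_dvd_of_iterated_deriv:
  fixes s :: "'a::field poly"
  assumes M: "M \<le> CHAR('a)" and P: "poly P x \<noteq> 0"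
    and van: "\<And>m. m < M \<Longrightarrow> poly ((poly_deriv_by P ^^ m) s) x = 0"
  shows "[:-x, 1:] ^ M dvd s"
proof (cases "s = 0")
  case False
  define j where "j = order x s"
  obtain q where q: "s = [:-x, 1:] ^ j * q" "\<not> [:-x, 1:] dvd q"
    using Polynomial.order_decomp[OF False, of x] unfolding j_def by blast
  show ?thesis
  proof (rule ccontr)
    assume "\<not> ?thesis"
    then have "j < M" using False by (auto simp: order_divides j_def)
    have "\<exists>h. (poly_deriv_by P ^^ m) s = [:-x, 1:] ^ (j - m) * h \<and> poly h x \<noteq> 0" if "m \<le> j" for m
      using that
    proof (induction m)
      case 0
      then show ?case using q by (auto simp: poly_eq_0_iff_dvd)
    next
      case (Suc m)
      then obtain h where h: "(poly_deriv_by P ^^ m) s = [:-x, 1:] ^ (j - m) * h" "poly h x \<noteq> 0" by auto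
      define i where "i = j - Suc m"
      have i: "j - m = Suc i" using Suc.prems by (simp add: i_def)
      have "(poly_deriv_by P ^^ Suc m) s
          = [:-x, 1:] ^ i * (P * (smult (of_nat (Suc i)) h + [:-x, 1:] * pderiv h))"
        using h(1) unfolding i
        by (simp add: poly_deriv_by_def pderiv_mult pderiv_power_Suc pderiv_pCons algebra_simps del: power_Suc of_nat_Suc)
           (simp add: algebra_simps)
      moreover have "of_nat (Suc i) \<noteq> (0 :: 'a)"
        using \<open>j < M\<close> M i_def Suc.prems by (intro of_nat_neq_0_of_less_CHAR) auto
      then have "poly (P * (smult (of_nat (Suc i)) h + [:-x, 1:] * pderiv h)) x \<noteq> 0"
        using P h(2) by (simp del: of_nat_Suc)
      ultimately show ?case unfolding i_def by blast
    qed
    from this[of j] van[OF \<open>j < M\<close>] show False by auto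
  qed
qed auto

lemma exists_notin_finite_alg_closed:
  assumes "finite (F :: 'a::alg_closed_field set)"
  shows "\<exists>z. z \<notin> F"
proof (cases "F = {}")
  case False
  define q where "q = (\<Prod>a\<in>F. [:-a, 1:]) + 1"
  have dq: "degree (\<Prod>a\<in>F. [:-a, 1:]) = card F"
    by (subst degree_prod_eq_sum_degree) auto
  have "card F > 0" using False assms by (simp add: card_gt_0_iff)
  then have "degree q > 0" unfolding q_def using dq by (subst degree_add_eq_left) auto
  then obtain z where "poly q z = 0" using alg_closed_imp_poly_has_root by blast
  then have "(\<Prod>a\<in>F. z - a) = - 1" by (simp add: q_def poly_prod eq_neg_iff_add_eq_0)
  moreover have "(\<Prod>a\<in>F. z - a) = 0" if "z \<in> F" using assms that by (intro prod_zero) auto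
  ultimately have "z \<notin> F" by auto
  then show ?thesis by blast
qed auto

section \<open>Derivatives of products of powers of linear polynomials\<close>

definition lin_prod :: "'i set \<Rightarrow> ('i \<Rightarrow> 'a::idom) \<Rightarrow> ('i \<Rightarrow> nat) \<Rightarrow> 'a poly" where
  "lin_prod I c e = (\<Prod>i\<in>I. [:c i, 1:] ^ e i)"

text \<open>The logarithmic derivative of \<open>lin_prod I c e\<close>, with denominators cleared
  by the product of all \<open>X + c i\<close>.\<close>

definition lin_log_deriv :: "'i set \<Rightarrow> ('i \<Rightarrow> 'a::idom) \<Rightarrow> ('i \<Rightarrow> nat) \<Rightarrow> 'a poly" where
  "lin_log_deriv I c e = (\<Sum>i\<in>I. smult (of_nat (e i)) (\<Prod>j\<in>I-{i}. [:c j, 1:]))"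

text \<open>The action of the derivation on the cofactor of \<open>lin_prod I c e\<close>. The gain
  is that the degree grows by at most \<open>card I\<close> per step, however large the exponents
  \<open>e i\<close> are; this keeps the number of equations in Stepanov's method small.\<close>

definition twisted_deriv :: "'i set \<Rightarrow> ('i \<Rightarrow> 'a::idom) \<Rightarrow> ('i \<Rightarrow> nat) \<Rightarrow> 'a poly \<Rightarrow> 'a poly" where
  "twisted_deriv I c e r = lin_prod I c (\<lambda>_. 1) * pderiv r + lin_log_deriv I c e * r"

lemma deriv_lin_prod:
  fixes c :: "'i \<Rightarrow> 'a::idom"
  assumes "finite I"
  shows "lin_prod I c (\<lambda>_. 1) * pderiv (lin_prod I c e) = lin_log_deriv I c e * lin_prod I c e"
proof -
  have "lin_prod I c (\<lambda>_. 1) * ((\<Prod>j\<in>I-{i}. [:c j, 1:] ^ e j) * pderiv ([:c i, 1:] ^ e i))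
      = smult (of_nat (e i)) (\<Prod>j\<in>I-{i}. [:c j, 1:]) * lin_prod I c e" if "i \<in> I" for i
  proof -
    have 1: "lin_prod I c (\<lambda>_. 1) = [:c i, 1:] * (\<Prod>j\<in>I-{i}. [:c j, 1:])"
      and 2: "lin_prod I c e = [:c i, 1:] ^ e i * (\<Prod>j\<in>I-{i}. [:c j, 1:] ^ e j)"
      unfolding lin_prod_def power_one_right by (rule prod.remove[OF assms that])+
    have 3: "[:c i, 1:] * pderiv ([:c i, 1:] ^ e i) = smult (of_nat (e i)) ([:c i, 1:] ^ e i)"
    proof -
      have gen: "L * pderiv (L ^ n) = smult (of_nat n) (L ^ n)" if "pderiv L = 1" for L :: "'a poly" and n
      proof (cases n)
        case (Suc m)
        show ?thesis unfolding Suc pderiv_power_Suc that by simp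
      qed auto
      show ?thesis by (rule gen) (simp add: pderiv_pCons one_pCons)
    qed
    have rearrange: "(l * q) * (r * d) = q * r * (l * d)" for l q r d :: "'a poly" by (simp add: mult_ac)
    show ?thesis unfolding 1 2
      by (subst rearrange, subst 3) (simp only: mult_smult_left mult_smult_right mult_ac)
  qed
  then show ?thesis
    unfolding lin_prod_def[of I c e] pderiv_prod sum_distrib_left lin_log_deriv_def sum_distrib_right
    by (intro sum.cong refl) (simp add: lin_prod_def)
qed

lemma deriv_by_lin_prod:
  fixes c :: "'i \<Rightarrow> 'a::idom"
  assumes "finite I"
  shows "poly_deriv_by (lin_prod I c (\<lambda>_. 1)) (r * lin_prod I c e) = twisted_deriv I c e r * lin_prod I c e"
proof -
  have "poly_deriv_by (lin_prod I c (\<lambda>_. 1)) (r * lin_prod I c e)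
     = r * (lin_prod I c (\<lambda>_. 1) * pderiv (lin_prod I c e)) + lin_prod I c (\<lambda>_. 1) * pderiv r * lin_prod I c e"
    by (simp add: poly_deriv_by_def pderiv_mult algebra_simps)
  then show ?thesis unfolding deriv_lin_prod[OF assms] twisted_deriv_def by (simp add: algebra_simps)
qed

lemma poly_deriv_by_sum: "poly_deriv_by P (sum f A) = (\<Sum>x\<in>A. poly_deriv_by P (f x))"
proof -
  have "pderiv (sum f A) = (\<Sum>x\<in>A. pderiv (f x))"
    by (induction A rule: infinite_finite_induct) (simp_all add: pderiv_add)
  then show ?thesis by (simp add: poly_deriv_by_def sum_distrib_left)
qed

lemma poly_deriv_by_smult: "poly_deriv_by P (smult a f) = smult a (poly_deriv_by P f)"
  by (simp add: poly_deriv_by_def pderiv_smult)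

lemma iterated_deriv_by_lin_prod:
  fixes c :: "'i \<Rightarrow> 'a::idom"
  assumes "finite I"
  shows "(poly_deriv_by (lin_prod I c (\<lambda>_. 1)) ^^ m) (\<Sum>u\<in>U. smult (w u) (r u * lin_prod I c (e u)))
       = (\<Sum>u\<in>U. smult (w u) ((twisted_deriv I c (e u) ^^ m) (r u) * lin_prod I c (e u)))"
  by (induction m) (simp_all add: poly_deriv_by_sum poly_deriv_by_smult deriv_by_lin_prod[OF assms] del: One_nat_def)

lemma degree_lin_prod:
  fixes c :: "'i \<Rightarrow> 'a::idom"
  assumes "finite I"
  shows "degree (lin_prod I c e) = sum e I"
  unfolding lin_prod_def using assms
  by (subst degree_prod_eq_sum_degree) (auto simp: degree_power_eq)

lemma degree_twisted_deriv:
  fixes c :: "'i \<Rightarrow> 'a::idom"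
  assumes "finite I"
  shows "degree (twisted_deriv I c e r) \<le> degree r + card I"
proof -
  have "degree (lin_prod I c (\<lambda>_. 1)) = card I" using degree_lin_prod[OF assms, of c "\<lambda>_. 1"] by simp
  moreover have "degree (pderiv r) \<le> degree r"
    by (rule degree_le) (simp add: coeff_pderiv coeff_eq_0)
  ultimately have "degree (lin_prod I c (\<lambda>_. 1) * pderiv r) \<le> degree r + card I"
    using degree_mult_le[of "lin_prod I c (\<lambda>_. 1)" "pderiv r"] by linarith
  moreover have "degree (lin_log_deriv I c e) \<le> card I"
    unfolding lin_log_deriv_def
  proof (intro degree_sum_le assms order.trans[OF degree_smult_le])
    fix i
    have "degree (\<Prod>j\<in>I-{i}. [:c j, 1:]) = card (I - {i})"
      by (subst degree_prod_eq_sum_degree) auto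
    then show "degree (\<Prod>j\<in>I-{i}. [:c j, 1:]) \<le> card I" using assms by (simp add: card_mono)
  qed
  then have "degree (lin_log_deriv I c e * r) \<le> degree r + card I"
    using degree_mult_le[of "lin_log_deriv I c e" r] by linarith
  ultimately show ?thesis unfolding twisted_deriv_def by (rule degree_add_le)
qed

lemma degree_iterated_twisted_deriv:
  fixes c :: "'i \<Rightarrow> 'a::idom"
  assumes "finite I"
  shows "degree ((twisted_deriv I c e ^^ m) r) \<le> degree r + m * card I"
proof (induction m)
  case (Suc m)
  then show ?case using degree_twisted_deriv[OF assms, of c e "(twisted_deriv I c e ^^ m) r"] by simp
qed auto

lemma linear_power_CHAR:
  fixes z :: "'a::comm_ring_1"
  assumes "prime CHAR('a)"
  shows "[:-z, 1:] ^ CHAR('a) = monom 1 CHAR('a) - [:z ^ CHAR('a):]"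
proof -
  have "(monom 1 1 + (- [:z:])) ^ CHAR('a) = (monom 1 1 :: 'a poly) ^ CHAR('a) + (- [:z:]) ^ CHAR('a)"
    by (rule freshmans_dream) (use assms in auto)
  moreover have "(- [:z:] :: 'a poly) ^ CHAR('a) = - [:z ^ CHAR('a):]"
  proof -
    \<comment> \<open>Expanding the power of a vanishing sum gives the sign for odd and even
      characteristic at once.\<close>
    have "((- [:z:]) + [:z:]) ^ CHAR('a) = (- [:z:] :: 'a poly) ^ CHAR('a) + [:z:] ^ CHAR('a)"
      by (rule freshmans_dream) (use assms in auto)
    moreover have "CHAR('a) \<noteq> 0" using assms by auto
    ultimately show ?thesis by (simp add: power_0_left poly_const_pow eq_neg_iff_add_eq_0)
  qed
  moreover have "monom 1 1 + (- [:z:]) = [:-z, 1:]" by (simp add: monom_altdef)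
  ultimately show ?thesis by (simp add: monom_power)
qed

lemma card_mult_le_degree:
  fixes f :: "'a::idom poly"
  assumes "f \<noteq> 0" "finite Pts" "\<And>x. x \<in> Pts \<Longrightarrow> [:-x, 1:] ^ M dvd f" "M > 0"
  shows "card Pts * M \<le> degree f"
proof -
  have o: "M \<le> order x f" if "x \<in> Pts" for x using assms(3)[OF that] assms(1) by (simp add: order_divides)
  have "card Pts * M \<le> (\<Sum>x\<in>Pts. order x f)" using sum_mono[of Pts "\<lambda>_. M"] o by simp
  also have "\<dots> \<le> (\<Sum>x\<in>set_mset (proots f). order x f)"
  proof (rule sum_mono2)
    show "Pts \<subseteq> set_mset (proots f)"
      using o assms(1,4) by (force simp: order_root)
  qed auto
  also have "\<dots> = size (proots f)" using assms(1) by (simp add: size_multiset_overloaded_eq)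
  also have "\<dots> \<le> degree f" by (rule size_proots_le)
  finally show ?thesis .
qed

text \<open>Let \<open>L i\<close> be the expansion of \<open>X + c i\<close> and
  \<open>Y i = L i ^ (- t i)\<close>. Then \<open>Y i ^ d i = L i / L i ^ p\<close>, and
  \<open>L i ^ p = (z + c i) ^ p + X ^ p\<close>, so modulo \<open>X ^ p\<close> the series
  \<open>Y i\<close> is a \<open>d i\<close>-th root of \<open>\<kappa> i * (X + c i)\<close>. The
  sum involves \<open>Y i ^ (- b i)\<close>; multiplication by the unit
  \<open>Y i ^ (d i - 1)\<close> turns the exponents into \<open>d i - 1 - b i\<close>, again a
  box.\<close>

lemma lin_prod_nonvanishing:
  fixes c :: "'i \<Rightarrow> 'a::alg_closed_field"
  defines "p \<equiv> CHAR('a)"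
  assumes p: "prime p" and I: "finite I" and d: "\<And>i. i \<in> I \<Longrightarrow> d i dvd p - 1"
    and c: "inj_on c I" "\<And>i. i \<in> I \<Longrightarrow> z + c i \<noteq> 0"
    and r: "\<exists>b\<in>exp_box I d. r b \<noteq> 0" "\<And>b. b \<in> exp_box I d \<Longrightarrow> degree (r b) < A"
    and le: "card (exp_box I d) * (A + card I) \<le> p"
  shows "\<not> fps_X ^ p dvd fps_at z (\<Sum>b\<in>exp_box I d. r b * lin_prod I c (\<lambda>i. (p - 1) div d i * b i))"
proof
  define t where "t = (\<lambda>i. (p - 1) div d i)"
  assume dvd: "fps_X ^ p dvd fps_at z (\<Sum>b\<in>exp_box I d. r b * lin_prod I c (\<lambda>i. (p - 1) div d i * b i))"
  have p1: "p > 1" using p by (rule prime_gt_1_nat)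
  have td: "t i * d i = p - 1" if "i \<in> I" for i using d[OF that] by (simp add: t_def)
  have dpos: "d i > 0" if "i \<in> I" for i using td[OF that] p1 by (cases "d i") auto
  have dp: "of_nat (d i) \<noteq> (0 :: 'a)" if "i \<in> I" for i
  proof (rule of_nat_neq_0_of_less_CHAR[OF dpos[OF that]])
    have "d i \<le> p - 1" using d[OF that] p1 by (intro dvd_imp_le) auto
    then show "d i < CHAR('a)" using p1 by (simp add: p_def)
  qed
  define L where "L = (\<lambda>i. fps_at z [:c i, 1:])"
  have L: "L i = fps_const (z + c i) + fps_X" for i
    by (simp add: L_def fps_at_def pcompose_pCons fps_of_poly_pCons add.commute mult.commute)
  have L0: "L i $ 0 \<noteq> 0" if "i \<in> I" for i using c(2)[OF that] by (simp add: L)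
  define Y where "Y = (\<lambda>i. inverse (L i ^ t i))"
  have LY: "L i ^ t i * Y i = 1" if "i \<in> I" for i
    unfolding Y_def using L0[OF that] by (intro inverse_mult_eq_1') (simp add: fps_power_zeroth)
  define \<kappa> where "\<kappa> = (\<lambda>i. inverse ((z + c i) ^ p))"
  define s where "s = (\<lambda>b. \<lambda>i\<in>I. d i - 1 - b i)"
  have sB: "s b \<in> exp_box I d" if "b \<in> exp_box I d" for b
    using dpos by (auto simp: s_def exp_box_def)
  have ss: "s (s b) = b" if "b \<in> exp_box I d" for b
  proof
    fix i
    show "s (s b) i = b i"
      using that by (cases "i \<in> I") (auto simp: s_def exp_box_def PiE_def extensional_def Pi_def dest!: bspec)
  qed
  have Ycong: "fps_X ^ p dvd Y i ^ d i - fps_at z [:\<kappa> i * c i, \<kappa> i:]" if i: "i \<in> I" for i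
  proof -
    have "L i ^ p = fps_const ((z + c i) ^ p) + fps_X ^ p"
      unfolding L p_def using p by (subst freshmans_dream) (auto simp: p_def)
    then have Lp: "fps_const (\<kappa> i) * L i ^ p = 1 + fps_const (\<kappa> i) * fps_X ^ p"
      using c(2)[OF i] by (simp add: \<kappa>_def distrib_left fps_const_mult[symmetric] del: fps_const_mult)
    have "fps_at z [:\<kappa> i * c i, \<kappa> i:] = fps_const (\<kappa> i) * L i"
      by (simp add: L fps_at_def pcompose_pCons fps_of_poly_pCons fps_of_poly_add distrib_left algebra_simps)
    moreover have "L i ^ (p - 1) * Y i ^ d i = 1"
      using LY[OF i] td[OF i] by (metis power_mult power_mult_distrib power_one)
    moreover have "L i ^ p = L i * L i ^ (p - 1)" using p1 by (simp flip: power_Suc)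
    ultimately have "Y i ^ d i - fps_at z [:\<kappa> i * c i, \<kappa> i:] = Y i ^ d i * (1 - fps_const (\<kappa> i) * L i ^ p)"
      by (simp add: algebra_simps)
    then show ?thesis unfolding Lp by simp
  qed
  have "fps_X ^ p dvd fps_at z (\<Sum>b\<in>exp_box I d. r b * lin_prod I c (\<lambda>i. t i * b i)) * (\<Prod>i\<in>I. Y i ^ (d i - 1))"
    using dvd unfolding t_def by (rule dvd_mult2)
  also have "fps_at z (\<Sum>b\<in>exp_box I d. r b * lin_prod I c (\<lambda>i. t i * b i)) * (\<Prod>i\<in>I. Y i ^ (d i - 1))
      = (\<Sum>b\<in>exp_box I d. fps_at z (r b) * (\<Prod>i\<in>I. Y i ^ s b i))"
    unfolding fps_at.map_sum sum_distrib_right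
  proof (intro sum.cong refl)
    fix b assume b: "b \<in> exp_box I d"
    have "fps_at z (lin_prod I c (\<lambda>i. t i * b i)) * (\<Prod>i\<in>I. Y i ^ (d i - 1)) = (\<Prod>i\<in>I. Y i ^ s b i)"
      unfolding lin_prod_def fps_at.map_prod fps_at.map_power prod.distrib[symmetric]
    proof (intro prod.cong refl)
      fix i assume i: "i \<in> I"
      have "b i < d i" using b i by (auto simp: exp_box_def PiE_def Pi_def dest!: bspec)
      then have "b i + (d i - 1 - b i) = d i - 1" by linarith
      then have "Y i ^ (d i - 1) = Y i ^ b i * Y i ^ s b i" using i unfolding power_add[symmetric] by (simp add: s_def)
      moreover have "L i ^ (t i * b i) * Y i ^ b i = 1"
        using LY[OF i] by (metis power_mult power_mult_distrib power_one)
      ultimately have "L i ^ (t i * b i) * Y i ^ (d i - 1) = Y i ^ s b i"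
        by (simp only: mult.assoc[symmetric] mult_1)
      then show "fps_at z [:c i, 1:] ^ (t i * b i) * Y i ^ (d i - 1) = Y i ^ s b i"
        by (simp only: L_def)
    qed
    then show "fps_at z (r b * lin_prod I c (\<lambda>i. t i * b i)) * (\<Prod>i\<in>I. Y i ^ (d i - 1))
        = fps_at z (r b) * (\<Prod>i\<in>I. Y i ^ s b i)" by (simp add: fps_at.map_mult mult.assoc)
  qed
  also have "\<dots> = box_eval I d (fps_at z) Y (\<lambda>b. r (s b))"
    unfolding box_eval_def by (rule sum.reindex_bij_witness[of _ s s]) (auto simp: ss sB)
  finally have "fps_X ^ p dvd box_eval I d (fps_at z) Y (\<lambda>b. r (s b))" .
  moreover have "\<not> fps_X ^ p dvd box_eval I d (fps_at z) Y (\<lambda>b. r (s b))"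
  proof (rule box_eval_nonvanishing[OF I dp _ c Ycong _ _ le])
    show "\<kappa> i \<noteq> 0" if "i \<in> I" for i using c(2)[OF that] by (simp add: \<kappa>_def)
    show "\<exists>b\<in>exp_box I d. r (s b) \<noteq> 0" using r(1) sB ss by metis
  qed (use sB r(2) in auto)
  ultimately show False by blast
qed

text \<open>The auxiliary polynomial is a combination of the terms
  \<open>X ^ a * (X - z) ^ (p * j) * (\<Prod>i\<in>I. (X + c i) ^ (t i * b i))\<close>. At the points counted here, the last two
  factors have values that are known in advance, also in all derivatives of order less than \<open>p\<close>.\<close>

lemma stepanov_bound:
  fixes c \<gamma> :: "'i \<Rightarrow> 'a::alg_closed_field"
  defines "p \<equiv> CHAR('a)"
  assumes p: "prime p" and I: "finite I" and d: "\<And>i. i \<in> I \<Longrightarrow> d i dvd p - 1"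
    and c: "inj_on c I" and \<gamma>: "\<And>i. i \<in> I \<Longrightarrow> \<gamma> i \<noteq> 0"
    and Pts: "finite Pts" "\<And>x. x \<in> Pts \<Longrightarrow> x ^ p = x" "\<And>x i. x \<in> Pts \<Longrightarrow> i \<in> I \<Longrightarrow> (x + c i) ^ ((p - 1) div d i) = \<gamma> i"
    and N: "N = card (exp_box I d)"
    and A: "M * (A + M * card I + J) < N * J * A" and le: "N * (A + card I) \<le> p" and M: "M \<le> p"
  shows "card Pts * M \<le> A + p * J + p * card I"
proof (cases "M = 0")
  case False
  define k where "k = card I"
  define t where "t = (\<lambda>i. (p - 1) div d i)"
  define e where "e = (\<lambda>b i. t i * b i)"
  let ?B = "exp_box I d"
  have p1: "p > 1" using p by (rule prime_gt_1_nat)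
  have td: "t i * d i = p - 1" if "i \<in> I" for i using d[OF that] by (simp add: t_def)
  have tpos: "t i > 0" if "i \<in> I" for i using td[OF that] p1 by (cases "t i") auto
  obtain z where z: "z \<notin> (\<lambda>i. - c i) ` I" using exists_notin_finite_alg_closed[of "(\<lambda>i. - c i) ` I"] I by auto
  then have zc: "z + c i \<noteq> 0" if "i \<in> I" for i using that by (auto simp: add_eq_0_iff2)
  \<comment> \<open>There is one unknown for each term \<open>(b, j, a)\<close> of the auxiliary
    polynomial. The equations make, for every order \<open>m < M\<close>, one polynomial of degree
    below \<open>A + M * k + J\<close> vanish identically; it takes the value of the
    \<open>m\<close>-th derivative at every counted point.\<close>
  define U where "U = ?B \<times> {..<J} \<times> {..<A}"
  define E where "E = {..<M} \<times> {..<A + M * k + J}"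
  define g where "g = (\<lambda>b. \<Prod>i\<in>I. \<gamma> i ^ b i)"
  \<comment> \<open>What the \<open>m\<close>-th derivative of a term looks like on
    \<open>Pts\<close>: powers of \<open>X - z\<close> with exponent \<open>p * j\<close> act as
    constants under derivation and take the value \<open>(x - z ^ p) ^ j\<close> because
    \<open>x ^ p = x\<close>, and the product of the \<open>(X + c i) ^ (t i * b i)\<close> takes
    the value \<open>g b\<close>. Both replacements lower the degree drastically.\<close>
  define q where "q = (\<lambda>m (b, j, a). smult (g b) ([:- (z ^ p), 1:] ^ j * (twisted_deriv I c (e b) ^^ m) (monom 1 a)))"
  have AJ: "A > 0" "J > 0" using A by (cases A; cases J; simp)+
  have "card E < card U"
    using A by (simp add: E_def U_def card_cartesian_product N k_def algebra_simps)
  moreover have "finite E" "finite U" using I by (simp_all add: E_def U_def)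
  ultimately obtain v where v: "\<exists>u\<in>U. v u \<noteq> 0" "\<forall>x\<in>E. (\<Sum>u\<in>U. coeff (q (fst x) u) (snd x) * v u) = 0"
    using homogeneous_system_nontrivial[of E U "\<lambda>x u. coeff (q (fst x) u) (snd x)"] by blast
  have dq: "degree (q m u) < A + M * k + J" if u0: "u \<in> U" and m: "m < M" for m u
  proof -
    obtain b j a where u: "u = (b, j, a)" "j < J" "a < A" using u0 by (auto simp: U_def)
    have 1: "degree ((twisted_deriv I c (e b) ^^ m) (monom 1 a)) \<le> a + m * k"
      using degree_iterated_twisted_deriv[OF I, where c = c and e = "e b" and m = m and r = "monom 1 a"] by (simp add: degree_monom_eq k_def)
    have 2: "degree ([:- (z ^ p), 1:] ^ j) = j" by (simp add: degree_power_eq)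
    have "degree (q m u) \<le> j + (a + m * k)"
      unfolding q_def u(1) prod.case using 1 2
      by (intro order.trans[OF degree_smult_le] order.trans[OF degree_mult_le]) simp
    moreover have "m * k \<le> M * k" using m by simp
    ultimately show ?thesis using u by linarith
  qed
  have q0: "(\<Sum>u\<in>U. smult (v u) (q m u)) = 0" if m: "m < M" for m
  proof (rule poly_eqI)
    fix n
    show "coeff (\<Sum>u\<in>U. smult (v u) (q m u)) n = coeff 0 n"
    proof (cases "n < A + M * k + J")
      case True
      then show ?thesis using v(2) m by (auto simp: E_def coeff_sum mult.commute dest!: bspec[of _ _ "(m, n)"])
    next
      case False
      have "coeff (q m u) n = 0" if "u \<in> U" for u using dq[OF that m] False by (intro coeff_eq_0) simp
      then show ?thesis by (simp add: coeff_sum)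
    qed
  qed
  define y where "y = (\<lambda>b. lin_prod I c (e b))"
  define \<Psi> where "\<Psi> = (\<Sum>(b, j, a)\<in>U. smult (v (b, j, a)) ([:-z, 1:] ^ (p * j) * monom 1 a * y b))"
  \<comment> \<open>Group the terms by \<open>j\<close> and take the least \<open>j0\<close> with a
    nonzero group. After division by \<open>X ^ (p * j0)\<close> at \<open>z\<close>, all later
    groups are divisible by \<open>X ^ p\<close>, so group \<open>j0\<close> would be as well,
    contrary to \<open>lin_prod_nonvanishing\<close>.\<close>
  have nz: "\<Psi> \<noteq> 0"
  proof
    assume \<Psi>0: "\<Psi> = 0"
    define R where "R = (\<lambda>j b. \<Sum>a<A. monom (v (b, j, a)) a)"
    have cR: "coeff (R j b) a = v (b, j, a)" if "a < A" for j b a using that by (simp add: R_def coeff_sum)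
    have dR: "degree (R j b) < A" for j b
      unfolding R_def using degree_sum_le[of "{..<A}" "\<lambda>a. monom (v (b, j, a)) a" "A - 1"] AJ
      by (force intro: order.trans[OF degree_monom_le])
    define S where "S = (\<lambda>j. \<Sum>b\<in>?B. R j b * y b)"
    have mon: "smult w (P * monom 1 a * Y) = P * (monom w a * Y)" for w :: 'a and P a Y
    proof -
      have "monom w a = smult w (monom 1 a)" by (simp add: smult_monom)
      then show ?thesis by (simp add: mult.assoc)
    qed
    have "\<Psi> = (\<Sum>b\<in>?B. \<Sum>j<J. \<Sum>a<A. [:-z, 1:] ^ (p * j) * (monom (v (b, j, a)) a * y b))"
      unfolding \<Psi>_def U_def by (simp only: sum.cartesian_product' prod.case mon)
    also have "\<dots> = (\<Sum>b\<in>?B. \<Sum>j<J. [:-z, 1:] ^ (p * j) * (R j b * y b))"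
      by (simp add: R_def sum_distrib_left sum_distrib_right)
    also have "\<dots> = (\<Sum>j<J. [:-z, 1:] ^ (p * j) * S j)"
      by (subst sum.swap) (simp add: S_def sum_distrib_left)
    finally have \<Psi>S: "\<Psi> = (\<Sum>j<J. [:-z, 1:] ^ (p * j) * S j)" .
    define j0 where "j0 = (LEAST j. \<exists>b\<in>?B. R j b \<noteq> 0)"
    obtain b j a where u: "b \<in> ?B" "j < J" "a < A" "v (b, j, a) \<noteq> 0" using v(1) by (auto simp: U_def)
    then have "R j b \<noteq> 0" using cR[of a j b] by auto
    then have ex: "\<exists>b\<in>?B. R j b \<noteq> 0" using u by blast
    then have j0: "\<exists>b\<in>?B. R j0 b \<noteq> 0" unfolding j0_def by (rule LeastI)
    have "j0 \<le> j" unfolding j0_def using ex by (rule Least_le)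
    then have j0J: "j0 < J" using u by simp
    have low: "S i = 0" if "i < j0" for i
      using not_less_Least[of i "\<lambda>j. \<exists>b\<in>?B. R j b \<noteq> 0"] that by (auto simp: S_def j0_def)
    have fX: "fps_at z ([:-z, 1:] ^ n) = fps_X ^ n" for n
      by (simp add: fps_at.map_power) (simp add: fps_at_def pcompose_pCons fps_of_poly_pCons)
    have "0 = (\<Sum>j<J. fps_X ^ (p * j) * fps_at z (S j))"
      using arg_cong[OF \<Psi>S, of "fps_at z"] \<Psi>0 by (simp add: fps_at.map_zero fps_at.map_sum fps_at.map_mult fX)
    also have "\<dots> = (\<Sum>j\<in>{j0..<J}. fps_X ^ (p * j) * fps_at z (S j))"
      by (rule sum.mono_neutral_right) (auto simp: low fps_at.map_zero)
    also have "\<dots> = fps_X ^ (p * j0) * fps_at z (S j0) + (\<Sum>j\<in>{Suc j0..<J}. fps_X ^ (p * j) * fps_at z (S j))"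
      using j0J by (simp add: sum.atLeast_Suc_lessThan)
    also have "(\<Sum>j\<in>{Suc j0..<J}. fps_X ^ (p * j) * fps_at z (S j))
        = fps_X ^ (p * j0) * (fps_X ^ p * (\<Sum>j\<in>{Suc j0..<J}. fps_X ^ (p * (j - Suc j0)) * fps_at z (S j)))"
      unfolding sum_distrib_left
    proof (intro sum.cong refl)
      fix i assume "i \<in> {Suc j0..<J}"
      then have "p * i = p * j0 + (p + p * (i - Suc j0))" by (simp add: add_mult_distrib2[symmetric] flip: mult_Suc_right)
      then show "fps_X ^ (p * i) * fps_at z (S i) = fps_X ^ (p * j0) * (fps_X ^ p * (fps_X ^ (p * (i - Suc j0)) * fps_at z (S i)))"
        by (simp add: power_add mult.assoc)
    qed
    finally have "fps_X ^ (p * j0) *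
        (fps_at z (S j0) + fps_X ^ p * (\<Sum>j\<in>{Suc j0..<J}. fps_X ^ (p * (j - Suc j0)) * fps_at z (S j))) = 0"
      by (simp only: distrib_left)
    then have "fps_at z (S j0) + fps_X ^ p * (\<Sum>j\<in>{Suc j0..<J}. fps_X ^ (p * (j - Suc j0)) * fps_at z (S j)) = 0"
      by (simp only: mult_eq_0_iff power_eq_0_iff fps_X_neq_zero simp_thms)
    then have "fps_at z (S j0) = fps_X ^ p * - (\<Sum>j\<in>{Suc j0..<J}. fps_X ^ (p * (j - Suc j0)) * fps_at z (S j))"
      by (simp only: add_eq_0_iff2 mult_minus_right)
    then have "fps_X ^ p dvd fps_at z (S j0)" by (rule dvdI)
    moreover have "\<not> fps_X ^ p dvd fps_at z (S j0)"
      unfolding S_def y_def e_def t_def p_def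
      by (rule lin_prod_nonvanishing) (use p I d c zc j0 dR le N in \<open>auto simp: p_def\<close>)
    ultimately show False by blast
  qed
  have dvd: "[:-x, 1:] ^ M dvd \<Psi>" if x: "x \<in> Pts" for x
  proof -
    \<comment> \<open>Modulo \<open>(X - x) ^ p\<close> the polynomial \<open>(X - z) ^ p\<close> is
      the constant \<open>w\<close>. Hence \<open>\<Psi>\<close> may be replaced by
      \<open>\<Phi>\<close>, in which no power of \<open>X - z\<close> is left to
      differentiate.\<close>
    define w where "w = x - z ^ p"
    define \<Phi> where "\<Phi> = (\<Sum>(b, j, a)\<in>U. smult (v (b, j, a) * w ^ j) (monom 1 a * y b))"
    have xc: "x + c i \<noteq> 0" if "i \<in> I" for i
      using Pts(3)[OF x that] \<gamma>[OF that] tpos[OF that] by (auto simp: t_def power_0_left split: if_splits)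
    have "[:-z, 1:] ^ p - [:w:] = [:-x, 1:] ^ p"
      using linear_power_CHAR[of z] linear_power_CHAR[of x] p Pts(2)[OF x] by (simp add: p_def w_def diff_diff_eq)
    then have *: "[:-x, 1:] ^ p dvd [:-z, 1:] ^ p - [:w:]" by simp
    have "[:-x, 1:] ^ p dvd \<Psi> - \<Phi>"
      unfolding \<Psi>_def \<Phi>_def sum_subtractf[symmetric]
    proof (rule dvd_sum)
      fix u :: "('i \<Rightarrow> nat) \<times> nat \<times> nat"
      obtain b j a where u: "u = (b, j, a)" by (cases u)
      have "smult (v (b, j, a)) ([:-z, 1:] ^ (p * j) * monom 1 a * y b) - smult (v (b, j, a) * w ^ j) (monom 1 a * y b)
         = ([:-z, 1:] ^ (p * j) - [:w:] ^ j) * smult (v (b, j, a)) (monom 1 a * y b)"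
        by (simp add: poly_const_pow algebra_simps)
      moreover have "[:-x, 1:] ^ p dvd [:-z, 1:] ^ (p * j) - [:w:] ^ j"
        unfolding power_mult by (rule dvd_diff_power[OF *])
      ultimately show "[:-x, 1:] ^ p dvd
            (case u of (b, j, a) \<Rightarrow> smult (v (b, j, a)) ([:-z, 1:] ^ (p * j) * monom 1 a * y b)) -
            (case u of (b, j, a) \<Rightarrow> smult (v (b, j, a) * w ^ j) (monom 1 a * y b))"
        unfolding u prod.case by (metis dvd_mult2)
    qed
    moreover have "[:-x, 1:] ^ M dvd [:-x, 1:] ^ p" using M by (rule le_imp_power_dvd)
    ultimately have 1: "[:-x, 1:] ^ M dvd \<Psi> - \<Phi>" by (rule dvd_trans[rotated])
    have "[:-x, 1:] ^ M dvd \<Phi>"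
    proof (rule linear_power_dvd_of_iterated_deriv[of M "lin_prod I c (\<lambda>_. 1)"])
      show "M \<le> CHAR('a)" using M by (simp add: p_def)
      show "poly (lin_prod I c (\<lambda>_. 1)) x \<noteq> 0"
        using xc I by (auto simp: lin_prod_def poly_prod prod_zero_iff add.commute)
      fix m assume m: "m < M"
      have gy: "poly (y b) x = g b" if "b \<in> ?B" for b
        unfolding y_def g_def lin_prod_def poly_prod e_def
      proof (intro prod.cong refl)
        fix i assume "i \<in> I"
        then show "poly ([:c i, 1:] ^ (t i * b i)) x = \<gamma> i ^ b i"
          using Pts(3)[OF x] by (simp add: t_def power_mult add.commute)
      qed
      have "\<Phi> = (\<Sum>u\<in>U. smult (v u * w ^ fst (snd u)) (monom 1 (snd (snd u)) * lin_prod I c (e (fst u))))"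
        by (simp add: \<Phi>_def y_def split_beta)
      then have "poly ((poly_deriv_by (lin_prod I c (\<lambda>_. 1)) ^^ m) \<Phi>) x
         = (\<Sum>u\<in>U. poly (smult (v u * w ^ fst (snd u)) ((twisted_deriv I c (e (fst u)) ^^ m) (monom 1 (snd (snd u))) * y (fst u))) x)"
        unfolding y_def by (simp only: iterated_deriv_by_lin_prod[OF I] poly_sum)
      also have "\<dots> = (\<Sum>u\<in>U. poly (smult (v u) (q m u)) x)"
      proof (intro sum.cong refl)
        fix u assume "u \<in> U"
        then obtain b j a where u: "u = (b, j, a)" "b \<in> ?B" by (auto simp: U_def)
        show "poly (smult (v u * w ^ fst (snd u)) ((twisted_deriv I c (e (fst u)) ^^ m) (monom 1 (snd (snd u))) * y (fst u))) x
            = poly (smult (v u) (q m u)) x"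
          by (simp add: u(1) q_def gy[OF u(2)] w_def mult_ac)
      qed
      also have "\<dots> = poly (\<Sum>u\<in>U. smult (v u) (q m u)) x" by (simp add: poly_sum)
      finally show "poly ((poly_deriv_by (lin_prod I c (\<lambda>_. 1)) ^^ m) \<Phi>) x = 0" by (simp add: q0[OF m])
    qed
    with 1 have "[:-x, 1:] ^ M dvd (\<Psi> - \<Phi>) + \<Phi>" by (rule dvd_add)
    then show ?thesis by simp
  qed
  have "card Pts * M \<le> degree \<Psi>" using nz Pts(1) dvd False by (intro card_mult_le_degree) auto
  also have "\<dots> \<le> A + p * J + p * k"
    unfolding \<Psi>_def
  proof (rule degree_sum_le[OF \<open>finite U\<close>])
    fix x assume "x \<in> U"
    then obtain b j a where x: "x = (b, j, a)" and u: "b \<in> ?B" "j < J" "a < A" unfolding U_def by blast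
    have "degree (y b) = (\<Sum>i\<in>I. t i * b i)" by (simp add: y_def degree_lin_prod[OF I] e_def)
    also have "\<dots> \<le> (\<Sum>i\<in>I. p)"
    proof (rule sum_mono)
      fix i assume i: "i \<in> I"
      then have "b i \<le> d i" using u(1) by (auto simp: exp_box_def PiE_def Pi_def dest!: bspec)
      then have "t i * b i \<le> t i * d i" by simp
      then show "t i * b i \<le> p" using td[OF i] by simp
    qed
    finally have 1: "degree (y b) \<le> p * k" by (simp add: k_def mult.commute)
    have 2: "degree ([:-z, 1:] ^ (p * j)) = p * j" by (simp add: degree_power_eq)
    have "degree ([:-z, 1:] ^ (p * j) * monom 1 a * y b) \<le> (p * j + a) + p * k"
      using 1 2 degree_mult_le[of "[:-z, 1:] ^ (p * j) * monom 1 a" "y b"] degree_mult_le[of "[:-z, 1:] ^ (p * j)" "monom 1 a"]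
        degree_monom_le[of "1 :: 'a" a] by linarith
    moreover have "p * j \<le> p * J" using u by simp
    ultimately have "degree ([:-z, 1:] ^ (p * j) * monom 1 a * y b) \<le> A + p * J + p * k"
      using u(3) by linarith
    then show "degree (case x of (b, j, a) \<Rightarrow> smult (v (b, j, a)) ([:-z, 1:] ^ (p * j) * monom 1 a * y b))
        \<le> A + p * J + p * k"
      unfolding x prod.case by (rule order.trans[OF degree_smult_le])
  qed
  finally show ?thesis by (simp add: k_def)
qed auto

lemma of_nat_power_CHAR:
  assumes "prime CHAR('a::comm_ring_1)"
  shows "(of_nat n :: 'a) ^ CHAR('a) = of_nat n"
proof (induction n)
  case 0
  then show ?case using assms by (simp add: power_0_left prime_gt_0_nat)
next
  case (Suc n)
  have "(1 + of_nat n :: 'a) ^ CHAR('a) = 1 ^ CHAR('a) + of_nat n ^ CHAR('a)"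
    by (rule freshmans_dream) (use assms in auto)
  then show ?case using Suc by simp
qed

text \<open>The order of vanishing \<open>M\<close> is nearly \<open>N * J\<close> while the degree
  of the auxiliary polynomial is about \<open>p * J\<close>, so the quotient exceeds
  \<open>p / N\<close> only by a proportion of order \<open>1 / J\<close>.\<close>

lemma stepanov_upper:
  fixes c \<gamma> :: "'i \<Rightarrow> 'a::alg_closed_field"
  defines "p \<equiv> CHAR('a)"
  assumes p: "prime p" and I: "finite I" and d: "\<And>i. i \<in> I \<Longrightarrow> d i dvd p - 1"
    and c: "inj_on c I" and \<gamma>: "\<And>i. i \<in> I \<Longrightarrow> \<gamma> i \<noteq> 0"
    and Pts: "finite Pts" "\<And>x. x \<in> Pts \<Longrightarrow> x ^ p = x" "\<And>x i. x \<in> Pts \<Longrightarrow> i \<in> I \<Longrightarrow> (x + c i) ^ ((p - 1) div d i) = \<gamma> i"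
    and N: "N = (\<Prod>i\<in>I. d i)" and J: "J \<ge> 2" and le: "N * (J\<^sup>2 * (card I * N + 1) + card I) \<le> p"
  shows "real (card Pts) \<le> p / N + p * (card I + 2) / ((real J - 1) * real N)"
proof -
  define k where "k = card I"
  have p1: "p > 1" using p by (rule prime_gt_1_nat)
  have "d i > 0" if "i \<in> I" for i using d[OF that] p1 by (cases "d i") auto
  then have N0: "N > 0" unfolding N using I by (simp add: prod_pos)
  obtain j where j: "J = Suc j" "j > 0" using J by (cases J) auto
  \<comment> \<open>With \<open>M = j * N\<close> and \<open>J = j + 1\<close>, the condition for
    more unknowns than equations reduces to \<open>j * (M * k + J) < A\<close>; \<open>A\<close> is
    the least such number.\<close>
  define M where "M = j * N"
  define A where "A = j * (M * k + J) + 1"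
  have AJ: "A \<le> J\<^sup>2 * (k * N + 1)"
    unfolding A_def M_def j by (simp add: power2_eq_square algebra_simps)
  have NA: "N * (A + k) \<le> p" using le AJ mult_le_mono2[of "A + k" "J\<^sup>2 * (k * N + 1) + k" N] unfolding k_def by linarith
  have NA': "N * A \<le> p" using NA by (simp add: distrib_left)
  then have "A \<le> p" using N0 by (metis add_leD1 le_trans mult_le_mono1 Suc_leI mult_1 One_nat_def)
  have "J * N \<le> p"
  proof -
    have "J * N \<le> A * N" unfolding A_def M_def using j N0 by (intro mult_le_mono1) (simp add: trans_le_add1)
    then show ?thesis using NA' by (simp only: mult.commute[of N A])
  qed
  then have Mp: "M \<le> p" unfolding M_def j by simp
  have "M * (A + M * k + J) < N * J * A"
  proof -
    have "j * (A + M * k + J) < J * A" unfolding j(1) A_def by (simp add: algebra_simps)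
    then have "N * (j * (A + M * k + J)) < N * (J * A)" using N0 by simp
    then show ?thesis by (simp add: M_def mult_ac)
  qed
  then have "card Pts * M \<le> A + p * J + p * k"
    using stepanov_bound[of I d c \<gamma> Pts N M A J] p I d c \<gamma> Pts N NA Mp unfolding p_def k_def by (simp add: card_exp_box)
  also have "\<dots> \<le> p * (J + (k + 1))" using \<open>A \<le> p\<close> by (simp add: algebra_simps)
  finally have "real (card Pts * M) \<le> real (p * (J + (k + 1)))" by (simp only: of_nat_le_iff)
  then have "real (card Pts) * (real j * real N) \<le> real p * (real j + real k + 2)"
    by (simp add: M_def j algebra_simps)
  then have "real (card Pts) \<le> real p * (real j + real k + 2) / (real j * real N)"
    using j N0 by (simp add: pos_le_divide_eq)
  also have "\<dots> = p / N + p * (card I + 2) / ((real J - 1) * real N)"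
    using j N0 by (simp add: field_simps k_def)
  finally show ?thesis .
qed

lemma card_roots_of_unity_le:
  assumes "d > 0"
  shows "card {x :: 'a::idom. x ^ d = 1} \<le> d" "finite {x :: 'a. x ^ d = 1}"
proof -
  define f where "f = monom (1 :: 'a) d - 1"
  have "coeff f d = 1" using assms by (simp add: f_def)
  then have "f \<noteq> 0" by auto
  have "{x :: 'a. x ^ d = 1} = {x. poly f x = 0}" by (auto simp: f_def poly_monom)
  moreover have "degree f \<le> d" unfolding f_def by (rule degree_diff_le) (simp_all add: degree_monom_le)
  ultimately show "card {x :: 'a::idom. x ^ d = 1} \<le> d" "finite {x :: 'a. x ^ d = 1}"
    using card_poly_roots_bound[OF \<open>f \<noteq> 0\<close>] poly_roots_finite[OF \<open>f \<noteq> 0\<close>] by auto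
qed

text \<open>The lower bound comes from the upper bounds for all the other cosets.\<close>

lemma stepanov_equidistribution:
  fixes c :: "'i \<Rightarrow> 'a::alg_closed_field"
  defines "p \<equiv> CHAR('a)"
  assumes p: "prime p" and I: "finite I" and d: "\<And>i. i \<in> I \<Longrightarrow> d i dvd p - 1"
    and c: "inj_on c I" "\<And>i. i \<in> I \<Longrightarrow> c i ^ p = c i"
    and N: "N = (\<Prod>i\<in>I. d i)" and J: "J \<ge> 2" and le: "N * (J\<^sup>2 * (card I * N + 1) + card I) \<le> p"
  shows "\<bar>real (card {x. x ^ p = x \<and> (\<forall>i\<in>I. (x + c i) ^ ((p - 1) div d i) = 1)}) - p / N\<bar>
           \<le> card I + p * (card I + 2) / (real J - 1)"
proof -
  define t where "t = (\<lambda>i. (p - 1) div d i)"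
  define F where "F = {x :: 'a. x ^ p = x}"
  define Pts where "Pts = (\<lambda>\<gamma>. {x \<in> F. \<forall>i\<in>I. (x + c i) ^ t i = \<gamma> i})"
  define \<Gamma> where "\<Gamma> = PiE I (\<lambda>i. {x :: 'a. x ^ d i = 1})"
  \<comment> \<open>The points where some \<open>x + c i\<close> vanishes have no prescribed root of
    unity at \<open>i\<close> and lie in none of the classes; they account for the summand
    \<open>card I\<close>.\<close>
  define Z where "Z = (\<lambda>i. - c i) ` I"
  define one where "one = (\<lambda>i\<in>I. 1 :: 'a)"
  define D where "D = p * (card I + 2) / ((real J - 1) * real N)"
  have p1: "p > 1" using p by (rule prime_gt_1_nat)
  have td: "t i * d i = p - 1" if "i \<in> I" for i using d[OF that] by (simp add: t_def)
  have dpos: "d i > 0" if "i \<in> I" for i using td[OF that] p1 by (cases "d i") auto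
  have N0: "N > 0" unfolding N using I dpos by (simp add: prod_pos)
  have D0: "D \<ge> 0" unfolding D_def using J by (intro divide_nonneg_nonneg mult_nonneg_nonneg) auto
  have finF: "finite F"
  proof -
    have "F \<subseteq> {x. x ^ (p - 1) = 1} \<union> {0}"
    proof
      fix x assume "x \<in> F"
      then have "x * (x ^ (p - 1) - 1) = 0" using p1 by (simp add: F_def algebra_simps flip: power_Suc)
      then show "x \<in> {x. x ^ (p - 1) = 1} \<union> {0}" by auto
    qed
    then show ?thesis using card_roots_of_unity_le(2)[of "p - 1"] p1 by (metis finite.simps finite_UnI finite_subset zero_less_diff)
  qed
  have cardF: "card F \<ge> p"
  proof -
    have "inj_on (of_nat :: nat \<Rightarrow> 'a) {..<p}"
      by (auto simp: inj_on_def of_nat_eq_iff_cong_CHAR p_def cong_less_modulus_unique_nat)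
    then have "card (of_nat ` {..<p} :: 'a set) = p" by (simp add: card_image)
    moreover have "(of_nat ` {..<p} :: 'a set) \<subseteq> F"
      using of_nat_power_CHAR[where 'a = 'a] p by (auto simp: F_def p_def)
    ultimately show ?thesis using card_mono[OF finF] by metis
  qed
  have upper: "real (card (Pts \<gamma>)) \<le> p / N + D" if "\<gamma> \<in> \<Gamma>" for \<gamma>
    unfolding D_def unfolding p_def
  proof (rule stepanov_upper[where c = c and \<gamma> = \<gamma> and I = I and d = d])
    show "\<gamma> i \<noteq> 0" if "i \<in> I" for i
      using \<open>\<gamma> \<in> \<Gamma>\<close> that dpos[OF that] by (auto simp: \<Gamma>_def PiE_def Pi_def power_0_left dest!: bspec)
    show "finite (Pts \<gamma>)" using finF by (simp add: Pts_def)
  qed (use p I d c(1) N J le in \<open>auto simp: p_def Pts_def F_def t_def\<close>)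
  have fin\<Gamma>: "finite \<Gamma>" unfolding \<Gamma>_def using I dpos by (intro finite_PiE) (auto intro: card_roots_of_unity_le)
  have card\<Gamma>: "card \<Gamma> \<le> N"
    unfolding \<Gamma>_def N card_PiE[OF I] using dpos by (intro prod_mono) (auto intro: card_roots_of_unity_le)
  have one: "one \<in> \<Gamma>" by (auto simp: one_def \<Gamma>_def)
  have X1: "Pts one = {x. x ^ p = x \<and> (\<forall>i\<in>I. (x + c i) ^ ((p - 1) div d i) = 1)}"
    by (auto simp: Pts_def one_def F_def t_def)
  have "F \<subseteq> Z \<union> (Pts one \<union> (\<Union>\<gamma>\<in>\<Gamma>-{one}. Pts \<gamma>))"
  proof
    fix x assume x: "x \<in> F"
    show "x \<in> Z \<union> (Pts one \<union> (\<Union>\<gamma>\<in>\<Gamma>-{one}. Pts \<gamma>))"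
    proof (cases "x \<in> Z")
      case False
      define \<gamma> where "\<gamma> = (\<lambda>i\<in>I. (x + c i) ^ t i)"
      have "\<gamma> i ^ d i = 1" if i: "i \<in> I" for i
      proof -
        have "x + c i \<noteq> 0" using False i by (auto simp: Z_def add_eq_0_iff2)
        moreover have "(x + c i) ^ p = x + c i"
          using freshmans_dream[of p x "c i"] p x c(2)[OF i] by (simp add: p_def F_def)
        then have "(x + c i) * (x + c i) ^ (p - 1) = x + c i" using p1 by (simp flip: power_Suc)
        ultimately have "(x + c i) ^ (p - 1) = 1" by simp
        then show ?thesis using i td[OF i] by (simp add: \<gamma>_def power_mult[symmetric])
      qed
      then have "\<gamma> \<in> \<Gamma>" by (auto simp: \<Gamma>_def \<gamma>_def)
      moreover have "x \<in> Pts \<gamma>" using x by (auto simp: Pts_def \<gamma>_def)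
      ultimately show ?thesis by auto
    qed auto
  qed
  then have "card F \<le> card (Z \<union> (Pts one \<union> (\<Union>\<gamma>\<in>\<Gamma>-{one}. Pts \<gamma>)))"
    using I finF fin\<Gamma> by (intro card_mono) (auto simp: Z_def Pts_def)
  also have "\<dots> \<le> card Z + (card (Pts one) + card (\<Union>\<gamma>\<in>\<Gamma>-{one}. Pts \<gamma>))"
    by (meson card_Un_le add_left_mono le_trans)
  also have "card Z \<le> card I" unfolding Z_def by (rule card_image_le[OF I])
  also have "card (\<Union>\<gamma>\<in>\<Gamma>-{one}. Pts \<gamma>) \<le> (\<Sum>\<gamma>\<in>\<Gamma>-{one}. card (Pts \<gamma>))"
    by (rule card_UN_le) (use fin\<Gamma> in auto)
  finally have "p \<le> card I + (card (Pts one) + (\<Sum>\<gamma>\<in>\<Gamma>-{one}. card (Pts \<gamma>)))" using cardF by linarith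
  then have "real p \<le> real (card I) + (real (card (Pts one)) + (\<Sum>\<gamma>\<in>\<Gamma>-{one}. real (card (Pts \<gamma>))))"
    by (metis of_nat_add of_nat_le_iff of_nat_sum)
  also have "(\<Sum>\<gamma>\<in>\<Gamma>-{one}. real (card (Pts \<gamma>))) \<le> (\<Sum>\<gamma>\<in>\<Gamma>-{one}. p / N + D)"
    by (intro sum_mono upper) auto
  also have "\<dots> = real (card \<Gamma> - 1) * (p / N + D)" using one fin\<Gamma> by simp
  also have "\<dots> \<le> (real N - 1) * (p / N + D)"
    using card\<Gamma> N0 D0 by (intro mult_right_mono) (auto simp: of_nat_diff)
  also have "(real N - 1) * (p / N + D) = real N * (p / N) + real N * D - p / N - D"
  proof -
    have "(n - 1) * (a + b) = n * a + n * b - a - b" for n a b :: real by (simp add: algebra_simps)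
    then show ?thesis .
  qed
  also have "real N * (p / N) = p" using N0 by simp
  finally have low: "p / N - real (card (Pts one)) \<le> real (card I) + N * D" using D0 by linarith
  have "real N * D = p * (card I + 2) / (real J - 1)" using N0 by (simp add: D_def)
  moreover have "D \<le> real N * D" using N0 D0 by (simp add: mult_le_cancel_right1)
  ultimately show ?thesis using low upper[OF one] X1 by simp
qed

section \<open>Transfer to all primes\<close>

text \<open>A predicate on the number \<open>p\<close> alone, with the index type fixed to
  \<open>nat\<close>: it mentions no field, so a prime violating it can be chosen before any type is
  built.\<close>

definition power_residue_equidistributed :: "nat \<Rightarrow> bool" where
  "power_residue_equidistributed p \<longleftrightarrow>
     (\<forall>(I :: nat set) d c N J. finite I \<longrightarrow> (\<forall>i\<in>I. d i dvd p - 1) \<longrightarrow> inj_on (\<lambda>i. c i mod p) I \<longrightarrow>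
        N = (\<Prod>i\<in>I. d i) \<longrightarrow> J \<ge> 2 \<longrightarrow> N * (J\<^sup>2 * (card I * N + 1) + card I) \<le> p \<longrightarrow>
        \<bar>real (card {x. x < p \<and> (\<forall>i\<in>I. [(x + c i) ^ ((p - 1) div d i) = 1] (mod p))}) - p / N\<bar>
          \<le> card I + p * (card I + 2) / (real J - 1))"

lemma power_residue_equidistributed_CHAR:
  assumes p: "prime CHAR('a::alg_closed_field)"
  shows "power_residue_equidistributed CHAR('a)"
  unfolding power_residue_equidistributed_def
proof (intro allI impI)
  fix I :: "nat set" and d c :: "nat \<Rightarrow> nat" and N J :: nat
  assume I: "finite I" and d: "\<forall>i\<in>I. d i dvd CHAR('a) - 1" and c: "inj_on (\<lambda>i. c i mod CHAR('a)) I"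
    and N: "N = (\<Prod>i\<in>I. d i)" and J: "J \<ge> 2" and le: "N * (J\<^sup>2 * (card I * N + 1) + card I) \<le> CHAR('a)"
  define p where "p = CHAR('a)"
  define F where "F = {x :: 'a. x ^ p = x}"
  have p1: "p > 1" using p unfolding p_def by (rule prime_gt_1_nat)
  have inj: "inj_on (of_nat :: nat \<Rightarrow> 'a) {..<p}"
    by (auto simp: inj_on_def of_nat_eq_iff_cong_CHAR p_def cong_less_modulus_unique_nat)
  have "F \<subseteq> insert 0 {x. x ^ (p - 1) = 1}"
  proof
    fix x assume "x \<in> F"
    then have "x * (x ^ (p - 1) - 1) = 0" using p1 by (simp add: F_def algebra_simps flip: power_Suc)
    then show "x \<in> insert 0 {x. x ^ (p - 1) = 1}" by auto
  qed
  moreover have fin: "finite {x :: 'a. x ^ (p - 1) = 1}" and le': "card {x :: 'a. x ^ (p - 1) = 1} \<le> p - 1"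
    using card_roots_of_unity_le[where 'a = 'a and d = "p - 1"] p1 by auto
  ultimately have finF: "finite F" and "card F \<le> card (insert 0 {x :: 'a. x ^ (p - 1) = 1})"
    by (auto intro: finite_subset card_mono)
  then have "card F \<le> p" using fin le' p1 card_insert_le_m1[of p "{x :: 'a. x ^ (p - 1) = 1}" 0] by simp
  moreover have "of_nat ` {..<p} \<subseteq> F"
    using of_nat_power_CHAR[where 'a = 'a] p by (auto simp: F_def p_def)
  \<comment> \<open>The fixed points of the Frobenius map number at most \<open>p\<close> and
    include \<open>p\<close> distinct residues, so they form the prime field.\<close>
  ultimately have F: "F = of_nat ` {..<p}"
    using card_seteq[OF finF, of "of_nat ` {..<p}"] card_image[OF inj] by simp
  define S where "S = {x. x < p \<and> (\<forall>i\<in>I. [(x + c i) ^ ((p - 1) div d i) = 1] (mod p))}"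
  have "{y :: 'a. y ^ p = y \<and> (\<forall>i\<in>I. (y + of_nat (c i)) ^ ((p - 1) div d i) = 1)}
      = {y \<in> F. \<forall>i\<in>I. (y + of_nat (c i)) ^ ((p - 1) div d i) = 1}" by (auto simp: F_def)
  also have "\<dots> = of_nat ` {x. x < p \<and> (\<forall>i\<in>I. (of_nat x + of_nat (c i) :: 'a) ^ ((p - 1) div d i) = 1)}"
    unfolding F by auto
  also have "{x. x < p \<and> (\<forall>i\<in>I. (of_nat x + of_nat (c i) :: 'a) ^ ((p - 1) div d i) = 1)}
      = {x. x < p \<and> (\<forall>i\<in>I. [(x + c i) ^ ((p - 1) div d i) = 1] (mod p))}"
  proof -
    have "(of_nat x + of_nat y :: 'a) ^ m = 1 \<longleftrightarrow> [(x + y) ^ m = 1] (mod p)" for x y m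
      using of_nat_eq_iff_cong_CHAR[where 'a = 'a, of "(x + y) ^ m" 1] by (simp add: p_def)
    then show ?thesis by simp
  qed
  finally have set_eq: "{y :: 'a. y ^ p = y \<and> (\<forall>i\<in>I. (y + of_nat (c i)) ^ ((p - 1) div d i) = 1)} = of_nat ` S"
    by (simp only: S_def)
  have "inj_on (of_nat :: nat \<Rightarrow> 'a) S" using inj by (rule inj_on_subset) (simp only: S_def, blast)
  then have "card {y :: 'a. y ^ p = y \<and> (\<forall>i\<in>I. (y + of_nat (c i)) ^ ((p - 1) div d i) = 1)} = card S"
    unfolding set_eq by (rule card_image)
  moreover have cinj: "inj_on (\<lambda>i. of_nat (c i) :: 'a) I"
  proof (rule inj_onI)
    fix i j assume ij: "i \<in> I" "j \<in> I" "(of_nat (c i) :: 'a) = of_nat (c j)"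
    then have "c i mod CHAR('a) = c j mod CHAR('a)" by (simp only: of_nat_eq_iff_cong_CHAR Cong.cong_def)
    then show "i = j" using ij(1,2) by (rule inj_onD[OF c])
  qed
  have "\<bar>real (card {y :: 'a. y ^ p = y \<and> (\<forall>i\<in>I. (y + of_nat (c i)) ^ ((p - 1) div d i) = 1)}) - p / N\<bar>
           \<le> card I + p * (card I + 2) / (real J - 1)"
    unfolding p_def
    by (rule stepanov_equidistribution[OF p I _ cinj of_nat_power_CHAR[OF p] N J le]) (use d in blast)
  ultimately show "\<bar>real (card {x. x < CHAR('a) \<and> (\<forall>i\<in>I. [(x + c i) ^ ((CHAR('a) - 1) div d i) = 1] (mod CHAR('a)))})
      - CHAR('a) / N\<bar> \<le> card I + CHAR('a) * (card I + 2) / (real J - 1)"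
    by (simp only: p_def S_def)
qed

text \<open>Types cannot depend on \<open>p\<close>, but a type may be built from a closed term: a field whose
  characteristic is a fixed prime that violates the claim, if there is one, settles all primes.\<close>

definition exceptional_prime :: nat where
  "exceptional_prime = (if \<exists>p. prime p \<and> \<not> power_residue_equidistributed p
     then SOME p. prime p \<and> \<not> power_residue_equidistributed p else 2)"

lemma prime_exceptional_prime: "prime exceptional_prime"
  using someI_ex[of "\<lambda>p. prime p \<and> \<not> power_residue_equidistributed p"]
  by (auto simp: exceptional_prime_def)

typedef exceptional_residue = "{..<exceptional_prime}"
  using prime_exceptional_prime by (auto simp: prime_nat_iff)

lemma card_exceptional_residue: "CARD(exceptional_residue) = exceptional_prime"
  by (simp add: type_definition.card[OF type_definition_exceptional_residue])

instance exceptional_residue :: prime_card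
  by standard (simp add: card_exceptional_residue prime_exceptional_prime)

lemma power_residue_equidistribution:
  assumes "prime p" "finite (I :: nat set)" "\<And>i. i \<in> I \<Longrightarrow> d i dvd p - 1" "inj_on (\<lambda>i. c i mod p) I"
    and "N = (\<Prod>i\<in>I. d i)" "J \<ge> 2" "N * (J\<^sup>2 * (card I * N + 1) + card I) \<le> p"
  shows "\<bar>real (card {x. x < p \<and> (\<forall>i\<in>I. [(x + c i) ^ ((p - 1) div d i) = 1] (mod p))}) - p / N\<bar>
           \<le> card I + p * (card I + 2) / (real J - 1)"
proof -
  have "CHAR(exceptional_residue mod_ring alg_closure) = exceptional_prime"
    by (simp add: card_exceptional_residue)
  then have "power_residue_equidistributed exceptional_prime"
    using power_residue_equidistributed_CHAR[where 'a = "exceptional_residue mod_ring alg_closure"]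
      prime_exceptional_prime by simp
  \<comment> \<open>If any prime violated the claim, \<open>exceptional_prime\<close> would be such
    a prime by choice, yet it has just been shown to satisfy it.\<close>
  then have "\<not> (\<exists>p. prime p \<and> \<not> power_residue_equidistributed p)"
    using someI_ex[of "\<lambda>p. prime p \<and> \<not> power_residue_equidistributed p"]
    by (auto simp: exceptional_prime_def split: if_splits)
  then have "power_residue_equidistributed p" using assms(1) by blast
  then show ?thesis unfolding power_residue_equidistributed_def using assms(2-) by blast
qed

section \<open>The Moebius function, primitive roots and squarefree numbers\<close>

definition mobius :: "nat \<Rightarrow> real" where
  "mobius n = (if squarefree n then (-1) ^ card (prime_factors n) else 0)"

lemma abs_mobius_le: "\<bar>mobius n\<bar> \<le> 1"
  by (simp add: mobius_def)

lemma prod_primes_facts: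
  assumes "finite T" "\<And>q. q \<in> T \<Longrightarrow> prime q"
  shows "squarefree (\<Prod>T :: nat)" "prime_factors (\<Prod>T) = T"
proof -
  show "squarefree (\<Prod>T)"
    by (rule squarefree_prod_coprime) (use assms in \<open>auto intro: primes_coprime squarefree_prime\<close>)
  have "prime_factors (prod (\<lambda>x. x) T) = \<Union>((prime_factors \<circ> (\<lambda>x. x)) ` T)"
    by (rule prime_factors_prod) (use assms(1) assms(2)[of 0] in auto)
  also have "\<dots> = T" using assms by (auto simp: prime_prime_factors)
  finally show "prime_factors (\<Prod>T) = T" by simp
qed

lemma prod_prime_factors_dvd: "n > 0 \<Longrightarrow> \<Prod>(prime_factors n) dvd (n :: nat)"
proof -
  assume n: "n > 0"
  have "(\<Prod>q\<in>prime_factors n. q) dvd (\<Prod>q\<in>prime_factors n. q ^ multiplicity q n)"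
    by (rule prod_dvd_prod) (auto intro: dvd_power simp: prime_factors_multiplicity)
  then show ?thesis using prime_factorization_nat[of n] n by simp
qed

lemma prod_prime_factors_squarefree:
  assumes "squarefree (n :: nat)"
  shows "\<Prod>(prime_factors n) = n"
proof -
  have n: "n > 0" using assms by (cases n) auto
  have "(\<Prod>q\<in>prime_factors n. q ^ multiplicity q n) = (\<Prod>q\<in>prime_factors n. q)"
  proof (intro prod.cong refl)
    fix q assume q: "q \<in> prime_factors n"
    then have "multiplicity q n \<le> 1" using assms n squarefree_factorial_semiring''[of n]
      by (auto simp: in_prime_factors_iff)
    moreover have "multiplicity q n > 0" using q by (simp add: prime_factors_multiplicity)
    ultimately have "multiplicity q n = 1" by linarith
    then show "q ^ multiplicity q n = q" by simp
  qed
  then show ?thesis using prime_factorization_nat[of n] n by simp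
qed

text \<open>Only squarefree divisors count, and they are the products over subsets of the prime
  factors. It is applied with \<open>h\<close> equal to \<open>1\<close>, \<open>1 / d\<close> and
  \<open>mobius d\<close>.\<close>

lemma sum_mobius_divisors:
  assumes "n > 0"
  shows "(\<Sum>d | d dvd n. mobius d * h d) = (\<Sum>T\<in>Pow (prime_factors n). (-1) ^ card T * h (\<Prod>T))"
proof -
  have fin: "finite {d. d dvd n}" using assms by simp
  have "(\<Sum>d | d dvd n. mobius d * h d) = (\<Sum>d | d dvd n \<and> squarefree d. mobius d * h d)"
    by (rule sum.mono_neutral_right) (use fin in \<open>auto simp: mobius_def\<close>)
  also have "\<dots> = (\<Sum>T\<in>Pow (prime_factors n). (-1) ^ card T * h (\<Prod>T))"
  proof (rule sum.reindex_bij_witness[of _ "\<lambda>T. \<Prod>T" prime_factors])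
    fix d assume d: "d \<in> {d. d dvd n \<and> squarefree d}"
    then show "\<Prod>(prime_factors d) = d" by (auto intro: prod_prime_factors_squarefree)
    then show "(-1) ^ card (prime_factors d) * h (\<Prod>(prime_factors d)) = mobius d * h d"
      using d by (simp add: mobius_def)
    show "prime_factors d \<in> Pow (prime_factors n)" using d assms dvd_prime_factors[of n d] by auto
  next
    fix T assume T: "T \<in> Pow (prime_factors n)"
    have finT: "finite T" and pT: "\<And>q. q \<in> T \<Longrightarrow> prime q" using T by (auto intro: finite_subset)
    show "prime_factors (\<Prod>T) = T" by (rule prod_primes_facts(2)[OF finT pT])
    have "\<Prod>T dvd \<Prod>(prime_factors n)" using T by (intro prod_dvd_prod_subset) auto
    then show "\<Prod>T \<in> {d. d dvd n \<and> squarefree d}"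
      using prod_prime_factors_dvd[OF assms] prod_primes_facts(1)[OF finT pT] by (auto intro: dvd_trans)
  qed
  finally show ?thesis .
qed

lemma sum_mobius:
  assumes "n > 0"
  shows "(\<Sum>d | d dvd n. mobius d) = of_bool (n = 1)"
proof -
  have "(\<Sum>d | d dvd n. mobius d) = (\<Sum>T\<in>Pow (prime_factors n). (-1) ^ card T)"
    using sum_mobius_divisors[OF assms, of "\<lambda>_. 1"] by simp
  also have "\<dots> = (\<Prod>q\<in>prime_factors n. 1 - 1)"
    using prod_diff_conv_sum[of "prime_factors n" "\<lambda>_. 1" "\<lambda>_. 1 :: real"] by simp
  also have "\<dots> = of_bool (n = 1)"
  proof (cases "n = 1")
    case False
    then have "prime_factors n \<noteq> {}" using assms by (simp add: prime_factorization_empty_iff)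
    then show ?thesis using False by (simp add: card_gt_0_iff)
  qed auto
  finally show ?thesis .
qed

lemma sum_mobius_div:
  assumes "n > 0"
  shows "(\<Sum>d | d dvd n. mobius d / real d) = real (totient n) / real n"
proof -
  have "(\<Sum>d | d dvd n. mobius d / real d) = (\<Sum>T\<in>Pow (prime_factors n). (-1) ^ card T * (1 / real (\<Prod>T)))"
    using sum_mobius_divisors[OF assms, of "\<lambda>d. 1 / real d"] by simp
  also have "\<dots> = (\<Sum>T\<in>Pow (prime_factors n). (-1) ^ card T * (\<Prod>q\<in>T. 1 / real q) * (\<Prod>q\<in>prime_factors n - T. 1))"
    by (intro sum.cong refl) (simp add: prod_dividef)
  also have "\<dots> = (\<Prod>q\<in>prime_factors n. 1 - 1 / real q)"
    by (rule prod_diff_conv_sum[symmetric]) simp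
  finally show ?thesis using assms by (simp add: totient_formula2)
qed

text \<open>If \<open>x\<close> has order \<open>o'\<close> and \<open>e = (p - 1) / o'\<close>, the
  power condition for \<open>d\<close> means \<open>d dvd e\<close>, so the sum is the Moebius sum
  over the divisors of \<open>e\<close>, and \<open>e = 1\<close> characterises primitive roots. For
  \<open>p dvd x\<close> the order is \<open>0\<close> and every term vanishes.\<close>

lemma primitive_root_indicator:
  assumes p: "prime p"
  shows "of_bool (ord p x = p - 1) = (\<Sum>d | d dvd p - 1. mobius d * of_bool ([x ^ ((p - 1) div d) = 1] (mod p)))"
proof -
  have p1: "p > 1" using p by (rule prime_gt_1_nat)
  show ?thesis
  proof (cases "coprime p x")
    case False
    have "ord p x = 0" using False by (simp add: ord_eq_0)
    moreover have "\<not> [x ^ ((p - 1) div d) = 1] (mod p)" if d: "d dvd p - 1" for d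
    proof -
      have "ord p x dvd (p - 1) div d \<longleftrightarrow> (p - 1) div d = 0" using \<open>ord p x = 0\<close> by simp
      moreover have "(p - 1) div d \<noteq> 0" using d p1 by (simp add: dvd_div_eq_0_iff)
      ultimately show ?thesis using ord_divides[of x "(p - 1) div d" p] by blast
    qed
    ultimately show ?thesis using p1 by (auto intro!: sum.neutral)
  next
    case True
    define o' where "o' = ord p x"
    have "o' dvd p - 1"
      using order_divides_totient[of p x] True p by (simp add: o'_def totient_prime)
    then obtain e where e: "p - 1 = o' * e" by blast
    have pos: "o' > 0" "e > 0" using e p1 by (auto intro: gr0I)
    have "(\<Sum>d | d dvd p - 1. mobius d * of_bool ([x ^ ((p - 1) div d) = 1] (mod p)))
        = (\<Sum>d | d dvd p - 1. mobius d * of_bool (d dvd e))"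
    proof (intro sum.cong refl)
      fix d assume "d \<in> {d. d dvd p - 1}"
      then obtain m where m: "p - 1 = d * m" by auto
      have d: "d > 0" using m p1 by (auto intro: gr0I)
      have "o' dvd m \<longleftrightarrow> d dvd e"
      proof
        assume "o' dvd m"
        then obtain k where "m = o' * k" by blast
        then have "o' * e = o' * (d * k)" using m e by (simp only: mult_ac)
        then have "d * k = e" using pos(1) by simp
        then show "d dvd e" by auto
      next
        assume "d dvd e"
        then obtain k where "e = d * k" by blast
        then have "d * m = d * (o' * k)" using m e by (simp only: mult_ac)
        then show "o' dvd m" using d by simp
      qed
      then show "mobius d * of_bool ([x ^ ((p - 1) div d) = 1] (mod p)) = mobius d * of_bool (d dvd e)"
        using m d by (simp add: ord_divides' o'_def)
    qed
    also have "\<dots> = (\<Sum>d | d dvd e. mobius d)"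
    proof (rule sum.mono_neutral_cong_right)
      show "finite {d. d dvd p - 1}" using p1 by simp
    qed (use e in auto)
    also have "\<dots> = of_bool (e = 1)" by (rule sum_mobius[OF pos(2)])
    also have "e = 1 \<longleftrightarrow> ord p x = p - 1" using e pos p1 by (auto simp: o'_def)
    finally show ?thesis by simp
  qed
qed

section \<open>The squarefree indicator and its truncation\<close>

lemma squarefree_iff_square_part: "squarefree (m :: nat) \<longleftrightarrow> square_part m = 1"
proof
  assume "squarefree m"
  then have "square_part m dvd 1" by (rule squarefreeD) simp
  then show "square_part m = 1" by simp
next
  assume "square_part m = 1"
  then show "squarefree m" by (intro squarefreeI) (simp flip: dvd_square_part_iff)
qed

text \<open>The \<open>e\<close> whose square divides \<open>m\<close> are the divisors of
  \<open>square_part m\<close>, so this is the Moebius sum of that number.\<close>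

lemma squarefree_indicator:
  assumes "m > 0"
  shows "of_bool (squarefree m) = (\<Sum>e | e\<^sup>2 dvd m. mobius e)"
proof -
  have "square_part m > 0" by (rule gr0I) (use assms in simp)
  then have "(\<Sum>e | e dvd square_part m. mobius e) = of_bool (square_part m = 1)" by (rule sum_mobius)
  then show ?thesis by (simp only: dvd_square_part_iff squarefree_iff_square_part)
qed

definition sqf_trunc :: "nat \<Rightarrow> nat \<Rightarrow> real" where
  "sqf_trunc y m = (\<Sum>e=1..y. mobius e * of_bool (e\<^sup>2 dvd m))"

lemma abs_sqf_trunc_le: "\<bar>sqf_trunc y m\<bar> \<le> y"
proof -
  have "\<bar>sqf_trunc y m\<bar> \<le> (\<Sum>e=1..y. \<bar>mobius e * of_bool (e\<^sup>2 dvd m)\<bar>)" unfolding sqf_trunc_def by (rule sum_abs)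
  also have "\<dots> \<le> (\<Sum>e=1..y. 1)" by (intro sum_mono) (auto simp: abs_mult abs_mobius_le)
  finally show ?thesis by simp
qed

lemma sqf_trunc_error:
  assumes "m > 0"
  shows "\<bar>of_bool (squarefree m) - sqf_trunc y m\<bar> \<le> (\<Sum>e\<in>{y<..m}. of_bool (e\<^sup>2 dvd m))"
proof -
  have le: "e \<le> m" if "e\<^sup>2 dvd m" for e
    using dvd_imp_le[OF that assms] by (metis le_trans power2_nat_le_imp_le order_refl le_square power2_eq_square)
  have pos: "e > 0" if "e\<^sup>2 dvd m" for e using that assms by (cases e) auto
  have "of_bool (squarefree m) = (\<Sum>e\<in>{1..y} \<union> {y<..m}. mobius e * of_bool (e\<^sup>2 dvd m))"
    unfolding squarefree_indicator[OF assms]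
    by (rule sum.mono_neutral_cong_left) (use le pos in \<open>auto simp: Suc_le_eq not_less\<close>)
  also have "\<dots> = sqf_trunc y m + (\<Sum>e\<in>{y<..m}. mobius e * of_bool (e\<^sup>2 dvd m))"
    unfolding sqf_trunc_def by (rule sum.union_disjoint) auto
  finally have "\<bar>of_bool (squarefree m) - sqf_trunc y m\<bar> = \<bar>\<Sum>e\<in>{y<..m}. mobius e * of_bool (e\<^sup>2 dvd m)\<bar>"
    by simp
  also have "\<dots> \<le> (\<Sum>e\<in>{y<..m}. \<bar>mobius e * of_bool (e\<^sup>2 dvd m)\<bar>)" by (rule sum_abs)
  also have "\<dots> \<le> (\<Sum>e\<in>{y<..m}. of_bool (e\<^sup>2 dvd m))"
    by (intro sum_mono) (auto simp: abs_mult abs_mobius_le)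
  finally show ?thesis .
qed

lemma sum_inverse_squares_tail:
  assumes "y > 0"
  shows "(\<Sum>e\<in>{y<..M}. 1 / (real e)\<^sup>2) \<le> 1 / real y"
proof -
  have "(\<Sum>e\<in>{y<..M}. 1 / (real e)\<^sup>2) \<le> 1 / real y - 1 / real M" if "M \<ge> y"
    using that
  proof (induction M rule: dec_induct)
    case (step M)
    have "{y<..Suc M} = insert (Suc M) {y<..M}" using step by auto
    then have "(\<Sum>e\<in>{y<..Suc M}. 1 / (real e)\<^sup>2) \<le> 1 / (real (Suc M))\<^sup>2 + (1 / real y - 1 / real M)"
      using step by simp
    also have "1 / (real (Suc M))\<^sup>2 \<le> 1 / real M - 1 / real (Suc M)"
    proof -
      have M: "M > 0" using step assms by simp
      have "1 / (real (Suc M))\<^sup>2 \<le> 1 / (real M * real (Suc M))"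
        using M by (intro divide_left_mono) (auto simp: power2_eq_square)
      also have "\<dots> = 1 / real M - 1 / real (Suc M)" using M by (simp add: field_simps)
      finally show ?thesis .
    qed
    finally show ?case by simp
  qed auto
  moreover have "{y<..M} = {}" if "M < y" using that by auto
  ultimately show ?thesis by (cases "M \<ge> y") (fastforce intro: order.trans)+
qed

lemma card_multiples_le: "d > 0 \<Longrightarrow> real (card {m \<in> {1..M}. d dvd m}) \<le> real M / real d"
proof -
  assume d: "d > 0"
  have "card {m \<in> {1..M}. d dvd m} \<le> card {1..M div d}"
  proof (rule card_inj_on_le[of "\<lambda>m. m div d"])
    show "inj_on (\<lambda>m. m div d) {m \<in> {1..M}. d dvd m}" by (auto simp: inj_on_def elim!: dvdE)
    show "(\<lambda>m. m div d) ` {m \<in> {1..M}. d dvd m} \<subseteq> {1..M div d}"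
      using d by (auto simp: Suc_le_eq div_greater_zero_iff div_le_mono dest: dvd_imp_le)
  qed simp
  then have "real (card {m \<in> {1..M}. d dvd m}) \<le> real (M div d)" by simp
  also have "\<dots> \<le> real M / real d" by (rule of_nat_div_le_of_nat)
  finally show ?thesis .
qed

lemma sum_square_divisors_tail:
  assumes "y > 0"
  shows "(\<Sum>m=1..M. \<Sum>e\<in>{y<..m}. of_bool (e\<^sup>2 dvd m)) \<le> real M / real y"
proof -
  have "(\<Sum>m=1..M. \<Sum>e\<in>{y<..m}. of_bool (e\<^sup>2 dvd m)) \<le> (\<Sum>m=1..M. \<Sum>e\<in>{y<..M}. of_bool (e\<^sup>2 dvd m) :: real)"
    by (intro sum_mono sum_mono2) auto
  also have "\<dots> = (\<Sum>e\<in>{y<..M}. real (card {m \<in> {1..M}. e\<^sup>2 dvd m}))"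
    by (subst sum.swap) (simp add: of_bool_def sum.If_cases Int_def)
  also have "\<dots> \<le> (\<Sum>e\<in>{y<..M}. real M * (1 / (real e)\<^sup>2))"
  proof (rule sum_mono)
    fix e assume "e \<in> {y<..M}"
    then have "real (card {m \<in> {1..M}. e\<^sup>2 dvd m}) \<le> real M / real (e\<^sup>2)" by (intro card_multiples_le) auto
    then show "real (card {m \<in> {1..M}. e\<^sup>2 dvd m}) \<le> real M * (1 / (real e)\<^sup>2)" by simp
  qed
  also have "\<dots> = real M * (\<Sum>e\<in>{y<..M}. 1 / (real e)\<^sup>2)" by (rule sum_distrib_left[symmetric])
  also have "\<dots> \<le> real M * (1 / real y)" using sum_inverse_squares_tail[OF assms, of M] by (intro mult_left_mono) auto
  finally show ?thesis by simp
qed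

lemma sum_shift_le:
  fixes F :: "nat \<Rightarrow> real"
  assumes "\<And>m. 0 \<le> F m" "i \<le> 2"
  shows "(\<Sum>n\<in>{1..<N}. F (n + i)) \<le> (\<Sum>m=1..N+2. F m)"
proof -
  have "(\<Sum>n\<in>{1..<N}. F (n + i)) = (\<Sum>m\<in>{1+i..<N+i}. F m)" by (simp only: sum.shift_bounds_nat_ivl)
  also have "\<dots> \<le> (\<Sum>m=1..N+2. F m)" using assms by (intro sum_mono2) auto
  finally show ?thesis .
qed

lemma sum_square_divisors_tail_shift:
  assumes "y > 0" "i \<le> 2"
  shows "(\<Sum>n\<in>{1..<N}. \<Sum>e\<in>{y<..n+i}. of_bool (e\<^sup>2 dvd n + i)) \<le> real (N + 2) / real y"
  using order.trans[OF sum_shift_le[of "\<lambda>m. \<Sum>e\<in>{y<..m}. of_bool (e\<^sup>2 dvd m)" i N] sum_square_divisors_tail[of y "N + 2"]] assms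
  by (simp add: sum_nonneg)

section \<open>Weighted sums of periodic functions\<close>

lemma sum_lessThan_add:
  fixes f :: "nat \<Rightarrow> 'a::comm_monoid_add"
  shows "(\<Sum>n<a + b. f n) = (\<Sum>n<a. f n) + (\<Sum>n<b. f (n + a))"
  by (induction b) (simp_all add: add_ac)

lemma sum_shift_periodic_block:
  fixes w :: "nat \<Rightarrow> 'a::comm_monoid_add"
  assumes per: "\<And>n. w (n + Q) = w n"
  shows "(\<Sum>n<Q. w (n + s)) = (\<Sum>n<Q. w n)"
proof (induction s)
  case (Suc s)
  have "(\<Sum>n<Q. w (n + Suc s)) = (\<Sum>n\<in>{Suc 0..<Suc Q}. w (n + s))"
    by (subst sum.shift_bounds_Suc_ivl) (simp add: lessThan_atLeast0)
  also have "\<dots> = (\<Sum>n<Q. w (n + s))"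
  proof (cases Q)
    case (Suc q)
    have "(\<Sum>n\<in>{Suc 0..<Suc Q}. w (n + s)) = (\<Sum>n\<in>{Suc 0..<Q}. w (n + s)) + w (Q + s)"
      using Suc by simp
    also have "w (Q + s) = w (0 + s)" using per[of s] by (simp add: add.commute)
    also have "(\<Sum>n\<in>{Suc 0..<Q}. w (n + s)) + w (0 + s) = (\<Sum>n\<in>{0..<Q}. w (n + s))"
      using Suc by (simp add: sum.atLeast_Suc_lessThan add_ac)
    finally show ?thesis by (simp add: lessThan_atLeast0)
  qed auto
  finally show ?case using Suc by simp
qed auto

lemma periodic_add_mult:
  fixes w :: "nat \<Rightarrow> 'a"
  assumes "\<And>n. w (n + Q) = w n"
  shows "w (n + k * Q) = w n"
proof (induction k)
  case (Suc k)
  then show ?case using assms[of "n + k * Q"] by (simp add: add_ac)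
qed auto

lemma sum_periodic_approx:
  fixes w :: "nat \<Rightarrow> real"
  assumes per: "\<And>n. w (n + Q) = w n" and w: "\<And>n. 0 \<le> w n" "\<And>n. w n \<le> 1" and Q: "Q > 0"
  shows "\<bar>(\<Sum>n<N. w n) - real N * ((\<Sum>n<Q. w n) / real Q)\<bar> \<le> real Q"
proof -
  define S where "S = (\<Sum>n<Q. w n)"
  have blocks: "(\<Sum>n<k * Q. w n) = real k * S" for k
  proof (induction k)
    case (Suc k)
    have "(\<Sum>n<Suc k * Q. w n) = (\<Sum>n<k * Q. w n) + (\<Sum>n<Q. w (n + k * Q))"
      using sum_lessThan_add[of w "k * Q" Q] by (simp add: add.commute)
    also have "(\<Sum>n<Q. w (n + k * Q)) = S"
      unfolding S_def by (intro sum.cong refl periodic_add_mult per)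
    finally show ?case using Suc by (simp add: distrib_right)
  qed auto
  define q r where "q = N div Q" and "r = N mod Q"
  have N: "N = q * Q + r" and r: "r < Q" using Q by (simp_all add: q_def r_def)
  have "(\<Sum>n<N. w n) = real q * S + (\<Sum>n<r. w (n + q * Q))"
    unfolding N by (simp add: sum_lessThan_add blocks)
  moreover have "real N * (S / real Q) = real q * S + real r * (S / real Q)"
    using Q by (simp add: N field_simps)
  moreover have "0 \<le> (\<Sum>n<r. w (n + q * Q))" "(\<Sum>n<r. w (n + q * Q)) \<le> real r"
    using sum_mono[of "{..<r}" "\<lambda>n. w (n + q * Q)" "\<lambda>_. 1"] w by (auto intro: sum_nonneg)
  moreover have "0 \<le> S" "S \<le> real Q"
    using sum_mono[of "{..<Q}" w "\<lambda>_. 1"] w by (auto intro: sum_nonneg simp: S_def)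
  then have SQ: "0 \<le> S / real Q" "S / real Q \<le> 1" using Q by auto
  have "0 \<le> real r * (S / real Q)" using SQ(1) by (rule mult_nonneg_nonneg[OF of_nat_0_le_iff])
  moreover have "real r * (S / real Q) \<le> real r"
    using mult_left_mono[OF SQ(2), of "real r"] by (simp only: mult_1_right of_nat_0_le_iff simp_thms)
  ultimately show ?thesis using r unfolding S_def by linarith
qed

text \<open>Shifting the summation variable by multiples of \<open>3 * Q\<close> preserves the weight \<open>w\<close>, so by
  Cauchy--Schwarz only complete sums of \<open>f (n + s) * f (n + t)\<close> over a full period are needed.\<close>

lemma weighted_sum_bound:
  fixes f w :: "nat \<Rightarrow> real"
  assumes w: "\<And>n. w (n + Q) = w n" "\<And>n. \<bar>w n\<bar> \<le> 1" and f: "\<And>n. \<bar>f n\<bar> \<le> 1" and H: "H > 0" and E: "E \<ge> 0"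
    and corr: "\<And>h h'. h < H \<Longrightarrow> h' < H \<Longrightarrow> h \<noteq> h' \<Longrightarrow> (\<Sum>n<p. f (n + 3 * Q * h) * f (n + 3 * Q * h')) \<le> E"
  shows "\<bar>\<Sum>n<p. w n * f n\<bar> \<le> 6 * real Q * real H + sqrt ((real p)\<^sup>2 / real H + real p * E)"
proof -
  define T where "T = (\<Sum>n<p. w n * f n)"
  define V where "V = (\<lambda>n. \<Sum>h<H. f (n + 3 * Q * h))"
  \<comment> \<open>A shift by \<open>3 * Q * h\<close> changes the sum only by one block of that
    length at each end; the two blocks together have fewer than \<open>6 * Q * H\<close> terms, each
    at most \<open>1\<close> in absolute value.\<close>
  have shift: "\<bar>T - (\<Sum>n<p. w n * f (n + 3 * Q * h))\<bar> \<le> 6 * real Q * real H" if h: "h < H" for h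
  proof -
    define s where "s = 3 * Q * h"
    have ws: "w (n + s) = w n" for n
      using periodic_add_mult[of w Q n "3 * h"] w(1) by (simp add: s_def mult_ac)
    define g where "g = (\<lambda>n. w n * f n)"
    have gb: "\<bar>g n\<bar> \<le> 1" for n unfolding g_def abs_mult using w(2)[of n] f[of n] by (intro mult_le_one) auto
    have "(\<Sum>n<p. w n * f (n + 3 * Q * h)) = (\<Sum>n<p. g (n + s))"
      by (simp add: g_def ws flip: s_def)
    moreover have "(\<Sum>n<s + p. g n) = (\<Sum>n<s. g n) + (\<Sum>n<p. g (n + s))"
      by (simp add: sum_lessThan_add)
    moreover have "(\<Sum>n<s + p. g n) = (\<Sum>n<p. g n) + (\<Sum>n<s. g (n + p))"
      by (simp add: sum_lessThan_add add.commute[of s p])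
    moreover have bd: "\<bar>\<Sum>n<s. g (n + a)\<bar> \<le> real s" for a
      using order.trans[OF sum_abs sum_mono[of "{..<s}" "\<lambda>n. \<bar>g (n + a)\<bar>" "\<lambda>_. 1"]] gb by simp
    have "\<bar>\<Sum>n<s. g n\<bar> \<le> real s" "\<bar>\<Sum>n<s. g (n + p)\<bar> \<le> real s" using bd[of 0] bd[of p] by auto
    moreover have "real s \<le> 3 * real Q * real H" using h by (simp add: s_def mult_left_mono)
    moreover have "T = (\<Sum>n<p. g n)" by (simp add: T_def g_def)
    ultimately show ?thesis by linarith
  qed
  have "real H * T - (\<Sum>n<p. w n * V n) = (\<Sum>h<H. T - (\<Sum>n<p. w n * f (n + 3 * Q * h)))"
    by (simp add: V_def sum_distrib_left sum_subtractf sum.swap[of _ "{..<H}"])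
  then have 1: "\<bar>real H * T - (\<Sum>n<p. w n * V n)\<bar> \<le> real H * (6 * real Q * real H)"
    using order.trans[OF sum_abs sum_mono[of "{..<H}" "\<lambda>h. \<bar>T - (\<Sum>n<p. w n * f (n + 3 * Q * h))\<bar>" "\<lambda>_. 6 * real Q * real H"]]
      shift by simp
  have W: "(\<Sum>n<p. (w n)\<^sup>2) \<le> real p"
    using sum_mono[of "{..<p}" "\<lambda>n. (w n)\<^sup>2" "\<lambda>_. 1"] w(2) by (simp add: abs_square_le_1)
  have "(\<Sum>n<p. (V n)\<^sup>2) = (\<Sum>h<H. \<Sum>h'<H. \<Sum>n<p. f (n + 3 * Q * h) * f (n + 3 * Q * h'))"
    unfolding V_def power2_eq_square sum_product by (rule sum_rotate)
  \<comment> \<open>The diagonal is estimated trivially by \<open>p\<close>; it is the source of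
    \<open>p^2 / H\<close> under the root.\<close>
  also have "\<dots> \<le> (\<Sum>h<H. \<Sum>h'<H. (if h = h' then real p else 0) + E)"
  proof (intro sum_mono)
    fix h h' assume hh: "h \<in> {..<H}" "h' \<in> {..<H}"
    show "(\<Sum>n<p. f (n + 3 * Q * h) * f (n + 3 * Q * h')) \<le> (if h = h' then real p else 0) + E"
    proof (cases "h = h'")
      case True
      have "(\<Sum>n<p. f (n + 3 * Q * h) * f (n + 3 * Q * h)) \<le> (\<Sum>n<p. 1)"
        using f by (intro sum_mono) (simp add: abs_square_le_1 flip: power2_eq_square)
      then show ?thesis using True E by simp
    next
      case False
      then show ?thesis using corr[of h h'] hh by auto
    qed
  qed
  also have "\<dots> = real H * real p + (real H)\<^sup>2 * E"
    by (simp add: sum.distrib power2_eq_square algebra_simps)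
  finally have VV: "(\<Sum>n<p. (V n)\<^sup>2) \<le> real H * real p + (real H)\<^sup>2 * E" .
  have "(\<Sum>n<p. w n * V n)\<^sup>2 \<le> (\<Sum>n<p. (w n)\<^sup>2) * (\<Sum>n<p. (V n)\<^sup>2)" by (rule Cauchy_Schwarz_ineq_sum)
  also have "\<dots> \<le> real p * (real H * real p + (real H)\<^sup>2 * E)"
    by (intro mult_mono W VV) (simp_all add: sum_nonneg)
  also have "\<dots> = (real H)\<^sup>2 * ((real p)\<^sup>2 / real H + real p * E)"
    using H by (simp add: power2_eq_square field_simps)
  finally have "\<bar>\<Sum>n<p. w n * V n\<bar> \<le> sqrt ((real H)\<^sup>2 * ((real p)\<^sup>2 / real H + real p * E))"
    by (intro real_le_rsqrt) simp
  also have "\<dots> = real H * sqrt ((real p)\<^sup>2 / real H + real p * E)"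
    by (simp add: real_sqrt_mult)
  finally have "\<bar>real H * T\<bar> \<le> real H * (6 * real Q * real H + sqrt ((real p)\<^sup>2 / real H + real p * E))"
    using 1 unfolding distrib_left by linarith
  then have "real H * \<bar>T\<bar> \<le> real H * (6 * real Q * real H + sqrt ((real p)\<^sup>2 / real H + real p * E))"
    by (simp add: abs_mult)
  then show ?thesis using H unfolding T_def by simp
qed

section \<open>Triples of squarefree numbers\<close>

definition sqf3 :: "nat \<Rightarrow> real" where
  "sqf3 n = of_bool (squarefree n) * of_bool (squarefree (n + 1)) * of_bool (squarefree (n + 2))"

text \<open>Each cut-off exceeds the product of the previous ones by a factor \<open>y\<close>, so the tail for one factor
  stays small after multiplication with the trivial bounds for the other truncated factors.\<close>

definition sqf3_trunc :: "nat \<Rightarrow> nat \<Rightarrow> real" where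
  "sqf3_trunc y n = sqf_trunc y n * sqf_trunc (y ^ 2) (n + 1) * sqf_trunc (y ^ 4) (n + 2)"

lemma abs_triple_product_diff:
  fixes a b c A B C :: real
  assumes "\<bar>b\<bar> \<le> 1" "\<bar>c\<bar> \<le> 1" "\<bar>A\<bar> \<le> s" "\<bar>B\<bar> \<le> t"
  shows "\<bar>a * b * c - A * B * C\<bar> \<le> \<bar>a - A\<bar> + s * \<bar>b - B\<bar> + s * t * \<bar>c - C\<bar>"
proof -
  have "a * b * c - A * B * C = (a - A) * (b * c) + A * (b - B) * c + A * B * (c - C)" by (simp add: algebra_simps)
  then have "\<bar>a * b * c - A * B * C\<bar> \<le> \<bar>a - A\<bar> * (\<bar>b\<bar> * \<bar>c\<bar>) + \<bar>A\<bar> * \<bar>b - B\<bar> * \<bar>c\<bar> + \<bar>A\<bar> * \<bar>B\<bar> * \<bar>c - C\<bar>"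
    by (simp flip: abs_mult)
  also have "\<dots> \<le> \<bar>a - A\<bar> * (1 * 1) + s * \<bar>b - B\<bar> * 1 + s * t * \<bar>c - C\<bar>"
    by (intro add_mono mult_mono) (use assms in \<open>auto intro!: mult_nonneg_nonneg mult_le_one\<close>)
  finally show ?thesis by simp
qed

lemma abs_sqf3_trunc_le: "\<bar>sqf3_trunc y n\<bar> \<le> real (y ^ 7)"
proof -
  have "\<bar>sqf3_trunc y n\<bar> \<le> real y * real (y ^ 2) * real (y ^ 4)"
    unfolding sqf3_trunc_def abs_mult by (intro mult_mono abs_sqf_trunc_le) auto
  also have "\<dots> = real (y ^ 7)" by (simp add: power_numeral_reduce)
  finally show ?thesis .
qed

lemma sqf3_bounds: "0 \<le> sqf3 n" "sqf3 n \<le> 1"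
  by (auto simp: sqf3_def)

lemma sum_sqf3_trunc_error:
  assumes y: "y > 0"
  shows "(\<Sum>n<N. \<bar>sqf3 n - sqf3_trunc y n\<bar>) \<le> 3 * real (N + 2) / real y + real (y ^ 7) + 1"
proof (cases N)
  case (Suc N')
  define \<tau> where "\<tau> = (\<lambda>(i::nat) (y::nat) n. \<Sum>e\<in>{y<..n+i}. of_bool (e\<^sup>2 dvd n + i) :: real)"
  \<comment> \<open>The point \<open>0\<close> is divisible by every square, so the tail estimates
    do not cover it and it is split off.\<close>
  have "{..<N} = insert 0 {1..<N}" using Suc by auto
  then have "(\<Sum>n<N. \<bar>sqf3 n - sqf3_trunc y n\<bar>)
      = \<bar>sqf3 0 - sqf3_trunc y 0\<bar> + (\<Sum>n\<in>{1..<N}. \<bar>sqf3 n - sqf3_trunc y n\<bar>)" by simp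
  also have "\<bar>sqf3 0 - sqf3_trunc y 0\<bar> \<le> real (y ^ 7) + 1"
    using abs_sqf3_trunc_le[of y 0] sqf3_bounds[of 0] by linarith
  also have "(\<Sum>n\<in>{1..<N}. \<bar>sqf3 n - sqf3_trunc y n\<bar>)
      \<le> (\<Sum>n\<in>{1..<N}. \<tau> 0 y n + real y * \<tau> 1 (y\<^sup>2) n + real y * real (y\<^sup>2) * \<tau> 2 (y ^ 4) n)"
  proof (rule sum_mono)
    fix n assume n: "n \<in> {1..<N}"
    have "\<bar>sqf3 n - sqf3_trunc y n\<bar> \<le> \<bar>of_bool (squarefree n) - sqf_trunc y n\<bar>
        + real y * \<bar>of_bool (squarefree (n + 1)) - sqf_trunc (y ^ 2) (n + 1)\<bar>
        + real y * real (y ^ 2) * \<bar>of_bool (squarefree (n + 2)) - sqf_trunc (y ^ 4) (n + 2)\<bar>"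
      unfolding sqf3_def sqf3_trunc_def
      by (rule abs_triple_product_diff[OF _ _ abs_sqf_trunc_le abs_sqf_trunc_le]) auto
    also have "\<dots> \<le> \<tau> 0 y n + real y * \<tau> 1 (y\<^sup>2) n + real y * real (y\<^sup>2) * \<tau> 2 (y ^ 4) n"
      unfolding \<tau>_def using n sqf_trunc_error[of "n + 0" y] sqf_trunc_error[of "n + 1" "y ^ 2"] sqf_trunc_error[of "n + 2" "y ^ 4"]
      by (intro add_mono mult_left_mono) simp_all
    finally show "\<bar>sqf3 n - sqf3_trunc y n\<bar> \<le> \<tau> 0 y n + real y * \<tau> 1 (y\<^sup>2) n + real y * real (y\<^sup>2) * \<tau> 2 (y ^ 4) n" .
  qed
  also have "\<dots> = (\<Sum>n\<in>{1..<N}. \<tau> 0 y n) + real y * (\<Sum>n\<in>{1..<N}. \<tau> 1 (y\<^sup>2) n)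
      + real y * real (y\<^sup>2) * (\<Sum>n\<in>{1..<N}. \<tau> 2 (y ^ 4) n)"
    by (simp add: sum.distrib sum_distrib_left)
  also have "\<dots> \<le> real (N + 2) / real y + real y * (real (N + 2) / real (y\<^sup>2)) + real y * real (y\<^sup>2) * (real (N + 2) / real (y ^ 4))"
    unfolding \<tau>_def using y by (intro add_mono mult_left_mono sum_square_divisors_tail_shift) auto
  also have "\<dots> = 3 * real (N + 2) / real y"
    using y by (simp add: power2_eq_square power4_eq_xxxx field_simps)
  finally show ?thesis by simp
qed auto

definition square_triple :: "nat \<times> nat \<times> nat \<Rightarrow> nat \<Rightarrow> real" where
  "square_triple = (\<lambda>(a, b, c) n. of_bool (a\<^sup>2 dvd n \<and> b\<^sup>2 dvd n + 1 \<and> c\<^sup>2 dvd n + 2))"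

definition triple_range :: "nat \<Rightarrow> (nat \<times> nat \<times> nat) set" where
  "triple_range y = {1..y} \<times> {1..y ^ 2} \<times> {1..y ^ 4}"

text \<open>A common period of the three divisibility conditions. Only its size matters: the ranges
  multiply to \<open>y ^ 7\<close>, so it is at most \<open>y ^ 14\<close>.\<close>

definition triple_period :: "nat \<times> nat \<times> nat \<Rightarrow> nat" where
  "triple_period = (\<lambda>(a, b, c). (a * b * c)\<^sup>2)"

definition triple_mobius :: "nat \<times> nat \<times> nat \<Rightarrow> real" where
  "triple_mobius = (\<lambda>(a, b, c). mobius a * mobius b * mobius c)"

lemma sqf3_trunc_expand:
  "sqf3_trunc y n = (\<Sum>e\<in>triple_range y. triple_mobius e * square_triple e n)"
proof -
  have "sqf3_trunc y n = (\<Sum>a=1..y. \<Sum>b=1..y^2. \<Sum>c=1..y^4.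
      (mobius a * of_bool (a\<^sup>2 dvd n)) * (mobius b * of_bool (b\<^sup>2 dvd n + 1)) * (mobius c * of_bool (c\<^sup>2 dvd n + 2)))"
    unfolding sqf3_trunc_def sqf_trunc_def
    by (subst sum_product, subst sum_distrib_right, subst sum_distrib_right, subst sum_distrib_left, rule refl)
  also have "\<dots> = (\<Sum>e\<in>triple_range y. triple_mobius e * square_triple e n)"
    unfolding triple_range_def sum.cartesian_product' triple_mobius_def square_triple_def prod.case
    by (intro sum.cong refl) (simp add: of_bool_conj mult_ac)
  finally show ?thesis .
qed

lemma square_triple_periodic: "square_triple e (n + triple_period e) = square_triple e n"
proof -
  obtain a b c where e: "e = (a, b, c)" by (cases e)
  have "a\<^sup>2 dvd n + (a * b * c)\<^sup>2 \<longleftrightarrow> a\<^sup>2 dvd n" "b\<^sup>2 dvd n + (a * b * c)\<^sup>2 + 1 \<longleftrightarrow> b\<^sup>2 dvd n + 1"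
    "c\<^sup>2 dvd n + (a * b * c)\<^sup>2 + 2 \<longleftrightarrow> c\<^sup>2 dvd n + 2"
  proof -
    have d: "a\<^sup>2 dvd (a * b * c)\<^sup>2" "b\<^sup>2 dvd (a * b * c)\<^sup>2" "c\<^sup>2 dvd (a * b * c)\<^sup>2" by (simp_all add: power_mult_distrib)
    have "n + (a * b * c)\<^sup>2 + 1 = (n + 1) + (a * b * c)\<^sup>2" "n + (a * b * c)\<^sup>2 + 2 = (n + 2) + (a * b * c)\<^sup>2" by simp_all
    then show "a\<^sup>2 dvd n + (a * b * c)\<^sup>2 \<longleftrightarrow> a\<^sup>2 dvd n" "b\<^sup>2 dvd n + (a * b * c)\<^sup>2 + 1 \<longleftrightarrow> b\<^sup>2 dvd n + 1"
      "c\<^sup>2 dvd n + (a * b * c)\<^sup>2 + 2 \<longleftrightarrow> c\<^sup>2 dvd n + 2"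
      using d by (metis dvd_add_left_iff)+
  qed
  then show ?thesis by (simp add: e square_triple_def triple_period_def)
qed

lemma triple_range_facts:
  shows "finite (triple_range y)" "card (triple_range y) = y ^ 7"
    and "e \<in> triple_range y \<Longrightarrow> 0 < triple_period e" "e \<in> triple_range y \<Longrightarrow> triple_period e \<le> y ^ 14"
    and "\<bar>triple_mobius e\<bar> \<le> 1"
proof -
  show "finite (triple_range y)" by (simp add: triple_range_def)
  show "card (triple_range y) = y ^ 7" by (simp add: triple_range_def card_cartesian_product power_add[symmetric] flip: power_Suc)
  show "0 < triple_period e" if "e \<in> triple_range y" using that by (auto simp: triple_range_def triple_period_def)
  show "triple_period e \<le> y ^ 14" if "e \<in> triple_range y"
  proof -
    obtain a b c where e: "e = (a, b, c)" by (cases e)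
    have "a * b * c \<le> y * y ^ 2 * y ^ 4" using that by (intro mult_le_mono) (auto simp: e triple_range_def)
    also have "\<dots> = y ^ 7" by (simp add: power_numeral_reduce)
    finally have "(a * b * c)\<^sup>2 \<le> (y ^ 7)\<^sup>2" by (rule power_mono) simp
    then show ?thesis by (simp add: e triple_period_def flip: power_mult)
  qed
  show "\<bar>triple_mobius e\<bar> \<le> 1"
    unfolding triple_mobius_def by (cases e) (simp add: abs_mult abs_mobius_le mult_le_one)
qed

text \<open>There are \<open>y ^ 7\<close> periodic terms, each off its mean by at most its period,
  which is at most \<open>y ^ 14\<close>.\<close>

lemma sqf3_trunc_mean: "\<exists>M. \<forall>N. \<bar>(\<Sum>n<N. sqf3_trunc y n) - real N * M\<bar> \<le> real (y ^ 21)"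
proof -
  define m where "m = (\<lambda>e. (\<Sum>n<triple_period e. square_triple e n) / real (triple_period e))"
  have "\<bar>(\<Sum>n<N. sqf3_trunc y n) - real N * (\<Sum>e\<in>triple_range y. triple_mobius e * m e)\<bar> \<le> real (y ^ 21)" for N
  proof -
    have "(\<Sum>n<N. sqf3_trunc y n) - real N * (\<Sum>e\<in>triple_range y. triple_mobius e * m e)
        = (\<Sum>e\<in>triple_range y. triple_mobius e * ((\<Sum>n<N. square_triple e n) - real N * m e))"
      unfolding sqf3_trunc_expand by (subst sum.swap) (simp add: sum_distrib_left right_diff_distrib sum_subtractf mult_ac)
    also have "\<bar>\<dots>\<bar> \<le> (\<Sum>e\<in>triple_range y. \<bar>triple_mobius e * ((\<Sum>n<N. square_triple e n) - real N * m e)\<bar>)" by (rule sum_abs)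
    also have "\<dots> \<le> (\<Sum>e\<in>triple_range y. 1 * real (y ^ 14))"
    proof (rule sum_mono)
      fix e assume e: "e \<in> triple_range y"
      have "\<bar>(\<Sum>n<N. square_triple e n) - real N * m e\<bar> \<le> real (triple_period e)"
        unfolding m_def using triple_range_facts(3)[OF e]
        by (intro sum_periodic_approx square_triple_periodic) (auto simp: square_triple_def split: prod.split)
      also have "\<dots> \<le> real (y ^ 14)" using triple_range_facts(4)[OF e] by (simp only: of_nat_le_iff)
      finally show "\<bar>triple_mobius e * ((\<Sum>n<N. square_triple e n) - real N * m e)\<bar> \<le> 1 * real (y ^ 14)"
        unfolding abs_mult by (intro mult_mono triple_range_facts(5)) auto
    qed
    also have "\<dots> = real (y ^ 21)" by (simp add: triple_range_facts(2) flip: power_add)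
    finally show ?thesis .
  qed
  then show ?thesis by blast
qed

section \<open>Local densities modulo squares of primes and comparison with the Euler
  product\<close>

definition square_avoiding :: "nat \<Rightarrow> nat \<Rightarrow> real" where
  "square_avoiding q n = of_bool (\<not> q\<^sup>2 dvd n \<and> \<not> q\<^sup>2 dvd n + 1 \<and> \<not> q\<^sup>2 dvd n + 2)"

lemma square_avoiding_mod:
  assumes "q\<^sup>2 dvd m"
  shows "square_avoiding q (n mod m) = square_avoiding q n"
proof -
  have "n mod m mod q\<^sup>2 = n mod q\<^sup>2" using assms by (rule mod_mod_cancel)
  then have "(n mod m + i) mod q\<^sup>2 = (n + i) mod q\<^sup>2" for i by (metis mod_add_left_eq)
  then have "q\<^sup>2 dvd n mod m + i \<longleftrightarrow> q\<^sup>2 dvd n + i" for i by (simp add: dvd_eq_mod_eq_0)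
  from this[of 0] this[of 1] this[of 2] show ?thesis by (simp add: square_avoiding_def)
qed

text \<open>The excluded residues \<open>0\<close>, \<open>-1\<close> and \<open>-2\<close> are
  distinct because \<open>q^2\<close> is at least \<open>4\<close>; this is the origin of the factor
  \<open>1 - 3 / q^2\<close>.\<close>

lemma sum_square_avoiding:
  assumes q: "q \<ge> 2"
  shows "(\<Sum>n<q\<^sup>2. square_avoiding q n) = (real q)\<^sup>2 - 3"
proof -
  define m where "m = q\<^sup>2"
  have m: "m \<ge> 4" using power_mono[OF q, of 2] by (simp add: m_def)
  have "square_avoiding q n = of_bool (n \<notin> {0, m - 1, m - 2})" if n: "n < m" for n
  proof -
    have "m dvd n \<longleftrightarrow> n = 0" using n by (auto dest: dvd_imp_le)
    moreover have "m dvd n + 1 \<longleftrightarrow> n = m - 1"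
    proof
      assume "m dvd n + 1"
      then have "m \<le> n + 1" by (rule dvd_imp_le) simp
      then show "n = m - 1" using n by linarith
    qed (use m in auto)
    moreover have "m dvd n + 2 \<longleftrightarrow> n = m - 2"
    proof
      assume d: "m dvd n + 2"
      then have "m \<le> n + 2" by (rule dvd_imp_le) simp
      moreover have "n + 2 \<noteq> m + 1"
      proof
        assume "n + 2 = m + 1"
        then have "m dvd 1" using d by (metis dvd_add_triv_left_iff)
        then show False using m by simp
      qed
      ultimately show "n = m - 2" using n by linarith
    next
      assume "n = m - 2"
      then have "n + 2 = m" using m by linarith
      then show "m dvd n + 2" by simp
    qed
    ultimately show ?thesis by (auto simp: square_avoiding_def m_def[symmetric])
  qed
  then have "(\<Sum>n<m. square_avoiding q n) = (\<Sum>n<m. of_bool (n \<notin> {0, m - 1, m - 2}))" by (intro sum.cong) auto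
  also have "\<dots> = real (card ({..<m} - {0, m - 1, m - 2}))"
    by (simp add: of_bool_def sum.If_cases Diff_eq Compl_eq)
  also have "card ({..<m} - {0, m - 1, m - 2}) = m - 3"
    using m by (subst card_Diff_subset) (auto simp: card_insert_if)
  finally show ?thesis using m by (simp add: m_def of_nat_diff)
qed

lemma sum_mod_product:
  fixes f g :: "nat \<Rightarrow> real"
  assumes "coprime a b" "a > 0" "b > 0"
  shows "(\<Sum>n<a * b. f (n mod a) * g (n mod b)) = (\<Sum>n<a. f n) * (\<Sum>n<b. g n)"
proof -
  let ?h = "\<lambda>n. (n mod a, n mod b)"
  have inj: "inj_on ?h {..<a * b}"
  proof (rule inj_onI)
    fix m n assume mn: "m \<in> {..<a * b}" "n \<in> {..<a * b}" "?h m = ?h n"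
    then have "[m = n] (mod a)" "[m = n] (mod b)" by (simp_all add: Cong.cong_def)
    then have "[m = n] (mod a * b)" using assms(1) by (rule coprime_cong_mult_nat)
    then show "m = n" using mn by (simp add: Cong.cong_def)
  qed
  have "?h ` {..<a * b} = {..<a} \<times> {..<b}"
    by (rule card_subset_eq) (use assms in \<open>auto simp: card_image[OF inj] card_cartesian_product\<close>)
  then have "bij_betw ?h {..<a * b} ({..<a} \<times> {..<b})" using inj by (simp add: bij_betw_def)
  then have "(\<Sum>n<a * b. (\<lambda>(i, j). f i * g j) (?h n)) = (\<Sum>(i, j)\<in>{..<a} \<times> {..<b}. f i * g j)"
    by (rule sum.reindex_bij_betw)
  then show ?thesis by (simp add: sum_product sum.cartesian_product)
qed

lemma sum_prod_square_avoiding: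
  assumes "finite S" "\<And>q. q \<in> S \<Longrightarrow> prime q"
  shows "(\<Sum>n<(\<Prod>q\<in>S. q\<^sup>2). \<Prod>q\<in>S. square_avoiding q n) = (\<Prod>q\<in>S. (real q)\<^sup>2 - 3)"
  using assms
proof (induction S rule: finite_induct)
  case (insert r S)
  define P where "P = (\<Prod>q\<in>S. q\<^sup>2)"
  have dvd: "q\<^sup>2 dvd P" if "q \<in> S" for q using that insert.hyps unfolding P_def by (intro dvd_prodI) auto
  have cop: "coprime (r\<^sup>2) P"
    unfolding P_def
  proof (rule prod_coprime_right)
    fix q assume "q \<in> S"
    then have "coprime r q" using insert.prems insert.hyps by (intro primes_coprime) auto
    then show "coprime (r\<^sup>2) (q\<^sup>2)" by simp
  qed
  have "q > 0" if "q \<in> insert r S" for q using insert.prems[OF that] by (rule prime_gt_0_nat)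
  then have pos: "r\<^sup>2 > 0" "P > 0" unfolding P_def by (auto intro!: prod_pos)
  have "(\<Sum>n<r\<^sup>2 * P. square_avoiding r n * (\<Prod>q\<in>S. square_avoiding q n))
      = (\<Sum>n<r\<^sup>2 * P. square_avoiding r (n mod r\<^sup>2) * (\<Prod>q\<in>S. square_avoiding q (n mod P)))"
    using dvd by (intro sum.cong refl arg_cong2[where f = "(*)"] prod.cong) (auto simp: square_avoiding_mod)
  also have "\<dots> = (\<Sum>n<r\<^sup>2. square_avoiding r n) * (\<Sum>n<P. \<Prod>q\<in>S. square_avoiding q n)"
    by (rule sum_mod_product[OF cop pos])
  also have "\<dots> = ((real r)\<^sup>2 - 3) * (\<Prod>q\<in>S. (real q)\<^sup>2 - 3)"
    using insert sum_square_avoiding[of r] prime_ge_2_nat[of r] by (simp add: P_def)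
  finally show ?case using insert.hyps by (simp add: P_def)
qed (auto simp: lessThan_Suc)

definition sieve_const :: "nat \<Rightarrow> real" where
  "sieve_const z = (\<Prod>q | prime q \<and> q \<le> z. 1 - 3 / (real q)\<^sup>2)"

text \<open>Unlike that of \<open>sqf3_trunc\<close>, the mean of this periodic approximation
  factors over primes. Its period, however, is the product of all \<open>q^2\<close> with
  \<open>q\<close> up to \<open>z\<close>, so it serves only for \<open>N\<close> tending to
  infinity with \<open>z\<close> fixed.\<close>

definition sqf3_sieve :: "nat \<Rightarrow> nat \<Rightarrow> real" where
  "sqf3_sieve z n = (\<Prod>q | prime q \<and> q \<le> z. square_avoiding q n)"

lemma finite_primes_le: "finite {q :: nat. prime q \<and> q \<le> z}"
  by (rule finite_subset[of _ "{..z}"]) auto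

lemma sqf3_sieve_bounds: "0 \<le> sqf3_sieve z n" "sqf3_sieve z n \<le> 1"
  unfolding sqf3_sieve_def by (auto intro!: prod_nonneg prod_le_1 simp: square_avoiding_def)

lemma sqf3_sieve_mean: "\<exists>c. \<forall>N. \<bar>(\<Sum>n<N. sqf3_sieve z n) - real N * sieve_const z\<bar> \<le> c"
proof -
  let ?S = "{q :: nat. prime q \<and> q \<le> z}"
  define P where "P = (\<Prod>q\<in>?S. q\<^sup>2)"
  have pos: "P > 0" unfolding P_def by (auto intro!: prod_pos prime_gt_0_nat)
  have per: "sqf3_sieve z (n + P) = sqf3_sieve z n" for n
    unfolding sqf3_sieve_def
  proof (intro prod.cong refl)
    fix q assume "q \<in> ?S"
    then have d: "q\<^sup>2 dvd P" using finite_primes_le[of z] unfolding P_def by (intro dvd_prodI) auto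
    then have "square_avoiding q ((n + P) mod P) = square_avoiding q (n mod P)" by simp
    then show "square_avoiding q (n + P) = square_avoiding q n" by (simp only: square_avoiding_mod[OF d])
  qed
  have "(\<Sum>n<P. sqf3_sieve z n) = (\<Prod>q\<in>?S. (real q)\<^sup>2 - 3)"
    unfolding P_def sqf3_sieve_def by (rule sum_prod_square_avoiding) (use finite_primes_le in auto)
  also have "\<dots> = real P * sieve_const z"
    unfolding P_def sieve_const_def of_nat_prod prod.distrib[symmetric]
    by (intro prod.cong refl) (auto simp: field_simps dest: prime_gt_0_nat)
  finally have "(\<Sum>n<P. sqf3_sieve z n) / real P = sieve_const z" using pos by simp
  moreover have "\<bar>(\<Sum>n<N. sqf3_sieve z n) - real N * ((\<Sum>n<P. sqf3_sieve z n) / real P)\<bar> \<le> real P" for N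
    by (rule sum_periodic_approx[where w = "sqf3_sieve z" and Q = P, OF per sqf3_sieve_bounds pos])
  ultimately show ?thesis by auto
qed

text \<open>Apart from \<open>n = 0\<close>, the two functions differ only where the square of some
  prime above \<open>z\<close> divides one of \<open>n\<close>, \<open>n + 1\<close>,
  \<open>n + 2\<close>.\<close>

lemma sum_sqf3_sieve_error:
  assumes z: "z > 0"
  shows "(\<Sum>n<N. \<bar>sqf3_sieve z n - sqf3 n\<bar>) \<le> 3 * real (N + 2) / real z + 1"
proof (cases N)
  case (Suc N')
  define \<tau> where "\<tau> = (\<lambda>(i::nat) n. \<Sum>e\<in>{z<..n+i}. of_bool (e\<^sup>2 dvd n + i) :: real)"
  have \<tau>0: "\<tau> i n \<ge> 0" for i n by (simp add: \<tau>_def sum_nonneg)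
  have "{..<N} = insert 0 {1..<N}" using Suc by auto
  then have "(\<Sum>n<N. \<bar>sqf3_sieve z n - sqf3 n\<bar>) = \<bar>sqf3_sieve z 0 - sqf3 0\<bar> + (\<Sum>n\<in>{1..<N}. \<bar>sqf3_sieve z n - sqf3 n\<bar>)" by simp
  also have "\<bar>sqf3_sieve z 0 - sqf3 0\<bar> \<le> 1" using sqf3_bounds[of 0] sqf3_sieve_bounds[of z 0] by linarith
  also have "(\<Sum>n\<in>{1..<N}. \<bar>sqf3_sieve z n - sqf3 n\<bar>) \<le> (\<Sum>n\<in>{1..<N}. \<tau> 0 n + \<tau> 1 n + \<tau> 2 n)"
  proof (rule sum_mono)
    fix n assume n: "n \<in> {1..<N}"
    show "\<bar>sqf3_sieve z n - sqf3 n\<bar> \<le> \<tau> 0 n + \<tau> 1 n + \<tau> 2 n"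
    proof (cases "sqf3_sieve z n = sqf3 n")
      case True
      then show ?thesis using \<tau>0 by simp
    next
      case False
      have one: "\<bar>sqf3_sieve z n - sqf3 n\<bar> \<le> 1" using sqf3_bounds[of n] sqf3_sieve_bounds[of z n] by linarith
      have "\<exists>i\<in>{0,1,2}. \<exists>q. prime q \<and> q > z \<and> q\<^sup>2 dvd n + i"
      proof (rule ccontr)
        assume no: "\<not> ?thesis"
        have "sqf3_sieve z n = sqf3 n"
        proof (cases "\<exists>q. prime q \<and> q \<le> z \<and> square_avoiding q n = 0")
          case True
          then obtain q where q: "prime q" "q \<le> z" "square_avoiding q n = 0" by blast
          then have sv: "sqf3_sieve z n = 0" unfolding sqf3_sieve_def using finite_primes_le by (intro prod_zero) auto
          have nu: "\<not> q dvd 1" using q(1) by (metis not_prime_unit)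
          have "q\<^sup>2 dvd n \<or> q\<^sup>2 dvd n + 1 \<or> q\<^sup>2 dvd n + 2"
            using q(3) by (simp only: square_avoiding_def of_bool_eq_0_iff) blast
          then have "\<not> squarefree n \<or> \<not> squarefree (n + 1) \<or> \<not> squarefree (n + 2)"
            using not_squarefreeI[OF _ nu] by blast
          then have "sqf3 n = 0" by (auto simp only: sqf3_def of_bool_eq mult_zero_left mult_zero_right)
          with sv show ?thesis by simp
        next
          case F: False
          then have "sqf3_sieve z n = 1" unfolding sqf3_sieve_def
            by (intro prod.neutral) (auto simp: square_avoiding_def)
          moreover have "squarefree (n + i)" if i: "i \<in> {0,1,2}" for i
          proof -
            have "\<not> q\<^sup>2 dvd n + i" if q: "prime q" for q
            proof (cases "q \<le> z")
              case True
              then have "square_avoiding q n \<noteq> 0" using F q by blast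
              then show ?thesis using i by (auto simp: square_avoiding_def)
            qed (use no i q in auto)
            then show ?thesis using n by (subst squarefree_factorial_semiring) auto
          qed
          from this[of 0] this[of 1] this[of 2] have "sqf3 n = 1" by (simp add: sqf3_def)
          ultimately show ?thesis by simp
        qed
        then show False using False by simp
      qed
      then obtain i q where i: "i \<in> {0,1,2}" and q: "q > z" "q\<^sup>2 dvd n + i" by blast
      have "q \<le> q\<^sup>2" by (simp add: power2_eq_square)
      also have "\<dots> \<le> n + i" using q(2) n by (intro dvd_imp_le) auto
      finally have "q \<in> {z<..n+i}" using q by simp
      then have "1 \<le> \<tau> i n"
        unfolding \<tau>_def using member_le_sum[of q "{z<..n+i}" "\<lambda>e. of_bool (e\<^sup>2 dvd n + i) :: real"] q by auto
      then show ?thesis using one i \<tau>0[of 0 n] \<tau>0[of 1 n] \<tau>0[of 2 n] by auto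
    qed
  qed
  also have "\<dots> \<le> real (N + 2) / real z + real (N + 2) / real z + real (N + 2) / real z"
    unfolding sum.distrib \<tau>_def using z by (intro add_mono sum_square_divisors_tail_shift) auto
  also have "\<dots> = 3 * real (N + 2) / real z" using z by (simp add: field_simps)
  finally show ?thesis by simp
qed auto

lemma sieve_const_LIMSEQ: "sieve_const \<longlonglongrightarrow> sqfree_triple_const"
proof -
  let ?f = "\<lambda>q :: nat. if prime q then 1 - 3 / (real q)\<^sup>2 else 1"
  have "(\<lambda>z. \<Prod>q\<le>z. ?f q) \<longlonglongrightarrow> prodinf ?f"
    by (intro convergent_prod_LIMSEQ abs_convergent_prod_imp_convergent_prod convergent_sqfree_triple_const)
  moreover have "(\<Prod>q\<le>z. ?f q) = sieve_const z" for z
    unfolding sieve_const_def by (rule prod.mono_neutral_cong_right) auto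
  ultimately show ?thesis by (simp add: sqfree_triple_const_def)
qed

lemma le_of_linear_bound:
  fixes a b c :: real
  assumes "\<And>N :: nat. real N * a \<le> real N * b + c"
  shows "a \<le> b"
proof (rule ccontr)
  assume "\<not> a \<le> b"
  then have "a - b > 0" by simp
  obtain N :: nat where "c / (a - b) < real N" using reals_Archimedean2 by blast
  then have "c < real N * (a - b)" using \<open>a - b > 0\<close> by (simp add: pos_divide_less_eq)
  then show False using assms[of N] by (simp add: right_diff_distrib)
qed

text \<open>The mean value of \<open>sqf3_trunc y\<close> is never computed: letting first \<open>N\<close> and then \<open>z\<close> tend to infinity
  in the comparison with \<open>sqf3_sieve z\<close> shows that it is within \<open>3 / y\<close> of the constant.\<close>

lemma sum_sqf3_approx:
  assumes y: "y > 0"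
  shows "\<bar>(\<Sum>n<N. sqf3 n) - real N * sqfree_triple_const\<bar> \<le> 6 * real (N + 2) / real y + real (y ^ 7) + real (y ^ 21) + 1"
proof -
  obtain M where M: "\<And>N. \<bar>(\<Sum>n<N. sqf3_trunc y n) - real N * M\<bar> \<le> real (y ^ 21)" using sqf3_trunc_mean by blast
  have e1: "\<bar>(\<Sum>n<N. sqf3 n) - (\<Sum>n<N. sqf3_trunc y n)\<bar> \<le> 3 * real (N + 2) / real y + real (y ^ 7) + 1" for N
    unfolding sum_subtractf[symmetric] by (rule order.trans[OF sum_abs sum_sqf3_trunc_error[OF y]])
  have near: "\<bar>sieve_const z - M\<bar> \<le> 3 / real z + 3 / real y" if z: "z > 0" for z
  proof -
    obtain c where c: "\<And>N. \<bar>(\<Sum>n<N. sqf3_sieve z n) - real N * sieve_const z\<bar> \<le> c" using sqf3_sieve_mean by blast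
    have "real N * \<bar>sieve_const z - M\<bar> \<le> real N * (3 / real z + 3 / real y)
        + (c + real (y ^ 21) + 6 / real z + 6 / real y + real (y ^ 7) + 2)" for N
    proof -
      have "\<bar>(\<Sum>n<N. sqf3_sieve z n) - (\<Sum>n<N. sqf3 n)\<bar> \<le> 3 * real (N + 2) / real z + 1"
        unfolding sum_subtractf[symmetric] by (rule order.trans[OF sum_abs sum_sqf3_sieve_error[OF z]])
      then have "\<bar>real N * sieve_const z - real N * M\<bar> \<le> 3 * real (N + 2) / real z + 3 * real (N + 2) / real y
         + (c + real (y ^ 21) + real (y ^ 7) + 2)"
        using e1[of N] M[of N] c[of N] by linarith
      also have "\<bar>real N * sieve_const z - real N * M\<bar> = real N * \<bar>sieve_const z - M\<bar>"
        by (simp flip: right_diff_distrib add: abs_mult)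
      also have "3 * real (N + 2) / real z = real N * (3 / real z) + 6 / real z"
        using z by (simp add: field_simps)
      also have "3 * real (N + 2) / real y = real N * (3 / real y) + 6 / real y"
        using y by (simp add: field_simps)
      finally show ?thesis by (simp add: distrib_left)
    qed
    then show ?thesis by (rule le_of_linear_bound)
  qed
  have "\<bar>sqfree_triple_const - M\<bar> \<le> 0 + 3 / real y"
  proof (rule LIMSEQ_le)
    show "(\<lambda>z. \<bar>sieve_const z - M\<bar>) \<longlonglongrightarrow> \<bar>sqfree_triple_const - M\<bar>"
      by (intro tendsto_intros sieve_const_LIMSEQ)
    show "(\<lambda>z. 3 / real z + 3 / real y) \<longlonglongrightarrow> 0 + 3 / real y"
      by (intro tendsto_intros lim_const_over_n)
    show "\<exists>N. \<forall>n\<ge>N. \<bar>sieve_const n - M\<bar> \<le> 3 / real n + 3 / real y"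
      using near by (intro exI[of _ 1]) auto
  qed
  then have "real N * \<bar>sqfree_triple_const - M\<bar> \<le> real N * (3 / real y)" by (intro mult_left_mono) auto
  also have "\<dots> \<le> 3 * real (N + 2) / real y" using y by (simp add: divide_right_mono)
  also have "real N * \<bar>sqfree_triple_const - M\<bar> = \<bar>real N * sqfree_triple_const - real N * M\<bar>"
    by (simp flip: right_diff_distrib add: abs_mult)
  finally show ?thesis using e1[of N] M[of N] by linarith
qed

section \<open>Triples of power residues\<close>

definition power_residue :: "nat \<Rightarrow> nat \<Rightarrow> nat \<Rightarrow> real" where
  "power_residue p d x = of_bool ([x ^ ((p - 1) div d) = 1] (mod p))"

definition power_residue3 :: "nat \<Rightarrow> (nat \<Rightarrow> nat) \<Rightarrow> nat \<Rightarrow> real" where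
  "power_residue3 p d n = (\<Prod>i<3. power_residue p (d i) (n + i))"

lemma power_residue3_bounds: "0 \<le> power_residue3 p d n" "power_residue3 p d n \<le> 1"
  unfolding power_residue3_def power_residue_def by (auto intro!: prod_nonneg prod_le_1)

lemma prod_of_bool_sum_eq_card:
  fixes p :: nat
  assumes "finite I"
  shows "(\<Sum>n<p. \<Prod>i\<in>I. of_bool (P n i)) = real (card {n. n < p \<and> (\<forall>i\<in>I. P n i)})"
proof -
  have "(\<Prod>i\<in>I. of_bool (P n i)) = (of_bool (\<forall>i\<in>I. P n i) :: real)" for n
    using assms by (induction I rule: finite_induct) auto
  then have "(\<Sum>n<p. \<Prod>i\<in>I. of_bool (P n i)) = (\<Sum>n | n < p \<and> (\<forall>i\<in>I. P n i). 1 :: real)"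
    by (intro sum.mono_neutral_cong_right) auto
  then show ?thesis by simp
qed

lemma sum_power_residue_approx:
  assumes "prime p" "finite (I :: nat set)" "\<And>i. i \<in> I \<Longrightarrow> d i dvd p - 1" "inj_on (\<lambda>i. c i mod p) I"
    and "N = (\<Prod>i\<in>I. d i)" "J \<ge> 2" "N * (J\<^sup>2 * (card I * N + 1) + card I) \<le> p"
  shows "\<bar>(\<Sum>n<p. \<Prod>i\<in>I. power_residue p (d i) (n + c i)) - p / N\<bar> \<le> card I + (card I + 2) * (p / (real J - 1))"
proof -
  have "(card I + 2) * (p / (real J - 1)) = p * (card I + 2) / (real J - 1)" by (simp add: algebra_simps)
  then show ?thesis
    unfolding power_residue_def prod_of_bool_sum_eq_card[OF assms(2)]
    using power_residue_equidistribution[OF assms] by (simp only:)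
qed

text \<open>Expanding the product leaves one count with six translates and two with three. The main
  terms \<open>p / N^2\<close>, twice \<open>- p / N^2\<close>, and \<open>p / N^2\<close> cancel;
  the errors add up to \<open>12 = 6 + 3 + 3\<close> and \<open>18 = 8 + 5 + 5\<close>.\<close>

lemma power_residue3_correlation:
  fixes d :: "nat \<Rightarrow> nat"
  assumes p: "prime p" and d: "\<And>i. i < 3 \<Longrightarrow> d i dvd p - 1" and N: "N = (\<Prod>i<3. d i)" and J: "J \<ge> 2"
    and le: "N\<^sup>2 * (J\<^sup>2 * (6 * N\<^sup>2 + 1) + 6) \<le> p"
    and st: "s + 3 \<le> t \<or> t + 3 \<le> s" "s + 2 < p" "t + 2 < p"
  defines "f \<equiv> \<lambda>n. power_residue3 p d n - 1 / real N"
  shows "(\<Sum>n<p. f (n + s) * f (n + t)) \<le> 12 + 18 * (p / (real J - 1))"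
proof -
  define R where "R = p / (real J - 1)"
  define A where "A = power_residue3 p d"
  have R0: "R \<ge> 0" using J by (simp add: R_def)
  have p1: "p > 1" using p by (rule prime_gt_1_nat)
  have "d i > 0" if "i < 3" for i using d[OF that] p1 by (cases "d i") auto
  then have N1: "N \<ge> 1" unfolding N by (simp add: Suc_le_eq prod_pos)
  have single: "\<bar>(\<Sum>n<p. A (n + u)) - p / N\<bar> \<le> 3 + 5 * R" if u: "u + 2 < p" for u
  proof -
    have "\<bar>(\<Sum>n<p. \<Prod>i<3. power_residue p (d i) (n + (u + i))) - p / N\<bar> \<le> real (card {..<3::nat}) + real (card {..<3::nat} + 2) * (p / (real J - 1))"
    proof (rule sum_power_residue_approx[OF p])
      show "inj_on (\<lambda>i. (u + i) mod p) {..<3}" using u by (auto simp: inj_on_def)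
      have "N * (J\<^sup>2 * (3 * N + 1) + 3) \<le> N\<^sup>2 * (J\<^sup>2 * (6 * N\<^sup>2 + 1) + 6)"
        using N1 by (intro mult_le_mono add_mono) (auto simp: power2_eq_square)
      then show "N * (J\<^sup>2 * (card {..<3::nat} * N + 1) + card {..<3::nat}) \<le> p" using le by simp
    qed (use d N J in auto)
    then show ?thesis by (simp add: A_def power_residue3_def R_def add.assoc)
  qed
  define c where "c = (\<lambda>i. if i < 3 then s + i else t + (i - 3))"
  define dd where "dd = (\<lambda>i. if i < 3 then d i else d (i - 3))"
  have six: "{..<6::nat} = {..<3} \<union> (\<lambda>i. i + 3) ` {..<3}" 
  proof -
    have "(\<lambda>i. i + 3) ` {..<3} = {3..<6::nat}" by (simp add: lessThan_atLeast0 image_add_atLeastLessThan')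
    then show ?thesis by auto
  qed
  have prod6: "(\<Prod>i<6. F i) = (\<Prod>i<3. F i) * (\<Prod>i<3. F (i + 3))" for F :: "nat \<Rightarrow> 'b::comm_monoid_mult"
    unfolding six by (subst prod.union_disjoint) (auto simp: prod.reindex)
  have "\<bar>(\<Sum>n<p. \<Prod>i<6. power_residue p (dd i) (n + c i)) - p / real (N\<^sup>2)\<bar> \<le> real (card {..<6::nat}) + real (card {..<6::nat} + 2) * (p / (real J - 1))"
  proof (rule sum_power_residue_approx[OF p])
    have "c i < p" if "i < 6" for i using st that by (auto simp: c_def)
    moreover have "inj_on c {..<6}"
    proof (rule inj_onI)
      fix i j assume "i \<in> {..<6}" "j \<in> {..<6}" "c i = c j"
      then show "i = j" using st(1) unfolding c_def by (auto split: if_splits)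
    qed
    ultimately show "inj_on (\<lambda>i. c i mod p) {..<6}" by (simp add: inj_on_def)
    show "N\<^sup>2 = (\<Prod>i<6. dd i)" unfolding prod6 by (simp add: dd_def N power2_eq_square)
    show "dd i dvd p - 1" if "i \<in> {..<6}" for i using that d by (auto simp: dd_def)
  qed (use le J in auto)
  moreover have "(\<Prod>i<6. power_residue p (dd i) (n + c i)) = A (n + s) * A (n + t)" for n
    unfolding prod6 by (simp add: dd_def c_def A_def power_residue3_def add.assoc)
  ultimately have pair: "\<bar>(\<Sum>n<p. A (n + s) * A (n + t)) - p / (real N)\<^sup>2\<bar> \<le> 6 + 8 * R"
    by (simp add: R_def)
  define \<delta> where "\<delta> = 1 / real N"
  have \<delta>: "0 \<le> \<delta>" "\<delta> \<le> 1" using N1 by (auto simp: \<delta>_def)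
  have "(\<Sum>n<p. f (n + s) * f (n + t))
      = ((\<Sum>n<p. A (n + s) * A (n + t)) - p / (real N)\<^sup>2) - \<delta> * ((\<Sum>n<p. A (n + s)) - p / N) - \<delta> * ((\<Sum>n<p. A (n + t)) - p / N)"
    by (simp add: f_def A_def \<delta>_def algebra_simps sum.distrib sum_subtractf sum_distrib_left power2_eq_square)
  also have "\<dots> \<le> (6 + 8 * R) + 1 * (3 + 5 * R) + 1 * (3 + 5 * R)"
  proof -
    have "\<bar>\<delta> * ((\<Sum>n<p. A (n + u)) - p / N)\<bar> \<le> 1 * (3 + 5 * R)" if "u + 2 < p" for u
      unfolding abs_mult using \<delta> single[OF that] by (intro mult_mono) auto
    from this[OF st(2)] this[OF st(3)] show ?thesis using pair by linarith
  qed
  finally show ?thesis by (simp add: R_def)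
qed

lemma weighted_power_residue3_sum:
  fixes d :: "nat \<Rightarrow> nat"
  assumes p: "prime p" and d: "\<And>i. i < 3 \<Longrightarrow> d i dvd p - 1" and N: "N = (\<Prod>i<3. d i)" and J: "J \<ge> 2"
    and le: "N\<^sup>2 * (J\<^sup>2 * (6 * N\<^sup>2 + 1) + 6) \<le> p" and H: "H > 0" "3 * y ^ 14 * H \<le> p"
  shows "\<bar>\<Sum>n<p. sqf3_trunc y n * (power_residue3 p d n - 1 / real N)\<bar>
      \<le> real (y ^ 7) * (6 * real (y ^ 14) * real H + sqrt ((real p)\<^sup>2 / real H + real p * (12 + 18 * (p / (real J - 1)))))"
proof -
  define f where "f = (\<lambda>n. power_residue3 p d n - 1 / real N)"
  define E where "E = 12 + 18 * (p / (real J - 1))"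
  have E0: "E \<ge> 0" using J by (simp add: E_def)
  have p1: "p > 1" using p by (rule prime_gt_1_nat)
  have "d i > 0" if "i < 3" for i using d[OF that] p1 by (cases "d i") auto
  then have N1: "N \<ge> 1" unfolding N by (simp add: Suc_le_eq prod_pos)
  have fb: "\<bar>f n\<bar> \<le> 1" for n
  proof -
    have "0 \<le> 1 / real N" "1 / real N \<le> 1" using N1 by auto
    then show ?thesis using power_residue3_bounds[of p d n] unfolding f_def by linarith
  qed
  have one: "\<bar>\<Sum>n<p. square_triple e n * f n\<bar> \<le> 6 * real (y ^ 14) * real H + sqrt ((real p)\<^sup>2 / real H + real p * E)"
    if e: "e \<in> triple_range y" for e
  proof -
    define Q where "Q = triple_period e"
    have Q: "Q > 0" "Q \<le> y ^ 14" using triple_range_facts(3,4)[OF e] by (simp_all add: Q_def)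
    have "3 * Q * H \<le> p" using Q(2) H(2) mult_le_mono[of "3 * Q" "3 * y ^ 14" H H] by linarith
    have "\<bar>\<Sum>n<p. square_triple e n * f n\<bar> \<le> 6 * real Q * real H + sqrt ((real p)\<^sup>2 / real H + real p * E)"
    proof (rule weighted_sum_bound[OF _ _ fb H(1) E0])
      show "square_triple e (n + Q) = square_triple e n" for n unfolding Q_def by (rule square_triple_periodic)
      show "\<bar>square_triple e n\<bar> \<le> 1" for n by (auto simp: square_triple_def split: prod.split)
      fix h h' assume h: "h < H" "h' < H" "h \<noteq> h'"
      have b: "3 * Q * k + 2 < p" if "k < H" for k
      proof -
        have "3 * Q * (k + 1) \<le> 3 * Q * H" using that by (intro mult_le_mono2) simp
        then show ?thesis using Q(1) \<open>3 * Q * H \<le> p\<close> by simp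
      qed
      \<comment> \<open>The factor \<open>3\<close> in the shift is needed here: the windows of
        three consecutive translates must stay disjoint even when \<open>Q = 1\<close>.\<close>
      have gap: "3 * Q * k + 3 \<le> 3 * Q * k'" if "k < k'" for k k'
      proof -
        have "3 * Q * (k + 1) \<le> 3 * Q * k'" using that by (intro mult_le_mono2) simp
        then show ?thesis using Q(1) by simp
      qed
      show "(\<Sum>n<p. f (n + 3 * Q * h) * f (n + 3 * Q * h')) \<le> E"
        unfolding f_def E_def
      proof (rule power_residue3_correlation[OF p d N J le])
        show "3 * Q * h + 3 \<le> 3 * Q * h' \<or> 3 * Q * h' + 3 \<le> 3 * Q * h"
          using gap[of h h'] gap[of h' h] h(3) by (cases "h < h'") auto
      qed (use b h in auto)
    qed
    also have "6 * real Q * real H \<le> 6 * real (y ^ 14) * real H"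
      using Q(2) by (intro mult_right_mono mult_left_mono) auto
    finally show ?thesis by simp
  qed
  have "(\<Sum>n<p. sqf3_trunc y n * f n) = (\<Sum>e\<in>triple_range y. triple_mobius e * (\<Sum>n<p. square_triple e n * f n))"
    unfolding sqf3_trunc_expand sum_distrib_right by (subst sum.swap) (simp add: sum_distrib_left mult.assoc)
  also have "\<bar>\<dots>\<bar> \<le> (\<Sum>e\<in>triple_range y. \<bar>triple_mobius e * (\<Sum>n<p. square_triple e n * f n)\<bar>)" by (rule sum_abs)
  also have "\<dots> \<le> (\<Sum>e\<in>triple_range y. 1 * (6 * real (y ^ 14) * real H + sqrt ((real p)\<^sup>2 / real H + real p * E)))"
    unfolding abs_mult by (intro sum_mono mult_mono one triple_range_facts(5)) auto
  finally show ?thesis by (simp add: triple_range_facts(2) f_def E_def)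
qed

text \<open>Positivity is what the existence of triples rests on. The limit of the partial products
  gives only nonnegativity; that it is not zero follows from convergence of the product with nonzero
  factors, the smallest being \<open>1 / 4\<close> at \<open>q = 2\<close>.\<close>

lemma sqfree_triple_const_bounds: "0 < sqfree_triple_const" "sqfree_triple_const \<le> 1"
proof -
  have pos: "0 < 1 - 3 / (real q)\<^sup>2" if "prime q" for q
  proof -
    have "2 * 2 \<le> real q * real q" using prime_ge_2_nat[OF that] by (intro mult_mono) auto
    then show ?thesis by (simp add: power2_eq_square field_simps)
  qed
  have b: "0 \<le> sieve_const z" "sieve_const z \<le> 1" for z
  proof -
    have nn: "0 \<le> 1 - 3 / (real q)\<^sup>2" if "prime q" for q using pos[OF that] by (rule less_imp_le)
    show "0 \<le> sieve_const z" unfolding sieve_const_def by (rule prod_nonneg) (use nn in blast)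
    show "sieve_const z \<le> 1" unfolding sieve_const_def by (rule prod_le_1, rule conjI, rule nn) auto
  qed
  show "sqfree_triple_const \<le> 1"
    using b(2) by (intro LIMSEQ_le_const2[OF sieve_const_LIMSEQ]) auto
  have "0 \<le> sqfree_triple_const"
    using b(1) by (intro LIMSEQ_le_const[OF sieve_const_LIMSEQ]) auto
  moreover have "sqfree_triple_const \<noteq> 0"
    unfolding sqfree_triple_const_def
  proof (rule prodinf_nonzero[OF abs_convergent_prod_imp_convergent_prod[OF convergent_sqfree_triple_const]])
    fix q
    show "(if prime q then 1 - 3 / (real q)\<^sup>2 else 1) \<noteq> 0"
      using pos[of q] by (cases "prime q") (simp_all only: if_True if_False, simp_all)
  qed
  ultimately show "0 < sqfree_triple_const" by simp
qed

text \<open>With \<open>f\<close> the residue indicator minus its mean \<open>1 / N\<close>, the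
  difference splits into \<open>(sqf3 - sqf3_trunc) * f\<close>, \<open>sqf3_trunc * f\<close>, and
  \<open>1 / N\<close> times the deviation of the squarefree triples from their density.\<close>

lemma sum_sqf3_power_residue3_small:
  fixes d :: "nat \<Rightarrow> nat"
  assumes p: "prime p" and d: "\<And>i. i < 3 \<Longrightarrow> d i dvd p - 1" and N: "N = (\<Prod>i<3. d i)" and J: "J \<ge> 2"
    and le: "N\<^sup>2 * (J\<^sup>2 * (6 * N\<^sup>2 + 1) + 6) \<le> p" and H: "H > 0" "3 * y ^ 14 * H \<le> p" and y: "y > 0"
  shows "\<bar>(\<Sum>n<p. sqf3 n * power_residue3 p d n) - sqfree_triple_const * p / N\<bar>
      \<le> real (y ^ 7) * (6 * real (y ^ 14) * real H + sqrt ((real p)\<^sup>2 / real H + real p * (12 + 18 * (p / (real J - 1)))))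
        + 9 * real (p + 2) / real y + 2 * real (y ^ 7) + real (y ^ 21) + 2" (is "_ \<le> ?B + _ + _ + _ + _")
proof -
  define f where "f = (\<lambda>n. power_residue3 p d n - 1 / real N)"
  have p1: "p > 1" using p by (rule prime_gt_1_nat)
  have "d i > 0" if "i < 3" for i using d[OF that] p1 by (cases "d i") auto
  then have N1: "N \<ge> 1" unfolding N by (simp add: Suc_le_eq prod_pos)
  have fb: "\<bar>f n\<bar> \<le> 1" for n
  proof -
    have "0 \<le> 1 / real N" "1 / real N \<le> 1" using N1 by auto
    then show ?thesis using power_residue3_bounds[of p d n] unfolding f_def by linarith
  qed
  have "(\<Sum>n<p. sqf3 n * power_residue3 p d n) - sqfree_triple_const * p / N
      = (\<Sum>n<p. (sqf3 n - sqf3_trunc y n) * f n) + (\<Sum>n<p. sqf3_trunc y n * f n)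
        + ((\<Sum>n<p. sqf3 n) - real p * sqfree_triple_const) * (1 / N)"
    by (simp add: f_def algebra_simps sum.distrib sum_subtractf sum_distrib_left sum_divide_distrib)
  moreover have "\<bar>\<Sum>n<p. (sqf3 n - sqf3_trunc y n) * f n\<bar> \<le> 3 * real (p + 2) / real y + real (y ^ 7) + 1"
  proof -
    have "\<bar>\<Sum>n<p. (sqf3 n - sqf3_trunc y n) * f n\<bar> \<le> (\<Sum>n<p. \<bar>(sqf3 n - sqf3_trunc y n) * f n\<bar>)" by (rule sum_abs)
    also have "\<dots> \<le> (\<Sum>n<p. \<bar>sqf3 n - sqf3_trunc y n\<bar> * 1)"
      unfolding abs_mult using fb by (intro sum_mono mult_left_mono) auto
    also have "\<dots> \<le> 3 * real (p + 2) / real y + real (y ^ 7) + 1" using sum_sqf3_trunc_error[OF y, of p] by simp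
    finally show ?thesis .
  qed
  moreover have "\<bar>\<Sum>n<p. sqf3_trunc y n * f n\<bar> \<le> ?B"
    unfolding f_def by (rule weighted_power_residue3_sum[OF p d N J le H])
  moreover have "\<bar>((\<Sum>n<p. sqf3 n) - real p * sqfree_triple_const) * (1 / N)\<bar>
      \<le> (6 * real (p + 2) / real y + real (y ^ 7) + real (y ^ 21) + 1) * 1"
    unfolding abs_mult using N1 by (intro mult_mono sum_sqf3_approx[OF y]) auto
  moreover have "\<bar>u + v + w\<bar> \<le> ?B + 9 * real (p + 2) / real y + 2 * real (y ^ 7) + real (y ^ 21) + 2"
    if "\<bar>u\<bar> \<le> 3 * real (p + 2) / real y + real (y ^ 7) + 1" "\<bar>v\<bar> \<le> ?B"
      "\<bar>w\<bar> \<le> (6 * real (p + 2) / real y + real (y ^ 7) + real (y ^ 21) + 1) * 1" for u v w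
  proof -
    define B q where "B = ?B" and "q = real (p + 2) / real y"
    have "\<bar>u\<bar> \<le> 3 * q + real (y ^ 7) + 1" "\<bar>v\<bar> \<le> B" "\<bar>w\<bar> \<le> 6 * q + real (y ^ 7) + real (y ^ 21) + 1"
      using that unfolding B_def q_def by simp_all
    then have "\<bar>u + v + w\<bar> \<le> B + 9 * q + 2 * real (y ^ 7) + real (y ^ 21) + 2" by linarith
    then show ?thesis unfolding B_def q_def by simp
  qed
  ultimately show ?thesis by (simp only:)
qed

text \<open>For large \<open>d\<close> the equidistribution result is out of range; it is enough
  that \<open>x ^ m = 1\<close> has at most \<open>m\<close> solutions modulo \<open>p\<close>, here
  with \<open>m = (p - 1) div d\<close>.\<close>

lemma sum_power_residue_le:
  assumes p: "prime p" and d: "d dvd p - 1"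
  shows "(\<Sum>n<p. power_residue p d (n + i)) \<le> real p / real d"
proof -
  have p1: "p > 1" using p by (rule prime_gt_1_nat)
  have per: "power_residue p d (n + p) = power_residue p d n" for n
  proof -
    have "[(n + p) ^ ((p - 1) div d) = n ^ ((p - 1) div d)] (mod p)" by (intro cong_pow) (simp add: Cong.cong_def)
    moreover have "[a = 1] (mod p) \<longleftrightarrow> [b = 1] (mod p)" if "[a = b] (mod p)" for a b
      using that by (simp only: Cong.cong_def)
    ultimately show ?thesis unfolding power_residue_def by (simp only:)
  qed
  have pos: "(p - 1) div d > 0" "d > 0" using d p1 by (auto simp: dvd_div_eq_0_iff intro: gr0I)
  have "(\<Sum>n<p. power_residue p d (n + i)) = (\<Sum>n<p. power_residue p d n)"
    by (rule sum_shift_periodic_block[where w = "power_residue p d", OF per])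
  also have "\<dots> = real (card {x \<in> {..<p}. [x ^ ((p - 1) div d) = 1] (mod p)})"
    unfolding power_residue_def by (simp add: of_bool_def sum.If_cases Int_def)
  also have "\<dots> \<le> real ((p - 1) div d)"
    using roots_mod_prime_bound[OF p pos(1), of 1] by simp
  also have "\<dots> \<le> real (p - 1) / real d" by (rule of_nat_div_le_of_nat)
  also have "\<dots> \<le> real p / real d" by (intro divide_right_mono) auto
  finally show ?thesis .
qed

text \<open>No cancellation is involved: the sum and its expected value both lie between
  \<open>0\<close> and \<open>p / D\<close>.\<close>

lemma sum_sqf3_power_residue3_large:
  fixes d :: "nat \<Rightarrow> nat"
  assumes p: "prime p" and d: "\<And>i. i < 3 \<Longrightarrow> d i dvd p - 1" and N: "N = (\<Prod>i<3. d i)"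
    and j: "j < 3" "D < real (d j)" and D: "D > 0"
  shows "\<bar>(\<Sum>n<p. sqf3 n * power_residue3 p d n) - sqfree_triple_const * p / N\<bar> \<le> real p / D"
proof -
  have p1: "p > 1" using p by (rule prime_gt_1_nat)
  have dpos: "d i > 0" if "i < 3" for i using d[OF that] p1 by (cases "d i") auto
  have "sqf3 n * power_residue3 p d n \<le> 1 * power_residue p (d j) (n + j)" for n
  proof (rule mult_mono)
    have "power_residue3 p d n = power_residue p (d j) (n + j) * (\<Prod>i\<in>{..<3}-{j}. power_residue p (d i) (n + i))"
      unfolding power_residue3_def using j by (intro prod.remove) auto
    also have "\<dots> \<le> power_residue p (d j) (n + j) * 1"
      by (intro mult_left_mono prod_le_1) (auto simp: power_residue_def)
    finally show "power_residue3 p d n \<le> power_residue p (d j) (n + j)" by simp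
  qed (auto simp: sqf3_bounds power_residue3_bounds)
  then have "(\<Sum>n<p. sqf3 n * power_residue3 p d n) \<le> (\<Sum>n<p. power_residue p (d j) (n + j))" by (intro sum_mono) simp
  also have "\<dots> \<le> real p / real (d j)" by (rule sum_power_residue_le[OF p d[OF j(1)]])
  also have "\<dots> \<le> real p / D" using j D by (intro divide_left_mono) auto
  finally have 1: "(\<Sum>n<p. sqf3 n * power_residue3 p d n) \<le> real p / D" .
  have 2: "0 \<le> (\<Sum>n<p. sqf3 n * power_residue3 p d n)" by (intro sum_nonneg mult_nonneg_nonneg sqf3_bounds power_residue3_bounds)
  have "d j dvd N" unfolding N using j by (intro dvd_prodI) auto
  moreover have N0: "N > 0" unfolding N using dpos by (intro prod_pos) auto
  ultimately have "d j \<le> N" by (intro dvd_imp_le)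
  then have "D \<le> real N" using j(2) by linarith
  have "sqfree_triple_const * real p \<le> 1 * real p"
    using sqfree_triple_const_bounds(2) by (rule mult_right_mono) simp
  then have "sqfree_triple_const * p / N \<le> 1 * real p / N" by (rule divide_right_mono) simp
  also have "\<dots> \<le> real p / D" using \<open>D \<le> real N\<close> D by (simp add: divide_left_mono)
  finally have 3: "sqfree_triple_const * p / N \<le> real p / D" .
  have "0 \<le> sqfree_triple_const * p / N" using sqfree_triple_const_bounds by simp
  with 1 2 3 show ?thesis by linarith
qed

section \<open>The asymptotic formula\<close>

text \<open>Squarefreeness is left inside as the exact indicator \<open>sqf3\<close>, with values in
  \<open>[0, 1]\<close>, so that tuples with a large entry can be bounded trivially; the truncated
  version has no such bound.\<close>

lemma N2_three_eq:
  assumes p: "prime p"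
  shows "real (N2 3 p) = (\<Sum>\<delta>\<in>PiE {..<3} (\<lambda>_. {d. d dvd p - 1}).
            (\<Prod>i<3. mobius (\<delta> i)) * (\<Sum>n<p. sqf3 n * power_residue3 p \<delta> n))"
proof -
  let ?D = "{d. d dvd p - 1}"
  have p1: "p > 1" using p by (rule prime_gt_1_nat)
  have lt3: "(\<forall>i<3. P i) \<longleftrightarrow> P 0 \<and> P 1 \<and> P (2 :: nat)" for P
    by (auto simp: numeral_3_eq_3 numeral_2_eq_2 All_less_Suc)
  have prod3: "(\<Prod>i<3. F i) = F 0 * F 1 * F (2 :: nat)" for F :: "nat \<Rightarrow> real"
    by (simp add: numeral_3_eq_3 numeral_2_eq_2)
  have "real (N2 3 p) = (\<Sum>n<p. of_bool (\<forall>i<3. sqfree_primroot p (n + i)))"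
  proof -
    have "(\<Sum>n<p. of_bool (\<forall>i<3. sqfree_primroot p (n + i))) = (\<Sum>n | n < p \<and> (\<forall>i<3. sqfree_primroot p (n + i)). 1 :: real)"
      by (intro sum.mono_neutral_cong_right) auto
    then show ?thesis by (simp add: N2_def)
  qed
  also have "\<dots> = (\<Sum>n<p. sqf3 n * (\<Prod>i<3. of_bool (ord p (n + i) = p - 1)))"
    unfolding lt3 prod3 sqf3_def sqfree_primroot_def by (intro sum.cong refl) (auto simp: of_bool_conj)
  also have "\<dots> = (\<Sum>n<p. \<Sum>\<delta>\<in>PiE {..<3} (\<lambda>_. ?D). (\<Prod>i<3. mobius (\<delta> i)) * (sqf3 n * power_residue3 p \<delta> n))"
  proof (intro sum.cong refl)
    fix n
    have "(\<Prod>i<3. of_bool (ord p (n + i) = p - 1)) = (\<Prod>i<3. \<Sum>d\<in>?D. mobius d * power_residue p d (n + i))"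
      unfolding power_residue_def by (intro prod.cong refl primitive_root_indicator[OF p])
    also have "\<dots> = (\<Sum>\<delta>\<in>PiE {..<3} (\<lambda>_. ?D). \<Prod>i<3. mobius (\<delta> i) * power_residue p (\<delta> i) (n + i))"
      by (rule prod_sum_PiE) (use p1 in auto)
    finally show "sqf3 n * (\<Prod>i<3. of_bool (ord p (n + i) = p - 1))
        = (\<Sum>\<delta>\<in>PiE {..<3} (\<lambda>_. ?D). (\<Prod>i<3. mobius (\<delta> i)) * (sqf3 n * power_residue3 p \<delta> n))"
      by (simp add: sum_distrib_left prod.distrib power_residue3_def mult_ac)
  qed
  finally show ?thesis by (subst (asm) sum.swap) (simp add: sum_distrib_left)
qed

lemma sum_abs_mobius:
  assumes "n > 0"
  shows "(\<Sum>d | d dvd n. \<bar>mobius d\<bar>) = 2 ^ card (prime_factors n)"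
proof -
  have "(\<Sum>d | d dvd n. \<bar>mobius d\<bar>) = (\<Sum>d | d dvd n. mobius d * mobius d)"
    by (intro sum.cong refl) (simp add: mobius_def flip: power_add mult_2)
  also have "\<dots> = (\<Sum>T\<in>Pow (prime_factors n). (-1) ^ card T * mobius (\<Prod>T))"
    by (rule sum_mobius_divisors[OF assms])
  also have "\<dots> = (\<Sum>T\<in>Pow (prime_factors n). 1)"
  proof (intro sum.cong refl)
    fix T assume "T \<in> Pow (prime_factors n)"
    then have "finite T" "\<And>q. q \<in> T \<Longrightarrow> prime q" by (auto intro: finite_subset)
    then show "(-1) ^ card T * mobius (\<Prod>T) = 1"
      by (simp add: mobius_def prod_primes_facts flip: power_add mult_2)
  qed
  also have "\<dots> = 2 ^ card (prime_factors n)" by (simp add: card_Pow)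
  finally show ?thesis .
qed

text \<open>The main terms factor into the cube of the sum of \<open>mobius d / d\<close>, which is
  the totient ratio. The weights in the error are the cube of the number of squarefree divisors of
  \<open>p - 1\<close>, hence the base \<open>8\<close>.\<close>

lemma N2_three_error:
  assumes p: "prime p"
    and B: "\<And>\<delta>. (\<And>i. i < 3 \<Longrightarrow> \<delta> i dvd p - 1) \<Longrightarrow>
        \<bar>(\<Sum>n<p. sqf3 n * power_residue3 p \<delta> n) - sqfree_triple_const * p / real (\<Prod>i<3. \<delta> i)\<bar> \<le> B"
  shows "\<bar>real (N2 3 p) - sqfree_triple_const * (real (totient (p - 1)) / real (p - 1)) ^ 3 * real p\<bar>
           \<le> 8 ^ card (prime_factors (p - 1)) * B"
proof -
  let ?D = "{d. d dvd p - 1}"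
  let ?\<Delta> = "PiE {..<3} (\<lambda>_. ?D) :: (nat \<Rightarrow> nat) set"
  have p1: "p - 1 > 0" using prime_gt_1_nat[OF p] by simp
  have finD: "finite ?D" using p1 by simp
  have "(\<Sum>d\<in>?D. mobius d / real d) ^ 3 = (\<Prod>i<(3::nat). \<Sum>d\<in>?D. mobius d / real d)" by simp
  also have "\<dots> = (\<Sum>\<delta>\<in>?\<Delta>. \<Prod>i<3. mobius (\<delta> i) / real (\<delta> i))"
    by (rule prod_sum_PiE) (use finD in auto)
  finally have main: "(real (totient (p - 1)) / real (p - 1)) ^ 3 = (\<Sum>\<delta>\<in>?\<Delta>. (\<Prod>i<3. mobius (\<delta> i)) / real (\<Prod>i<3. \<delta> i))"
    unfolding sum_mobius_div[OF p1] by (simp add: prod_dividef)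
  have eq: "real (N2 3 p) - sqfree_triple_const * (real (totient (p - 1)) / real (p - 1)) ^ 3 * real p
      = (\<Sum>\<delta>\<in>?\<Delta>. (\<Prod>i<3. mobius (\<delta> i)) * ((\<Sum>n<p. sqf3 n * power_residue3 p \<delta> n) - sqfree_triple_const * p / real (\<Prod>i<3. \<delta> i)))"
    unfolding N2_three_eq[OF p] main by (simp add: right_diff_distrib sum_subtractf sum_distrib_left sum_distrib_right mult_ac)
  have "\<bar>real (N2 3 p) - sqfree_triple_const * (real (totient (p - 1)) / real (p - 1)) ^ 3 * real p\<bar>
      \<le> (\<Sum>\<delta>\<in>?\<Delta>. \<bar>(\<Prod>i<3. mobius (\<delta> i)) * ((\<Sum>n<p. sqf3 n * power_residue3 p \<delta> n) - sqfree_triple_const * p / real (\<Prod>i<3. \<delta> i))\<bar>)"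
    unfolding eq by (rule sum_abs)
  also have "\<dots> \<le> (\<Sum>\<delta>\<in>?\<Delta>. (\<Prod>i<3. \<bar>mobius (\<delta> i)\<bar>) * B)"
  proof (rule sum_mono)
    fix \<delta> assume \<delta>: "\<delta> \<in> ?\<Delta>"
    have \<delta>': "\<delta> i dvd p - 1" if "i < 3" for i using PiE_mem[OF \<delta>, of i] that by simp
    have "0 \<le> (\<Prod>i<3. \<bar>mobius (\<delta> i)\<bar>)" by (rule prod_nonneg) simp
    from mult_left_mono[OF B[of \<delta>, OF \<delta>'] this]
    show "\<bar>(\<Prod>i<3. mobius (\<delta> i)) * ((\<Sum>n<p. sqf3 n * power_residue3 p \<delta> n) - sqfree_triple_const * p / real (\<Prod>i<3. \<delta> i))\<bar>
        \<le> (\<Prod>i<3. \<bar>mobius (\<delta> i)\<bar>) * B" by (simp only: abs_mult abs_prod)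
  qed
  also have "\<dots> = (\<Prod>i<(3::nat). \<Sum>d\<in>?D. \<bar>mobius d\<bar>) * B"
    unfolding sum_distrib_right[symmetric] by (subst prod_sum_PiE) (use finD in auto)
  also have "\<dots> = 8 ^ card (prime_factors (p - 1)) * B"
    unfolding sum_abs_mobius[OF p1] by (simp add: power_mult[symmetric] power_mult_distrib[symmetric] mult.commute[of _ 3] power_mult)
  finally show ?thesis .
qed

text \<open>A prime \<open>q\<close> beyond \<open>B powr (1 / \<epsilon>)\<close> satisfies
  \<open>B \<le> q powr \<epsilon>\<close> and pays for its own factor \<open>B\<close>. The
  boundedly many smaller primes go into the constant.\<close>

lemma exponential_omega_bound:
  fixes B \<epsilon> :: real
  assumes B: "B \<ge> 1" and \<epsilon>: "\<epsilon> > 0"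
  shows "\<exists>K>0. \<forall>n>0. B ^ card (prime_factors n) \<le> K * real n powr \<epsilon>"
proof -
  obtain z :: nat where z: "B powr (1 / \<epsilon>) \<le> real z" using real_arch_simple by blast
  have "B ^ card (prime_factors n) \<le> B ^ (z + 1) * real n powr \<epsilon>" if n: "n > 0" for n
  proof -
    let ?P = "prime_factors n"
    have "B ^ card ?P = (\<Prod>q\<in>?P. B)" by simp
    also have "\<dots> \<le> (\<Prod>q\<in>?P. (if q \<le> z then B else 1) * real q powr \<epsilon>)"
    proof (rule prod_mono)
      fix q assume q: "q \<in> ?P"
      then have "real q \<ge> 1" using prime_ge_1_nat[of q] by auto
      then have "1 \<le> real q powr \<epsilon>" using \<epsilon> by (simp add: ge_one_powr_ge_zero)
      moreover have "B \<le> real q powr \<epsilon>" if "q > z"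
      proof -
        have "B = (B powr (1 / \<epsilon>)) powr \<epsilon>" using B \<epsilon> by (simp add: powr_powr)
        also have "\<dots> \<le> real q powr \<epsilon>" using that z \<epsilon> by (intro powr_mono2) auto
        finally show ?thesis .
      qed
      ultimately show "0 \<le> B \<and> B \<le> (if q \<le> z then B else 1) * real q powr \<epsilon>"
        using B mult_left_mono[of 1 "real q powr \<epsilon>" B] by auto
    qed
    also have "\<dots> = (\<Prod>q\<in>?P. if q \<le> z then B else 1) * real (\<Prod>?P) powr \<epsilon>"
      by (simp add: prod.distrib prod_powr_distrib)
    also have "(\<Prod>q\<in>?P. if q \<le> z then B else 1) = (\<Prod>q\<in>{q\<in>?P. q \<le> z}. B)" by (rule prod.inter_filter[symmetric]) simp
    also have "\<dots> \<le> B ^ (z + 1)"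
    proof -
      have "card {q\<in>?P. q \<le> z} \<le> card {..z}" by (rule card_mono) auto
      then show ?thesis using B by (simp add: power_increasing del: power_Suc)
    qed
    also have "real (\<Prod>?P) powr \<epsilon> \<le> real n powr \<epsilon>"
      using prod_prime_factors_dvd[OF n] n \<epsilon> by (intro powr_mono2) (auto dest: dvd_imp_le simp del: of_nat_prod)
    finally show ?thesis using B by (simp add: mult_left_mono mult_right_mono)
  qed
  then show ?thesis using B by (intro exI[of _ "B ^ (z + 1)"]) auto
qed

lemma totient_ratio_ge:
  assumes "n > 0"
  shows "1 / 2 ^ card (prime_factors n) \<le> real (totient n) / real n"
proof -
  have "(1 / 2) ^ card (prime_factors n) = (\<Prod>q\<in>prime_factors n. 1 / 2 :: real)" by simp
  also have "\<dots> \<le> (\<Prod>q\<in>prime_factors n. 1 - 1 / real q)"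
  proof (rule prod_mono)
    fix q assume "q \<in> prime_factors n"
    then have "real q \<ge> 2" using prime_ge_2_nat[of q] by auto
    then show "0 \<le> (1 / 2 :: real) \<and> 1 / 2 \<le> 1 - 1 / real q" by (simp add: field_simps)
  qed
  finally show ?thesis using assms by (simp add: totient_formula2 power_one_over)
qed

lemma nat_floor_bounds:
  assumes "x \<ge> (1 :: real)"
  shows "real (nat \<lfloor>x\<rfloor>) \<le> x" "x / 2 \<le> real (nat \<lfloor>x\<rfloor>)"
proof -
  have "\<lfloor>x\<rfloor> \<ge> 1" using assms by simp
  then show "real (nat \<lfloor>x\<rfloor>) \<le> x" by simp
  have "x < real_of_int \<lfloor>x\<rfloor> + 1" by linarith
  then show "x / 2 \<le> real (nat \<lfloor>x\<rfloor>)" using \<open>\<lfloor>x\<rfloor> \<ge> 1\<close> by linarith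
qed

text \<open>The parameters bring every main error down to \<open>u ^ 98\<close>. An entry above
  \<open>u^2\<close> gives \<open>p / u^2\<close>. Otherwise \<open>N \<le> u ^ 6\<close>; with
  \<open>y\<close> about \<open>u^2\<close> and \<open>H\<close> about \<open>u ^ 32\<close>, also
  used as \<open>J\<close>, the error \<open>p / y\<close> is of order \<open>u ^ 98\<close>, and so
  is \<open>y ^ 7 * p / sqrt H\<close>, as \<open>14 + 100 - 16 = 98\<close>. The constant is
  \<open>57 = 16 + 36 + 5\<close>.\<close>

lemma sum_sqf3_power_residue3_bound:
  assumes p: "prime p" and d: "\<And>i. i < 3 \<Longrightarrow> d i dvd p - 1" and u: "u \<ge> 13" "real p = u ^ 100"
  shows "\<bar>(\<Sum>n<p. sqf3 n * power_residue3 p d n) - sqfree_triple_const * p / real (\<Prod>i<3. d i)\<bar> \<le> 57 * u ^ 98"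
proof (cases "\<forall>i<3. real (d i) \<le> u\<^sup>2")
  case False
  then obtain j where j: "j < 3" "u\<^sup>2 < real (d j)" by auto
  have "\<bar>(\<Sum>n<p. sqf3 n * power_residue3 p d n) - sqfree_triple_const * p / real (\<Prod>i<3. d i)\<bar> \<le> real p / u\<^sup>2"
    by (rule sum_sqf3_power_residue3_large[where d = d and j = j, OF p d refl j]) (use u in auto)
  also have "\<dots> = u ^ 98" using u by (simp add: power_diff[symmetric] flip: power_diff)
  also have "\<dots> \<le> 57 * u ^ 98" using u by simp
  finally show ?thesis .
next
  case True
  have mono: "u ^ a \<le> u ^ b" if "a \<le> b" for a b using u that by (intro power_increasing) auto
  have one: "1 \<le> u ^ a" for a using u by (intro one_le_power) auto
  have pos: "0 < u ^ a" for a using u by simp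
  define y where "y = nat \<lfloor>u\<^sup>2\<rfloor>"
  define H where "H = nat \<lfloor>u ^ 32\<rfloor>"
  have y: "real y \<le> u\<^sup>2" "u\<^sup>2 / 2 \<le> real y" unfolding y_def by (rule nat_floor_bounds[OF one])+
  have H: "real H \<le> u ^ 32" "u ^ 32 / 2 \<le> real H" unfolding H_def by (rule nat_floor_bounds[OF one])+
  have yp: "real (y ^ a) \<le> u ^ (2 * a)" for a
    using power_mono[OF y(1), of a] by (simp add: power_mult)
  have "13 \<le> u ^ 1" "u ^ 1 \<le> u ^ 32" using u mono[of 1 32] by auto
  then have H4: "u ^ 32 / 4 \<le> real H - 1" "4 \<le> real H" using H(2) by linarith+
  have y0: "y > 0" using y(2) pos[of 2] by (cases y) auto
  define N where "N = (\<Prod>i<3. d i)"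
  have "real N \<le> (\<Prod>i<(3::nat). u\<^sup>2)" unfolding N_def of_nat_prod using True by (intro prod_mono) auto
  then have "real N \<le> u ^ 6" by (simp flip: power_mult)
  then have N2: "(real N)\<^sup>2 \<le> u ^ 12" using power_mono[of "real N" "u ^ 6" 2] by (simp flip: power_mult)
  have H2: "(real H)\<^sup>2 \<le> u ^ 64" using power_mono[OF H(1), of 2] by (simp flip: power_mult)
  have "real (N\<^sup>2 * (H\<^sup>2 * (6 * N\<^sup>2 + 1) + 6)) = (real N)\<^sup>2 * ((real H)\<^sup>2 * (6 * (real N)\<^sup>2 + 1) + 6)"
    by (simp add: algebra_simps)
  also have "\<dots> \<le> u ^ 12 * (u ^ 64 * (6 * u ^ 12 + 1) + 6)"
    by (intro mult_mono add_mono N2 H2 order_refl) (use pos[of 12] pos[of 64] in \<open>auto intro!: add_nonneg_nonneg mult_nonneg_nonneg\<close>)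
  also have "\<dots> = 6 * u ^ 88 + u ^ 76 + 6 * u ^ 12" by (simp add: algebra_simps flip: power_add)
  \<comment> \<open>The coefficients \<open>6 + 1 + 6\<close> are absorbed by one more power of
    \<open>u\<close>; this is where \<open>u \<ge> 13\<close> comes from. The exponent
    \<open>88\<close> is that of \<open>N^4 * H^2\<close>.\<close>
  also have "\<dots> \<le> 13 * u ^ 88" using mono[of 76 88] mono[of 12 88] by simp
  also have "\<dots> \<le> u ^ 1 * u ^ 88" using u by (intro mult_right_mono) auto
  also have "\<dots> \<le> real p" unfolding u(2) power_add[symmetric] by (rule mono) simp
  finally have le: "N\<^sup>2 * (H\<^sup>2 * (6 * N\<^sup>2 + 1) + 6) \<le> p" by (simp only: of_nat_le_iff)
  have yH: "real (y ^ 14) * real H \<le> u ^ 60"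
    using mult_mono[OF yp[of 14] H(1)] pos by (simp flip: power_add)
  have "real (3 * y ^ 14 * H) \<le> 3 * u ^ 60" using yH by simp
  also have "\<dots> \<le> u ^ 1 * u ^ 60" using u by (intro mult_right_mono) auto
  also have "\<dots> \<le> real p" unfolding u(2) power_add[symmetric] by (rule mono) simp
  finally have yHp: "3 * y ^ 14 * H \<le> p" by (simp only: of_nat_le_iff)
  have "real p / (real H - 1) \<le> u ^ 100 / (u ^ 32 / 4)"
    unfolding u(2) by (rule frac_le) (use H4(1) pos[of 32] pos[of 100] in simp_all)
  also have "\<dots> = 4 * u ^ 68" using u by (simp add: field_simps flip: power_add)
  finally have R: "real p / (real H - 1) \<le> 4 * u ^ 68" .
  have "12 + 18 * (real p / (real H - 1)) \<le> 84 * u ^ 68" using R one[of 68] by linarith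
  then have "real p * (12 + 18 * (real p / (real H - 1))) \<le> u ^ 100 * (84 * u ^ 68)"
    unfolding u(2) using pos[of 100] by (intro mult_left_mono) auto
  also have "\<dots> = 84 * u ^ 168" by (simp flip: power_add)
  finally have s1: "real p * (12 + 18 * (real p / (real H - 1))) \<le> 84 * u ^ 168" .
  have "(real p)\<^sup>2 / real H \<le> (u ^ 100)\<^sup>2 / (u ^ 32 / 2)"
    unfolding u(2) by (rule frac_le) (use H(2) pos[of 32] in simp_all)
  also have "\<dots> = 2 * u ^ 168" using u by (simp add: field_simps flip: power_add power_mult)
  finally have s2: "(real p)\<^sup>2 / real H \<le> 2 * u ^ 168" .
  have "sqrt ((real p)\<^sup>2 / real H + real p * (12 + 18 * (real p / (real H - 1)))) \<le> sqrt ((10 * u ^ 84)\<^sup>2)"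
  proof (rule real_sqrt_le_mono)
    have "(10 * u ^ 84)\<^sup>2 = 100 * u ^ 168" by (simp add: power_mult_distrib flip: power_mult)
    then show "(real p)\<^sup>2 / real H + real p * (12 + 18 * (real p / (real H - 1))) \<le> (10 * u ^ 84)\<^sup>2"
      using s1 s2 pos[of 168] by linarith
  qed
  also have "\<dots> = 10 * u ^ 84" unfolding real_sqrt_abs using pos[of 84] by simp
  finally have s3: "sqrt ((real p)\<^sup>2 / real H + real p * (12 + 18 * (real p / (real H - 1)))) \<le> 10 * u ^ 84" .
  have "6 * real (y ^ 14) * real H + sqrt ((real p)\<^sup>2 / real H + real p * (12 + 18 * (real p / (real H - 1)))) \<le> 16 * u ^ 84"
    using yH s3 mono[of 60 84] by simp
  then have "real (y ^ 7) * (6 * real (y ^ 14) * real H + sqrt ((real p)\<^sup>2 / real H + real p * (12 + 18 * (real p / (real H - 1)))))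
      \<le> u ^ 14 * (16 * u ^ 84)"
    using yp[of 7] pos[of 14] H4(2) by (intro mult_mono) (auto intro!: add_nonneg_nonneg divide_nonneg_nonneg)
  also have "\<dots> = 16 * u ^ 98" by (simp flip: power_add)
  finally have t1: "real (y ^ 7) * (6 * real (y ^ 14) * real H + sqrt ((real p)\<^sup>2 / real H + real p * (12 + 18 * (real p / (real H - 1)))))
      \<le> 16 * u ^ 98" .
  have "9 * real (p + 2) / real y \<le> (18 * u ^ 100) / (u\<^sup>2 / 2)"
    using y(2) y0 pos[of 2] u prime_ge_2_nat[OF p] by (intro frac_le) auto
  also have "\<dots> = 36 * u ^ 98" using u by (simp add: field_simps flip: power_add)
  finally have t2: "9 * real (p + 2) / real y \<le> 36 * u ^ 98" .
  have t3: "2 * real (y ^ 7) + real (y ^ 21) + 2 \<le> 5 * u ^ 98"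
    using yp[of 7] yp[of 21] mono[of 14 98] mono[of 42 98] one[of 98] by simp
  have "2 \<le> H" using H4(2) by simp
  have "H > 0" using H4(2) by simp
  have "\<bar>(\<Sum>n<p. sqf3 n * power_residue3 p d n) - sqfree_triple_const * p / real N\<bar>
      \<le> real (y ^ 7) * (6 * real (y ^ 14) * real H + sqrt ((real p)\<^sup>2 / real H + real p * (12 + 18 * (real p / (real H - 1)))))
        + 9 * real (p + 2) / real y + 2 * real (y ^ 7) + real (y ^ 21) + 2"
    by (rule sum_sqf3_power_residue3_small[where d = d, OF p d N_def \<open>2 \<le> H\<close> le \<open>H > 0\<close> yHp y0])
  then show ?thesis unfolding N_def[symmetric] using t1 t2 t3 by linarith
qed

text \<open>The base is \<open>64\<close> rather than \<open>8\<close> because the existence proof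
  loses \<open>8\<close> to the number of prime factors of \<open>p - 1\<close> twice: once in the
  error, once in the lower bound for the cube of the totient ratio.\<close>

lemma N2_three_asymptotics:
  "\<exists>K>0. \<forall>p. prime p \<and> real p powr (1 / 100) \<ge> 13 \<longrightarrow>
     64 ^ card (prime_factors (p - 1)) \<le> K * real p powr (1 / 100) \<and>
     \<bar>real (N2 3 p) - sqfree_triple_const * (real (totient (p - 1)) / real (p - 1)) ^ 3 * real p\<bar>
       \<le> 8 ^ card (prime_factors (p - 1)) * (57 * (real p powr (1 / 100)) ^ 98)"
proof -
  obtain K where K: "K > 0" "\<And>n. n > 0 \<Longrightarrow> (64 :: real) ^ card (prime_factors n) \<le> K * real n powr (1 / 100)"
    using exponential_omega_bound[of 64 "1 / 100"] by auto
  show ?thesis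
  proof (intro exI[of _ K] conjI allI impI K(1))
    fix p assume "prime p \<and> real p powr (1 / 100) \<ge> 13"
    then have p: "prime p" and u: "real p powr (1 / 100) \<ge> 13" by auto
    have p1: "p > 1" using p by (rule prime_gt_1_nat)
    have "(64 :: real) ^ card (prime_factors (p - 1)) \<le> K * real (p - 1) powr (1 / 100)" using p1 by (intro K(2)) simp
    also have "\<dots> \<le> K * real p powr (1 / 100)" using K(1) by (intro mult_left_mono powr_mono2) auto
    finally show "(64 :: real) ^ card (prime_factors (p - 1)) \<le> K * real p powr (1 / 100)" .
    have "real p = (real p powr (1 / 100)) ^ 100" using p1 by (simp add: powr_realpow[symmetric] powr_powr)
    then show "\<bar>real (N2 3 p) - sqfree_triple_const * (real (totient (p - 1)) / real (p - 1)) ^ 3 * real p\<bar>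
       \<le> 8 ^ card (prime_factors (p - 1)) * (57 * (real p powr (1 / 100)) ^ 98)"
      using sum_sqf3_power_residue3_bound[OF p _ u] by (intro N2_three_error[OF p]) auto
  qed
qed

lemma power_powr_inverse:
  assumes "x > 0"
  shows "(x ^ 100) powr (1 / 100) = (x :: real)"
proof -
  have "x ^ 100 = x powr 100" using powr_realpow[OF assms, of 100] by simp
  then show ?thesis using assms by (simp only: powr_powr) simp
qed

lemma eventually_powr_ge: "eventually (\<lambda>p :: nat. real p powr (1 / 100) \<ge> c) at_top"
proof -
  obtain N :: nat where N: "(max c 1) ^ 100 \<le> real N" using real_arch_simple by blast
  have "c \<le> real p powr (1 / 100)" if "p \<ge> N" for p
  proof -
    have "c \<le> max c 1" by simp
    also have "\<dots> = ((max c 1) ^ 100) powr (1 / 100)" by (rule power_powr_inverse[symmetric]) auto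
    also have "\<dots> \<le> real p powr (1 / 100)" using N that by (intro powr_mono2) auto
    finally show ?thesis .
  qed
  then show ?thesis by (auto simp: eventually_at_top_linorder)
qed

theorem theorem17p3:
  shows "(\<exists>p0. \<forall>p::nat. prime p \<and> p \<ge> p0 \<longrightarrow>
            (\<exists>n<p. sqfree_primroot p n \<and> sqfree_primroot p (n + 1) \<and> sqfree_primroot p (n + 2)))
       \<and> (\<exists>\<epsilon>0>0. \<forall>\<epsilon>::real. 0 < \<epsilon> \<and> \<epsilon> < \<epsilon>0 \<longrightarrow>
            (\<lambda>p. real (N2 3 p)
                 - sqfree_triple_const * (real (totient (p - 1)) / real (p - 1)) ^ 3 * real p)
              \<in> O[primes_at_top](\<lambda>p. real p powr (1 - \<epsilon>)))"
proof -
  obtain K where K: "K > 0" and bounds: "\<And>p. prime p \<Longrightarrow> real p powr (1 / 100) \<ge> 13 \<Longrightarrow>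
     64 ^ card (prime_factors (p - 1)) \<le> K * real p powr (1 / 100) \<and>
     \<bar>real (N2 3 p) - sqfree_triple_const * (real (totient (p - 1)) / real (p - 1)) ^ 3 * real p\<bar>
       \<le> 8 ^ card (prime_factors (p - 1)) * (57 * (real p powr (1 / 100)) ^ 98)"
    using N2_three_asymptotics by blast
  define C where "C = sqfree_triple_const"
  have C: "C > 0" unfolding C_def by (rule sqfree_triple_const_bounds)
  have exist: "\<exists>n<p. sqfree_primroot p n \<and> sqfree_primroot p (n + 1) \<and> sqfree_primroot p (n + 2)"
    if p: "prime p" and u13: "real p powr (1 / 100) \<ge> 13" and uK: "real p powr (1 / 100) \<ge> 57 * K / C + 1" for p
  proof -
    define u where "u = real p powr (1 / 100)"
    define W where "W = (2 :: real) ^ card (prime_factors (p - 1))"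
    have p1: "p > 1" using p by (rule prime_gt_1_nat)
    have W: "W > 0" "W ^ 3 = 8 ^ card (prime_factors (p - 1))" "W ^ 6 = 64 ^ card (prime_factors (p - 1))"
      by (simp_all add: W_def power_mult[symmetric] mult.commute power_mult)
    have pu: "real p = u ^ 100" using p1 by (simp add: u_def powr_realpow[symmetric] powr_powr)
    have u: "u > 0" using p1 by (simp add: u_def)
    have b1: "W ^ 6 \<le> K * u" and b2: "\<bar>real (N2 3 p) - C * (real (totient (p - 1)) / real (p - 1)) ^ 3 * real p\<bar> \<le> W ^ 3 * (57 * u ^ 98)"
      using bounds[OF p u13] by (simp_all add: W u_def C_def)
    \<comment> \<open>Error times the inverse of the totient bound is
      \<open>57 * W ^ 6 * u ^ 98\<close>, at most \<open>57 * K * u ^ 99\<close>, which drops below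
      \<open>C * u ^ 100\<close> from here on.\<close>
    have "57 * K < C * u" using uK C by (simp add: u_def field_simps)
    then have "57 * K * u < C * u * u" using u by simp
    then have "57 * W ^ 6 < C * u\<^sup>2" using b1 by (simp add: power2_eq_square)
    then have "57 * W ^ 6 * u ^ 98 < C * u\<^sup>2 * u ^ 98" using u by simp
    also have "\<dots> = C * real p" unfolding pu by (simp flip: power_add)
    finally have "W ^ 3 * (57 * u ^ 98) * W ^ 3 < C * real p" by (simp add: mult_ac flip: power_add)
    then have "W ^ 3 * (57 * u ^ 98) < C * (1 / W) ^ 3 * real p" using W(1) by (simp add: power_divide pos_less_divide_eq)
    also have "\<dots> \<le> C * (real (totient (p - 1)) / real (p - 1)) ^ 3 * real p"
      using totient_ratio_ge[of "p - 1"] p1 C W(1) unfolding W_def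
      by (intro mult_right_mono mult_left_mono power_mono) auto
    finally have "real (N2 3 p) > 0" using b2 by linarith
    then have "{n. n < p \<and> (\<forall>i<3. sqfree_primroot p (n + i))} \<noteq> {}" by (auto simp: N2_def card_gt_0_iff)
    then obtain n where n: "n < p" "\<And>i. i < 3 \<Longrightarrow> sqfree_primroot p (n + i)" by auto
    then show ?thesis using n(2)[of 0] n(2)[of 1] n(2)[of 2] by auto
  qed
  have "\<exists>p0. \<forall>p\<ge>p0. real p powr (1 / 100) \<ge> 13 \<and> real p powr (1 / 100) \<ge> 57 * K / C + 1"
    using eventually_conj[OF eventually_powr_ge[of 13] eventually_powr_ge[of "57 * K / C + 1"]]
    by (simp add: eventually_at_top_linorder)
  then have first: "\<exists>p0. \<forall>p::nat. prime p \<and> p \<ge> p0 \<longrightarrow>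
            (\<exists>n<p. sqfree_primroot p n \<and> sqfree_primroot p (n + 1) \<and> sqfree_primroot p (n + 2))"
    using exist by blast
  \<comment> \<open>One of the two saved powers of \<open>u\<close> pays for the factor
    \<open>8 ^ card (prime_factors (p - 1))\<close>; the other leaves
    \<open>u ^ 99 = p powr (99 / 100)\<close>, whence the range of
    \<open>\<epsilon>\<close>.\<close>
  have second: "(\<lambda>p. real (N2 3 p) - sqfree_triple_const * (real (totient (p - 1)) / real (p - 1)) ^ 3 * real p)
              \<in> O[primes_at_top](\<lambda>p. real p powr (1 - \<epsilon>))" if \<epsilon>: "0 < \<epsilon>" "\<epsilon> < 1 / 100" for \<epsilon> :: real
  proof (rule bigoI[where c = "57 * K"])
    have "eventually (\<lambda>p. prime p \<longrightarrow>
        norm (real (N2 3 p) - sqfree_triple_const * (real (totient (p - 1)) / real (p - 1)) ^ 3 * real p)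
          \<le> 57 * K * norm (real p powr (1 - \<epsilon>))) at_top"
      using eventually_powr_ge[of 13]
    proof eventually_elim
      case (elim p)
      show ?case
      proof
        assume p: "prime p"
        define u where "u = real p powr (1 / 100)"
        have p1: "p > 1" using p by (rule prime_gt_1_nat)
        have u: "u > 0" using p1 by (simp add: u_def)
        have "8 ^ card (prime_factors (p - 1)) \<le> (64 :: real) ^ card (prime_factors (p - 1))" by (intro power_mono) auto
        also have "\<dots> \<le> K * u" using bounds[OF p elim] by (simp add: u_def)
        finally have w: "8 ^ card (prime_factors (p - 1)) \<le> K * u" .
        have "\<bar>real (N2 3 p) - sqfree_triple_const * (real (totient (p - 1)) / real (p - 1)) ^ 3 * real p\<bar>
            \<le> 8 ^ card (prime_factors (p - 1)) * (57 * u ^ 98)" using bounds[OF p elim] by (simp add: u_def)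
        also have "\<dots> \<le> K * u * (57 * u ^ 98)" using w u by (intro mult_right_mono) auto
        also have "\<dots> = 57 * K * u ^ 99" by (simp add: power_numeral_reduce)
        also have "u ^ 99 = real p powr (99 / 100)" using p1 by (simp add: u_def powr_realpow[symmetric] powr_powr)
        also have "57 * K * \<dots> \<le> 57 * K * real p powr (1 - \<epsilon>)"
          using \<epsilon> p1 K by (intro mult_left_mono powr_mono) auto
        finally show "norm (real (N2 3 p) - sqfree_triple_const * (real (totient (p - 1)) / real (p - 1)) ^ 3 * real p)
          \<le> 57 * K * norm (real p powr (1 - \<epsilon>))" by simp
      qed
    qed
    then show "eventually (\<lambda>p. norm (real (N2 3 p) - sqfree_triple_const * (real (totient (p - 1)) / real (p - 1)) ^ 3 * real p)
          \<le> 57 * K * norm (real p powr (1 - \<epsilon>))) primes_at_top"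
      unfolding primes_at_top_def eventually_inf_principal by simp
  qed
  show ?thesis using first second by (intro conjI exI[of _ "1 / 100"]) auto
qed

end
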